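(* There exist functions $f,g\in A^2(\mathbb{D})$ such that $$b_{f,g}:=\sup_{z\in\mathbb{D}} B(|f|^2)(z)\,B(|g|^2)(z)<\infty,$$ but the Toeplitz product $T_fT_g^*$ is not bounded on $A^2(\mathbb{D})$.
   Context: $\mathbb{D}$ is the open unit disc, $dA$ is Lebesgue area measure normalized so that $A(\mathbb{D})=1$, and $A^2(\mathbb{D})$ is the (closed) subspace of $L^2(\mathbb{D},dA)$ consisting of analytic functions. $P_B$ denotes the Bergman projection, the orthogonal projection of $L^2(\mathbb{D},dA)$ onto $A^2(\mathbb{D})$, given by $P_Bf(z)=\int_{\mathbb{D}}\frac{f(\zeta)}{(1-\bar\zeta z)^2}\,dA(\zeta)$. For $f\in L^2(\mathbb{D})$, the (densely defined) Toeplitz operator on $A^2(\mathbb{D})$ is $T_fu=P_B(fu)$, and $T_g^*$ denotes the adjoint of $T_g$. The Berezin transform of an integrable function $h$ is $Bh(z)=\int_{\mathbb{D}}\frac{h(\zeta)(1-|z|^2)^2}{|1-\bar\zeta z|^4}\,dA(\zeta)$. *)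

theory Defs
  imports "HOL-Analysis.Analysis"
begin

definition dA :: "complex measure" where
  "dA = density (lebesgue_on (ball 0 1)) (\<lambda>_. ennreal (1 / pi))"

definition L2D :: "(complex \<Rightarrow> complex) set" where
  "L2D = {f. f \<in> borel_measurable dA \<and> integrable dA (\<lambda>z. (cmod (f z))\<^sup>2)}"

definition ipD :: "(complex \<Rightarrow> complex) \<Rightarrow> (complex \<Rightarrow> complex) \<Rightarrow> complex" where
  "ipD f h = (LINT z|dA. f z * cnj (h z))"

definition normD :: "(complex \<Rightarrow> complex) \<Rightarrow> real" where
  "normD f = sqrt (LINT z|dA. (cmod (f z))\<^sup>2)"

definition A2D :: "(complex \<Rightarrow> complex) set" where
  "A2D = {f \<in> L2D. f holomorphic_on ball 0 1}"

definition bergman_proj :: "(complex \<Rightarrow> complex) \<Rightarrow> complex \<Rightarrow> complex" where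
  "bergman_proj f z = (LINT \<zeta>|dA. f \<zeta> / (1 - cnj \<zeta> * z)\<^sup>2)"

definition toeplitz_dom :: "(complex \<Rightarrow> complex) \<Rightarrow> (complex \<Rightarrow> complex) set" where
  "toeplitz_dom f = {u \<in> A2D. (\<lambda>z. f z * u z) \<in> L2D}"

definition toeplitz :: "(complex \<Rightarrow> complex) \<Rightarrow> (complex \<Rightarrow> complex) \<Rightarrow> (complex \<Rightarrow> complex)" where
  "toeplitz f u = bergman_proj (\<lambda>z. f z * u z)"

definition toeplitz_adj_dom :: "(complex \<Rightarrow> complex) \<Rightarrow> (complex \<Rightarrow> complex) set" where
  "toeplitz_adj_dom g = {v \<in> A2D. \<exists>w \<in> A2D. \<forall>u \<in> toeplitz_dom g. ipD (toeplitz g u) v = ipD u w}"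

definition toeplitz_adj :: "(complex \<Rightarrow> complex) \<Rightarrow> (complex \<Rightarrow> complex) \<Rightarrow> (complex \<Rightarrow> complex)" where
  "toeplitz_adj g v = (SOME w. w \<in> A2D \<and> (\<forall>u \<in> toeplitz_dom g. ipD (toeplitz g u) v = ipD u w))"

definition toeplitz_prod_bounded :: "(complex \<Rightarrow> complex) \<Rightarrow> (complex \<Rightarrow> complex) \<Rightarrow> bool" where
  "toeplitz_prod_bounded f g \<longleftrightarrow>
     (\<exists>C. \<forall>v \<in> toeplitz_adj_dom g. toeplitz_adj g v \<in> toeplitz_dom f \<longrightarrow>
            normD (toeplitz f (toeplitz_adj g v)) \<le> C * normD v)"

definition berezin :: "(complex \<Rightarrow> real) \<Rightarrow> complex \<Rightarrow> real" where
  "berezin h z = (LINT \<zeta>|dA. h \<zeta> * (1 - (cmod z)\<^sup>2)\<^sup>2 / (cmod (1 - cnj \<zeta> * z)) ^ 4)"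

end

theory Submission
  imports Defs "HOL-Complex_Analysis.Complex_Analysis"
begin

text \<open>Let \<open>E\<close> be a self-similar Cantor set of dimension \<open>1/2\<close> on the unit circle with its natural
  measure \<open>\<mu>\<close>, and let \<open>\<delta>\<close> be the distance to \<open>E\<close>. The potential
  \<open>\<Phi>\<^sub>\<sigma>(z) = \<integral> (1 - \<bar>t z)\<^bsup>-\<sigma>\<^esup> d\<mu>(t)\<close> with \<open>0 < \<sigma> < 1\<close> takes values in a sector of the right half plane,
  hence is comparable in modulus to \<open>\<integral> |z - t|\<^bsup>-\<sigma>\<^esup> d\<mu>(t)\<close>, that is, to \<open>\<delta>\<^bsup>1/2 - \<sigma>\<^esup>\<close> if \<open>\<sigma> > 1/2\<close> and to
  \<open>L = log (1/\<delta>)\<close> if \<open>\<sigma> = 1/2\<close>. Take \<open>f = \<Phi>\<^bsub>3/4\<^esub>\<^bsup>-3\<^esup>\<close> and \<open>g = \<Phi>\<^bsub>3/4\<^esub>\<^bsup>3\<^esup> \<Phi>\<^bsub>1/2\<^esub>\<^bsup>-3/4\<^esup>\<close>, so that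
  \<open>|f|\<^sup>2\<close> is of size \<open>\<delta>\<^bsup>3/2\<^esup>\<close> and \<open>|g|\<^sup>2\<close> of size \<open>\<delta>\<^bsup>-3/2\<^esup> L\<^bsup>-3/2\<^esup>\<close>. The latter is summable over scales,
  and the Berezin transforms at \<open>z\<close> are at most of order \<open>\<delta>(z)\<^bsup>3/2\<^esup>\<close> and \<open>\<delta>(z)\<^bsup>-3/2\<^esup>\<close>.

  If the product were bounded, duality would give \<open>\<parallel>g P \<phi>\<parallel> \<le> C \<parallel>\<phi> / f\<parallel>\<close> for all \<open>\<phi>\<close>. For
  \<open>G = \<Phi>\<^bsub>1/2\<^esub>\<^bsup>1/4\<^esup>\<close> and \<open>\<phi> = (1 - |z|\<^sup>2) (2 G + z G')\<close> one has \<open>P \<phi> = G\<close> and \<open>|\<phi>| \<le> C L\<^bsup>-3/4\<^esup>\<close>, so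
  \<open>|\<phi> / f|\<^sup>2\<close> is of size at most \<open>\<delta>\<^bsup>-3/2\<^esup> L\<^bsup>-3/2\<^esup>\<close>, which is integrable, whereas \<open>|g G|\<^sup>2\<close> is of size
  \<open>\<delta>\<^bsup>-3/2\<^esup> L\<^bsup>-1\<^esup>\<close>, which is not.\<close>

section \<open>A Cantor set of dimension one half\<close>

text \<open>One count fixes the numbers. The points at distance about 4^-m from a set of dimension
  1/2 fill an area of about 2^m * 16^-m = 8^-m. For the weight \<delta>^(-3/2) all scales therefore
  contribute equally, and only powers of L decide between convergence and divergence. The Berezin
  condition is blind to these powers: any summable choice for |g|^2 passes. The operator is not
  blind. Differentiating a power of L and multiplying by 1 - |z|^2, which is at most of order
  \<delta>, gains a full factor L, so |\<phi>| is smaller than |G| by that factor. The powers -3/4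
  and 1/4 make |g|^2 and |\<phi> / f|^2 obey one and the same bound, with scale sums of m^(-3/2),
  while |g G|^2 gives exactly the harmonic series.

  The order 3/4 lies above 1/2, where the finest scale starts to dominate a potential, and below 1,
  where the sector argument stops. Its sixth power has size \<delta>^(-3/2).

  All sizes are expressed through an integer level N with \<delta> comparable to 4^-N:
  \<delta>^(-3/2) becomes 8^N and L becomes N + 1.\<close>

definition cantor_angle :: "real \<Rightarrow> real" where
  "cantor_angle x = (\<Sum>k. real_of_int \<lfloor>2 ^ k * x\<rfloor> / 4 ^ k)"

text \<open>For x in [0,1) with binary digits b_j the angle is 2 * (sum of b_j / 4^j), so up to
  countably many points the image is the Cantor set with base 4 digits 0 and 2, of dimension log 2 /
  log 4. Writing the angle with floors makes its monotonicity, and hence its measurability,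
  immediate. The measure \<mu> is the image of Lebesgue measure on [0,1).\<close>

definition cantor_point :: "real \<Rightarrow> complex" where
  "cantor_point x = cis (cantor_angle x)"

lemma norm_cantor_point [simp]: "cmod (cantor_point x) = 1"
  by (simp add: cantor_point_def)

lemma summable_cantor_angle: "summable (\<lambda>k. real_of_int \<lfloor>2 ^ k * (x::real)\<rfloor> / 4 ^ k)"
proof (rule summable_comparison_test')
  show "summable (\<lambda>k. (\<bar>x\<bar> + 1) * (1/2::real) ^ k)"
    by (intro summable_mult summable_geometric) auto
  show "norm (real_of_int \<lfloor>2 ^ k * x\<rfloor> / 4 ^ k) \<le> (\<bar>x\<bar> + 1) * (1/2) ^ k" if "k \<ge> 0" for k
  proof -
    have "\<bar>real_of_int \<lfloor>2 ^ k * x\<rfloor>\<bar> \<le> \<bar>2 ^ k * x\<bar> + 1"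
      by linarith
    also have "\<dots> \<le> 2 ^ k * (\<bar>x\<bar> + 1)"
      by (simp add: abs_mult algebra_simps)
    finally have "\<bar>real_of_int \<lfloor>2 ^ k * x\<rfloor>\<bar> / 4 ^ k \<le> 2 ^ k * (\<bar>x\<bar> + 1) / 4 ^ k"
      by (simp add: divide_right_mono)
    also have "\<dots> = (\<bar>x\<bar> + 1) * (2/4) ^ k"
      by (simp only: power_divide) simp
    finally show ?thesis by simp
  qed
qed

text \<open>The floor at level n determines all coarser floors, so the series agree up to index n.
  Beyond it the floors at index n + 1 + k differ by at most 2^(k+1), and the resulting geometric
  series sums to exactly 4^-n.\<close>

lemma cantor_angle_same:
  assumes "\<lfloor>2 ^ n * x\<rfloor> = \<lfloor>2 ^ n * y\<rfloor>"
  shows "\<bar>cantor_angle x - cantor_angle y\<bar> \<le> 1 / 4 ^ n"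
proof -
  define d where "d k = real_of_int \<lfloor>2 ^ k * x\<rfloor> / 4 ^ k - real_of_int \<lfloor>2 ^ k * y\<rfloor> / 4 ^ k" for k
  have sd: "summable d"
    unfolding d_def by (intro summable_diff summable_cantor_angle)
  have low: "d k = 0" if "k \<le> n" for k
  proof -
    have *: "\<lfloor>2 ^ k * z\<rfloor> = \<lfloor>2 ^ n * z\<rfloor> div 2 ^ (n - k)" for z :: real
    proof -
      have "2 ^ k * z = (2 ^ n * z) / real_of_int (2 ^ (n - k))"
        using that power_add[of "2::real" k "n - k"] by (simp add: field_simps)
      then show ?thesis by (metis floor_divide_real_eq_div zero_le_numeral zero_le_power)
    qed
    show ?thesis
      unfolding d_def using assms by (simp add: *)
  qed
  have high: "\<bar>d (k + Suc n)\<bar> \<le> (1/2) ^ k * (1 / (2 * 4 ^ n))" for k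
  proof -
    have "\<bar>2 ^ n * x - 2 ^ n * y\<bar> < 1"
      using assms by linarith
    then have "2 ^ Suc k * \<bar>2 ^ n * x - 2 ^ n * y\<bar> < 2 ^ Suc k * 1"
      by (intro mult_strict_left_mono) auto
    moreover have "2 ^ Suc k * \<bar>2 ^ n * x - 2 ^ n * y\<bar> = \<bar>2 ^ (k + Suc n) * x - 2 ^ (k + Suc n) * y\<bar>"
      proof -
      have "2 ^ (k + Suc n) * x - 2 ^ (k + Suc n) * y = 2 ^ Suc k * (2 ^ n * x - 2 ^ n * y)"
        by (simp add: power_add algebra_simps)
      then show ?thesis by (simp only: abs_mult) simp
    qed
    ultimately have "\<bar>2 ^ (k + Suc n) * x - 2 ^ (k + Suc n) * y\<bar> < real_of_int (2 ^ Suc k)"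
      by (metis mult_1_right of_int_numeral of_int_power)
    then have "\<bar>\<lfloor>2 ^ (k + Suc n) * x\<rfloor> - \<lfloor>2 ^ (k + Suc n) * y\<rfloor>\<bar> \<le> 2 ^ Suc k"
      by linarith
    then have "\<bar>real_of_int \<lfloor>2 ^ (k + Suc n) * x\<rfloor> - real_of_int \<lfloor>2 ^ (k + Suc n) * y\<rfloor>\<bar> \<le> 2 ^ Suc k"
      by (metis of_int_abs of_int_diff of_int_le_iff of_int_numeral of_int_power)
    then have "\<bar>d (k + Suc n)\<bar> \<le> 2 ^ Suc k / 4 ^ (k + Suc n)"
      unfolding d_def diff_divide_distrib[symmetric] abs_divide
      by (metis abs_of_nonneg divide_right_mono zero_le_numeral zero_le_power)
    also have "\<dots> = (2/4) ^ k * (1 / (2 * 4 ^ n))"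
      by (simp only: power_divide) (simp add: power_add)
    finally show ?thesis by simp
  qed
  have "cantor_angle x - cantor_angle y = suminf d"
    unfolding d_def cantor_angle_def by (rule suminf_diff[OF summable_cantor_angle summable_cantor_angle])
  also have "\<dots> = (\<Sum>k. d (k + Suc n)) + (\<Sum>k<Suc n. d k)"
    by (rule suminf_split_initial_segment[OF sd])
  also have "(\<Sum>k<Suc n. d k) = 0"
    using low by (intro sum.neutral) auto
  finally have e: "cantor_angle x - cantor_angle y = (\<Sum>k. d (k + Suc n))" by simp
  have s: "(\<lambda>k. (1/2) ^ k * (1 / (2 * 4 ^ n))) sums (2 * (1 / (2 * 4 ^ n)) :: real)"
    using geometric_sums[of "1/2::real"] by (intro sums_mult2) simp
  have "norm (\<Sum>k. d (k + Suc n)) \<le> (\<Sum>k. (1/2) ^ k * (1 / (2 * 4 ^ n)))"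
    using high sums_summable[OF s] by (intro norm_suminf_le) auto
  also have "\<dots> = 1 / 4 ^ n" using sums_unique[OF s] by simp
  finally show ?thesis by (simp add: e)
qed

lemma mono_cantor_angle: "x \<le> y \<Longrightarrow> cantor_angle x \<le> cantor_angle y"
  unfolding cantor_angle_def
  by (intro suminf_le summable_cantor_angle divide_right_mono) (auto intro!: floor_mono mult_left_mono)

text \<open>By monotonicity every term of the difference series is nonnegative, so the single term
  of index n already gives the bound. Together with \<open>cantor_angle_same\<close> this makes
  distance 4^-n in the Cantor set correspond to agreement in a dyadic interval of length
  2^-n.\<close>

lemma cantor_angle_diff:
  assumes "\<lfloor>2 ^ n * x\<rfloor> < \<lfloor>2 ^ n * y\<rfloor>"
  shows "cantor_angle y - cantor_angle x \<ge> 1 / 4 ^ n"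
proof -
  have xy: "x \<le> y"
  proof (rule ccontr)
    assume "\<not> x \<le> y"
    then have "\<lfloor>2 ^ n * y\<rfloor> \<le> \<lfloor>2 ^ n * x\<rfloor>" by (intro floor_mono) auto
    with assms show False by simp
  qed
  define d where "d k = real_of_int \<lfloor>2 ^ k * y\<rfloor> / 4 ^ k - real_of_int \<lfloor>2 ^ k * x\<rfloor> / 4 ^ k" for k
  have d0: "d k \<ge> 0" for k
    unfolding d_def using xy by (auto intro!: divide_right_mono floor_mono mult_left_mono)
  have sd: "summable d"
    unfolding d_def by (intro summable_diff summable_cantor_angle)
  have "real_of_int \<lfloor>2 ^ n * y\<rfloor> - real_of_int \<lfloor>2 ^ n * x\<rfloor> \<ge> 1" using assms by linarith
  then have "1 / 4 ^ n \<le> d n"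
    unfolding d_def by (simp add: diff_divide_distrib[symmetric] divide_right_mono)
  also have "\<dots> = (\<Sum>k\<in>{n}. d k)" by simp
  also have "\<dots> \<le> suminf d" using d0 sd by (intro sum_le_suminf) auto
  also have "\<dots> = cantor_angle y - cantor_angle x"
    unfolding d_def cantor_angle_def by (rule suminf_diff[OF summable_cantor_angle summable_cantor_angle, symmetric])
  finally show ?thesis .
qed

lemma dist_cis: "cmod (cis a - cis b) = 2 * \<bar>sin ((a - b) / 2)\<bar>"
proof -
  have "cis a - cis b = cis b * (cis (a - b) - 1)"
    by (simp add: algebra_simps cis_mult)
  then show ?thesis
    using dist_exp_i_1[of "a - b"] by (simp add: norm_mult cis_conv_exp)
qed

lemma dist_cis_ge:
  assumes "\<bar>a - b\<bar> \<le> 1"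
  shows "\<bar>a - b\<bar> / 2 \<le> cmod (cis a - cis b)"
proof -
  define x where "x = (a - b) / 2"
  have x: "\<bar>x\<bar> \<le> 1" using assms by (simp add: x_def)
  have "\<bar>sin x - (\<Sum>m<3. sin_coeff m * x ^ m)\<bar> \<le> inverse (fact 3) * \<bar>x\<bar> ^ 3"
    by (rule Maclaurin_sin_bound)
  then have "\<bar>sin x - x\<bar> \<le> \<bar>x\<bar> ^ 3 / 6"
    by (simp add: sin_coeff_def numeral_3_eq_3 fact_numeral)
  also have "\<bar>x\<bar> ^ 3 \<le> \<bar>x\<bar>"
    using power_decreasing[of 1 3 "\<bar>x\<bar>"] x by simp
  finally have "\<bar>sin x\<bar> \<ge> \<bar>x\<bar> / 2" by linarith
  then show ?thesis unfolding dist_cis x_def by simp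
qed

lemma dist_cis_le: "cmod (cis a - cis b) \<le> \<bar>a - b\<bar>"
  unfolding dist_cis using abs_sin_x_le_abs_x[of "(a - b) / 2"] by simp

lemma cantor_point_near:
  "\<lfloor>2 ^ n * x\<rfloor> = \<lfloor>2 ^ n * y\<rfloor> \<Longrightarrow> cmod (cantor_point x - cantor_point y) \<le> 1 / 4 ^ n"
  using cantor_angle_same[of n x y] dist_cis_le order_trans unfolding cantor_point_def by blast

lemma cantor_point_near_imp_same:
  assumes "x \<in> {0..<1}" "y \<in> {0..<1}" and "cmod (cantor_point x - cantor_point y) < 1 / (2 * 4 ^ n)"
  shows "\<lfloor>2 ^ n * x\<rfloor> = \<lfloor>2 ^ n * y\<rfloor>"
proof -
  have "\<lfloor>2 ^ 0 * x\<rfloor> = \<lfloor>2 ^ 0 * y\<rfloor>"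
    using assms(1,2) floor_eq_iff[of x 0] floor_eq_iff[of y 0] by simp
  then have "\<bar>cantor_angle x - cantor_angle y\<bar> \<le> 1"
    using cantor_angle_same[of 0 x y] by simp
  from dist_cis_ge[OF this] assms(3) have *: "\<bar>cantor_angle x - cantor_angle y\<bar> < 1 / 4 ^ n"
    unfolding cantor_point_def by simp
  show ?thesis
    using cantor_angle_diff[of n x y] cantor_angle_diff[of n y x] *
    by (cases "\<lfloor>2 ^ n * x\<rfloor>" "\<lfloor>2 ^ n * y\<rfloor>" rule: linorder_cases) linarith+
qed

section \<open>The Cantor measure and its mass in small discs\<close>

definition unit_leb :: "real measure" where
  "unit_leb = restrict_space lborel {0..<1}"

lemma space_unit_leb [simp]: "space unit_leb = {0..<1}"
  by (simp add: unit_leb_def space_restrict_space)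

lemma measurable_unit_leb: "f \<in> borel_measurable borel \<Longrightarrow> f \<in> borel_measurable unit_leb"
  unfolding unit_leb_def by (rule measurable_restrict_space1) simp

lemma emeasure_unit_leb: "A \<in> sets borel \<Longrightarrow> A \<subseteq> {0..<1} \<Longrightarrow> emeasure unit_leb A = emeasure lborel A"
  unfolding unit_leb_def by (subst emeasure_restrict_space) auto

interpretation unit_leb: finite_measure unit_leb
  by standard (simp add: emeasure_unit_leb)

lemma measure_unit_leb_space [simp]: "measure unit_leb {0..<1} = 1"
  by (simp add: measure_def emeasure_unit_leb)

lemma borel_measurable_cantor_angle [measurable]: "cantor_angle \<in> borel_measurable borel"
  by (rule borel_measurable_mono) (auto intro: monoI mono_cantor_angle)

lemma borel_measurable_cantor_point [measurable]: "cantor_point \<in> borel_measurable borel"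
proof -
  have "continuous_on UNIV cis" by (simp add: cis_conv_exp[abs_def] continuous_intros)
  then have "cis \<in> borel_measurable borel" by (rule borel_measurable_continuous_onI)
  from measurable_compose[OF borel_measurable_cantor_angle this] show ?thesis
    unfolding cantor_point_def[abs_def] .
qed

lemmas measurable_unit_leb_cantor_point [measurable] = measurable_unit_leb[OF borel_measurable_cantor_point]

text \<open>This is \<mu> of the closed disc of radius 3 / 4^m about z. The two bounds below, both
  of order 2^-m, express that \<mu> is regular of dimension 1/2.\<close>

definition near_mass :: "nat \<Rightarrow> complex \<Rightarrow> real" where
  "near_mass m z = measure unit_leb {x \<in> {0..<1}. cmod (z - cantor_point x) \<le> 3 / 4 ^ m}"

lemma sets_near [measurable]: "{x \<in> {0..<1}. cmod (z - cantor_point x) \<le> r} \<in> sets borel"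
  by measurable

lemma sets_near' [measurable]: "{x \<in> {0..<1}. cmod (z - cantor_point x) \<le> r} \<in> sets unit_leb"
proof -
  have "{x \<in> space unit_leb. cmod (z - cantor_point x) \<le> r} \<in> sets unit_leb" by measurable
  then show ?thesis by simp
qed

lemma dyadic_interval:
  "{x::real. \<lfloor>2 ^ n * x\<rfloor> = j} = {real_of_int j / 2 ^ n ..< (real_of_int j + 1) / 2 ^ n}"
  by (auto simp: floor_eq_iff divide_le_eq less_divide_eq mult.commute)

lemma emeasure_dyadic_interval:
  "emeasure lborel {x::real. \<lfloor>2 ^ n * x\<rfloor> = j} = ennreal (1 / 2 ^ n)"
proof -
  have "real_of_int j / 2 ^ n \<le> (real_of_int j + 1) / 2 ^ n"
    by (simp add: divide_right_mono)
  then show ?thesis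
    unfolding dyadic_interval by (subst emeasure_lborel_Ico) (simp_all add: add_divide_distrib)
qed

lemma near_mass_le: "near_mass m z \<le> 4 / 2 ^ m"
proof (cases "m < 2")
  case True
  then have "m = 0 \<or> m = 1" by auto
  moreover have "near_mass m z \<le> 1"
    unfolding near_mass_def using unit_leb.bounded_measure by (metis measure_unit_leb_space space_unit_leb)
  ultimately show ?thesis by auto
next
  case False
  then obtain n where n: "m = Suc (Suc n)" by (metis add_2_eq_Suc le_Suc_ex linorder_not_less)
  let ?S = "{x \<in> {0..<1}. cmod (z - cantor_point x) \<le> 3 / 4 ^ m}"
  show ?thesis
  proof (cases "?S = {}")
    case True
    then show ?thesis by (simp only: near_mass_def) simp
  next
    case False
    then obtain y where y: "y \<in> {0..<1}" "cmod (z - cantor_point y) \<le> 3 / 4 ^ m" by auto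
    have "?S \<subseteq> {x::real. \<lfloor>2 ^ n * x\<rfloor> = \<lfloor>2 ^ n * y\<rfloor>}"
    proof clarify
      fix x :: real assume x: "x \<in> {0..<1}" "cmod (z - cantor_point x) \<le> 3 / 4 ^ m"
      have "cmod (cantor_point x - cantor_point y) \<le> cmod (z - cantor_point y) + cmod (z - cantor_point x)"
        using norm_triangle_ineq4[of "z - cantor_point y" "z - cantor_point x"] by simp
      also have "\<dots> \<le> 6 / 4 ^ m" using x y by simp
      \<comment> \<open>Here m = n + 2, so the diameter 6 / 4^m equals (3/8) / 4^n. Giving up two
        generations is what brings it below the separation threshold, and it costs the factor 4 in
        the bound.\<close>
      also have "\<dots> < 1 / (2 * 4 ^ n)" by (simp add: n field_simps)
      finally show "\<lfloor>2 ^ n * x\<rfloor> = \<lfloor>2 ^ n * y\<rfloor>"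
        using x y by (intro cantor_point_near_imp_same)
    qed
    then have "emeasure lborel ?S \<le> emeasure lborel {x::real. \<lfloor>2 ^ n * x\<rfloor> = \<lfloor>2 ^ n * y\<rfloor>}"
      unfolding dyadic_interval by (intro emeasure_mono) auto
    also have "\<dots> = ennreal (1 / 2 ^ n)"
      by (rule emeasure_dyadic_interval)
    finally have "emeasure unit_leb ?S \<le> ennreal (1 / 2 ^ n)"
      by (subst emeasure_unit_leb[OF sets_near]) auto
    then have "near_mass m z \<le> 1 / 2 ^ n"
      unfolding near_mass_def measure_def by (intro enn2real_leI) auto
    then show ?thesis by (simp add: n)
  qed
qed

text \<open>The dyadic interval of generation m around x has measure 2^-m and its image stays within
  4^-m of \<open>cantor_point x\<close>. This explains the radii: 2 + 1 = 3.\<close>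

lemma near_mass_ge:
  assumes "x \<in> {0..<1}" "cmod (z - cantor_point x) \<le> 2 / 4 ^ m"
  shows "near_mass m z \<ge> 1 / 2 ^ m"
proof -
  let ?S = "{x \<in> {0..<1}. cmod (z - cantor_point x) \<le> 3 / 4 ^ m}"
  let ?J = "{y::real. \<lfloor>2 ^ m * y\<rfloor> = \<lfloor>2 ^ m * x\<rfloor>}"
  have "?J \<subseteq> {0..<1}"
  proof
    fix y assume "y \<in> ?J"
    moreover have "\<lfloor>2 ^ m * x\<rfloor> \<ge> 0" "\<lfloor>2 ^ m * x\<rfloor> < 2 ^ m"
      using assms(1) by (auto simp: floor_less_iff)
    ultimately have "\<lfloor>2 ^ m * y\<rfloor> \<ge> 0" "\<lfloor>2 ^ m * y\<rfloor> < 2 ^ m" by auto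
    then have "0 \<le> 2 ^ m * y" "2 ^ m * y < 2 ^ m * 1" by (simp_all add: floor_less_iff)
    then show "y \<in> {0..<1}"
      using mult_pos_neg[of "2 ^ m" y] by (cases "y < 0") auto
  qed
  moreover have "cmod (z - cantor_point y) \<le> 3 / 4 ^ m" if "y \<in> ?J" for y
  proof -
    have "cmod (z - cantor_point y) \<le> cmod (z - cantor_point x) + cmod (cantor_point x - cantor_point y)"
      using norm_triangle_ineq[of "z - cantor_point x" "cantor_point x - cantor_point y"] by simp
    also have "\<dots> \<le> 2 / 4 ^ m + 1 / 4 ^ m"
      using assms(2) that by (intro add_mono cantor_point_near) auto
    finally show ?thesis by simp
  qed
  ultimately have "?J \<subseteq> ?S" by auto
  then have "emeasure lborel ?J \<le> emeasure lborel ?S" by (intro emeasure_mono) auto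
  moreover have "emeasure lborel ?J = ennreal (1 / 2 ^ m)"
    by (rule emeasure_dyadic_interval)
  ultimately have "ennreal (1 / 2 ^ m) \<le> emeasure unit_leb ?S"
    by (subst emeasure_unit_leb[OF sets_near]) auto
  then show ?thesis
    unfolding near_mass_def by (simp add: unit_leb.emeasure_eq_measure)
qed

text \<open>The integer logarithm N of the distance to the Cantor set: that distance lies between 1
  / (2 * 4^N) = 2 / 4^(N+1) and 2 / 4^N. For z in the disc the maximum is over a finite set, because
  z stays at distance at least 1 - |z| from the circle, and over a nonempty one, because no distance
  exceeds 2.\<close>

definition cantor_level :: "complex \<Rightarrow> nat" where
  "cantor_level z = Max {n. \<exists>x\<in>{0..<1}. cmod (z - cantor_point x) \<le> 2 / 4 ^ n}"

lemma dist_cantor_point_ge: "1 - cmod z \<le> cmod (z - cantor_point x)"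
  using norm_triangle_ineq2[of "cantor_point x" z] by (simp add: norm_minus_commute)

lemma cantor_level:
  assumes "cmod z < 1"
  shows "\<exists>x\<in>{0..<1}. cmod (z - cantor_point x) \<le> 2 / 4 ^ cantor_level z"
    and "x \<in> {0..<1} \<Longrightarrow> 1 / (2 * 4 ^ cantor_level z) < cmod (z - cantor_point x)"
proof -
  let ?T = "{n. \<exists>x\<in>{0..<1}. cmod (z - cantor_point x) \<le> 2 / 4 ^ n}"
  obtain k where k: "(1/4::real) ^ k < (1 - cmod z) / 2"
    using real_arch_pow_inv[of "(1 - cmod z) / 2" "1/4"] assms by auto
  have "?T \<subseteq> {..k}"
  proof
    fix n assume "n \<in> ?T"
    then obtain x where "cmod (z - cantor_point x) \<le> 2 / 4 ^ n" by blast
    with dist_cantor_point_ge[of z x] have "(1 - cmod z) / 2 \<le> (1/4) ^ n"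
      by (simp add: power_divide)
    with k have "(1/4::real) ^ k < (1/4) ^ n" by linarith
    then show "n \<in> {..k}" by (simp add: power_strict_decreasing_iff)
  qed
  then have fin: "finite ?T" by (rule finite_subset) simp
  have "cmod (z - cantor_point 0) \<le> 2 / 4 ^ 0"
    using norm_triangle_ineq4[of z "cantor_point 0"] assms by simp
  then have "0 \<in> ?T" by (intro CollectI bexI[of _ 0]) auto
  then have ne: "?T \<noteq> {}" by blast
  from Max_in[OF fin ne] show "\<exists>x\<in>{0..<1}. cmod (z - cantor_point x) \<le> 2 / 4 ^ cantor_level z"
    unfolding cantor_level_def by blast
  show "1 / (2 * 4 ^ cantor_level z) < cmod (z - cantor_point x)" if "x \<in> {0..<1}"
  proof (rule ccontr)
    assume "\<not> 1 / (2 * 4 ^ cantor_level z) < cmod (z - cantor_point x)"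
    then have "Suc (cantor_level z) \<in> ?T" using that by (auto intro!: bexI[of _ x])
    from Max_ge[OF fin this] show False by (simp add: cantor_level_def)
  qed
qed

lemma near_mass_ge_level: "cmod z < 1 \<Longrightarrow> m \<le> cantor_level z \<Longrightarrow> near_mass m z \<ge> 1 / 2 ^ m"
proof -
  assume "cmod z < 1" and m: "m \<le> cantor_level z"
  then obtain x where x: "x \<in> {0..<1}" "cmod (z - cantor_point x) \<le> 2 / 4 ^ cantor_level z"
    using cantor_level by blast
  note x(2)
  also have "2 / 4 ^ cantor_level z \<le> (2 / 4 ^ m :: real)"
    using m by (intro divide_left_mono power_increasing) auto
  finally show ?thesis using x near_mass_ge by blast
qed

lemma one_minus_norm_le_level: "cmod z < 1 \<Longrightarrow> 1 - cmod z \<le> 2 / 4 ^ cantor_level z"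
proof -
  assume "cmod z < 1"
  then obtain x where "cmod (z - cantor_point x) \<le> 2 / 4 ^ cantor_level z"
    using cantor_level(1) by blast
  with dist_cantor_point_ge[of z x] show ?thesis by linarith
qed

section \<open>The normalized area measure\<close>

text \<open>By Vitali covering, U is up to a null set a countable disjoint union of balls. A
  rotation carries balls to balls of the same radius, so the volume of a ball is the only measure
  that has to be known. Applying this to the inverse rotation as well turns the inequality into
  invariance.\<close>

lemma emeasure_open_le_rotate:
  fixes c :: complex
  assumes c: "cmod c = 1" and U: "open U"
  shows "emeasure lborel U \<le> emeasure lborel ((\<lambda>z. c * z) -` U)"
proof -
  let ?K = "{(x, r). r > 0 \<and> ball x r \<subseteq> U}"
  obtain C where C: "countable C" "C \<subseteq> ?K"
     "pairwise (\<lambda>i j. disjnt (ball (fst i) (snd i)) (ball (fst j) (snd j))) C"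
     "negligible (U - (\<Union>i \<in> C. ball (fst i) (snd i)))"
  proof (rule Vitali_covering_theorem_balls [of U ?K fst snd])
    fix x and d :: real assume "x \<in> U" "0 < d"
    with U obtain e where "e > 0" "ball x e \<subseteq> U" by (meson openE)
    with \<open>0 < d\<close> show "\<exists>i. i \<in> ?K \<and> x \<in> ball (fst i) (snd i) \<and> snd i < d"
      by (intro exI[of _ "(x, min e (d/2))"]) auto
  qed
  let ?B = "\<lambda>i::complex \<times> real. ball (fst i) (snd i)"
  let ?B' = "\<lambda>i::complex \<times> real. ball (cnj c * fst i) (snd i)"
  have cc: "c * cnj c = 1" using c by (metis complex_norm_square of_real_1 power_one)
  have pre: "(\<lambda>z. c * z) -` ball a r = ball (cnj c * a) r" for a r
  proof -
    have "dist a (c * z) = dist (cnj c * a) z" for z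
    proof -
      have "a - c * z = c * (cnj c * a - z)" using cc by (simp add: algebra_simps flip: mult.assoc)
      then show ?thesis using c by (simp add: dist_norm norm_mult)
    qed
    then show ?thesis by auto
  qed
  have "emeasure lborel U = emeasure lebesgue U" using U by simp
  also have "\<dots> = emeasure lebesgue (\<Union>i\<in>C. ?B i)"
  proof (rule emeasure_eq_AE)
    have "AE x in lebesgue. x \<notin> U - (\<Union>i \<in> C. ?B i)"
      using C(4) by (intro AE_not_in) (simp only: negligible_iff_null_sets)
    moreover have "(\<Union>i\<in>C. ?B i) \<subseteq> U" using C(2) by fastforce
    ultimately show "AE x in lebesgue. x \<in> U \<longleftrightarrow> x \<in> (\<Union>i\<in>C. ?B i)" 
      by (elim eventually_mono) blast
  next
    have "open (\<Union>i\<in>C. ?B i)" by blast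
    then show "(\<Union>i\<in>C. ?B i) \<in> sets lebesgue" by (simp only: borel_open sets_completionI_sets sets_lborel)
    show "U \<in> sets lebesgue" using U by (simp only: borel_open sets_completionI_sets sets_lborel)
  qed
  also have "\<dots> = emeasure lborel (\<Union>i\<in>C. ?B i)" by (simp add: open_UN)
  also have "\<dots> = (\<integral>\<^sup>+i. emeasure lborel (?B i) \<partial>count_space C)"
    using C(1,3) by (intro emeasure_UN_countable) (auto simp: disjoint_family_on_def pairwise_def disjnt_def)
  also have "\<dots> = (\<integral>\<^sup>+i. emeasure lborel (?B' i) \<partial>count_space C)"
    using C(2) by (intro nn_integral_cong) (auto simp: emeasure_ball)
  also have "\<dots> = emeasure lborel (\<Union>i\<in>C. ?B' i)"
  proof (intro emeasure_UN_countable[symmetric] C(1))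
    show "disjoint_family_on ?B' C"
      using C(3) unfolding disjoint_family_on_def pairwise_def disjnt_def pre[symmetric]
      by (metis vimage_Int vimage_empty)
  qed auto
  also have "\<dots> \<le> emeasure lborel ((\<lambda>z. c * z) -` U)"
  proof (rule emeasure_mono)
    show "(\<Union>i\<in>C. ?B' i) \<subseteq> (\<lambda>z. c * z) -` U" using C(2) unfolding pre[symmetric] by fastforce
    have "open ((\<lambda>z. c * z) -` U)" using U by (intro open_vimage continuous_intros)
    then show "(\<lambda>z. c * z) -` U \<in> sets lborel" by simp
  qed
  finally show ?thesis .
qed

lemma lborel_distr_rotate:
  fixes c :: complex
  assumes c: "cmod c = 1"
  shows "distr lborel borel (\<lambda>z. c * z) = lborel"
proof -
  have eq: "emeasure lborel ((\<lambda>z. c * z) -` U) = emeasure lborel U" if U: "open U" for U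
  proof (rule antisym)
    have o: "open ((\<lambda>z. c * z) -` U)" using U by (intro open_vimage continuous_intros)
    have cc: "c * (cnj c * z) = z" for z
      using c by (metis complex_norm_square mult.assoc mult_1 of_real_1 power_one)
    have "emeasure lborel ((\<lambda>z. c * z) -` U) \<le> emeasure lborel ((\<lambda>z. cnj c * z) -` (\<lambda>z. c * z) -` U)"
      using c o by (intro emeasure_open_le_rotate) auto
    also have "(\<lambda>z. cnj c * z) -` (\<lambda>z. c * z) -` U = U" by (auto simp: cc)
    finally show "emeasure lborel ((\<lambda>z. c * z) -` U) \<le> emeasure lborel U" .
    show "emeasure lborel U \<le> emeasure lborel ((\<lambda>z. c * z) -` U)"
      by (rule emeasure_open_le_rotate[OF c U])
  qed
  show ?thesis
  proof (rule measure_eqI_generator_eq[where E="{S. open S}" and \<Omega>=UNIV and A="\<lambda>n. ball 0 (real n)"])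
    show "emeasure (distr lborel borel (\<lambda>z. c * z)) X = emeasure lborel X" if "X \<in> {S. open S}" for X
      using that eq[of X] by (subst emeasure_distr) auto
    show "(\<Union>i. ball (0::complex) (real i)) = UNIV"
      by (auto simp: reals_Archimedean2)
    show "emeasure (distr lborel borel (\<lambda>z. c * z)) (ball 0 (real i)) \<noteq> \<infinity>" for i
      using eq[of "ball 0 (real i)"] by (subst emeasure_distr) (auto simp: emeasure_ball)
  qed (auto simp: Int_stable_def borel_def)
qed

lemma space_dA [simp]: "space dA = ball 0 1"
  by (simp add: dA_def)

lemma sets_dA [measurable_cong]: "sets dA = sets (lebesgue_on (ball 0 1))"
  by (simp add: dA_def)

lemma ident_measurable_dA [measurable]: "(\<lambda>z. z) \<in> borel_measurable dA"
  by (subst measurable_cong_sets[OF sets_dA refl])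
    (intro measurable_restrict_space1 measurable_completion, simp)

lemma borel_measurable_dA: "f \<in> borel_measurable borel \<Longrightarrow> f \<in> borel_measurable dA"
  using measurable_compose[OF ident_measurable_dA] by blast

lemma borel_measurable_dA_continuous_on:
  assumes "continuous_on (ball 0 1) f"
  shows "(f :: complex \<Rightarrow> 'b :: {real_normed_vector, second_countable_topology}) \<in> borel_measurable dA"
proof -
  have "(\<lambda>z. indicator (ball 0 1) z *\<^sub>R f z) \<in> borel_measurable dA"
    by (intro borel_measurable_dA borel_measurable_continuous_on_indicator assms) auto
  then show ?thesis by (rule measurable_cong[THEN iffD1, rotated]) auto
qed

lemma emeasure_dA: "A \<in> sets borel \<Longrightarrow> A \<subseteq> ball 0 1 \<Longrightarrow> emeasure dA A = ennreal (1 / pi) * emeasure lborel A"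
proof -
  assume A: "A \<in> sets borel" "A \<subseteq> ball 0 1"
  then have s: "A \<in> sets (lebesgue_on (ball 0 1))"
    by (auto simp: sets_restrict_space intro!: image_eqI[of _ _ A])
  have "emeasure dA A = ennreal (1 / pi) * emeasure (lebesgue_on (ball 0 1)) A"
    unfolding dA_def using s by (subst emeasure_density) (auto simp: nn_integral_cmult_indicator)
  also have "emeasure (lebesgue_on (ball 0 1)) A = emeasure lborel A"
    using A by (subst emeasure_restrict_space) auto
  finally show ?thesis .
qed

lemma emeasure_dA_ball:
  assumes "r \<ge> 0" "ball a r \<subseteq> ball 0 1"
  shows "emeasure dA (ball a r) = ennreal (r\<^sup>2)"
proof -
  have "emeasure dA (ball a r) = ennreal (1 / pi) * ennreal (pi * r\<^sup>2)"
    using assms by (simp add: emeasure_dA emeasure_ball unit_ball_vol_2)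
  also have "\<dots> = ennreal (r\<^sup>2)"
    using assms by (subst ennreal_mult[symmetric]) auto
  finally show ?thesis .
qed

lemma emeasure_dA_cball_le:
  assumes "r \<ge> 0"
  shows "emeasure dA {z \<in> ball 0 1. cmod (z - a) \<le> r} \<le> ennreal (r\<^sup>2)"
proof -
  have "emeasure dA {z \<in> ball 0 1. cmod (z - a) \<le> r} = ennreal (1 / pi) * emeasure lborel {z \<in> ball 0 1. cmod (z - a) \<le> r}"
    by (intro emeasure_dA) auto
  also have "emeasure lborel {z \<in> ball 0 1. cmod (z - a) \<le> r} \<le> emeasure lborel (cball a r)"
    by (intro emeasure_mono) (auto simp: dist_norm norm_minus_commute)
  also have "\<dots> = ennreal (pi * r\<^sup>2)"
    using assms by (simp add: emeasure_cball unit_ball_vol_2)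
  also have "ennreal (1 / pi) * ennreal (pi * r\<^sup>2) = ennreal (r\<^sup>2)"
    using assms by (subst ennreal_mult[symmetric]) auto
  finally show ?thesis by (simp add: mult_left_mono)
qed

interpretation dA: finite_measure dA
  using emeasure_dA_ball[of 1 0] by (intro finite_measureI) simp

lemma measure_dA_ball [simp]: "measure dA (ball 0 1) = 1"
  using emeasure_dA_ball[of 1 0] by (simp add: measure_def)

lemma distr_dA_rotate:
  assumes c: "cmod c = 1"
  shows "distr dA borel (\<lambda>z. c * z) = distr dA borel (\<lambda>z. z)"
proof (rule measure_eqI)
  fix A assume "A \<in> sets (distr dA borel (\<lambda>z. c * z))"
  then have A: "A \<in> sets borel" by simp
  have e: "(\<lambda>z. c * z) -` A \<inter> ball 0 1 = (\<lambda>z. c * z) -` (A \<inter> ball 0 1)"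
    using c by (auto simp: norm_mult)
  have m: "(\<lambda>z. c * z) \<in> borel_measurable dA" by measurable
  have "emeasure (distr dA borel (\<lambda>z. c * z)) A = emeasure dA ((\<lambda>z. c * z) -` A \<inter> ball 0 1)"
    using A m by (subst emeasure_distr) auto
  also have "\<dots> = ennreal (1 / pi) * emeasure lborel ((\<lambda>z. c * z) -` A \<inter> ball 0 1)"
    using A by (intro emeasure_dA) (auto intro!: sets.Int measurable_sets_borel[of _ borel])
  also have "emeasure lborel ((\<lambda>z. c * z) -` A \<inter> ball 0 1) = emeasure (distr lborel borel (\<lambda>z. c * z)) (A \<inter> ball 0 1)"
    using A unfolding e by (subst emeasure_distr) auto
  also have "\<dots> = emeasure lborel (A \<inter> ball 0 1)" by (simp add: lborel_distr_rotate[OF c])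
  also have "ennreal (1 / pi) * emeasure lborel (A \<inter> ball 0 1) = emeasure dA (A \<inter> ball 0 1)"
    using A by (intro emeasure_dA[symmetric]) auto
  also have "\<dots> = emeasure (distr dA borel (\<lambda>z. z)) A"
    using A by (subst emeasure_distr) auto
  finally show "emeasure (distr dA borel (\<lambda>z. c * z)) A = emeasure (distr dA borel (\<lambda>z. z)) A" .
qed simp

text \<open>The set where |z|^2 exceeds x in [0,1) has normalized area 1 - x, so the squared radius
  is uniformly distributed on [0,1]. With rotation invariance this takes the place of polar
  coordinates.\<close>

lemma distr_dA_norm_square:
  "distr dA borel (\<lambda>z. (cmod z)\<^sup>2) = distr (lebesgue_on {0..1}) borel (\<lambda>t::real. t)"
proof (rule measure_eqI_lessThan)
  have m: "(\<lambda>z. (cmod z)\<^sup>2) \<in> borel_measurable dA" by measurable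
  have m': "(\<lambda>t::real. t) \<in> borel_measurable (lebesgue_on {0..1})"
    by (intro measurable_restrict_space1 measurable_completion) simp
  fix x :: real
  have 1: "emeasure (distr dA borel (\<lambda>z. (cmod z)\<^sup>2)) {x<..} = emeasure dA {z \<in> ball 0 1. x < (cmod z)\<^sup>2}"
    using m by (subst emeasure_distr) (auto intro!: arg_cong[where f="emeasure dA"])
  then show "emeasure (distr dA borel (\<lambda>z. (cmod z)\<^sup>2)) {x<..} < \<infinity>"
    by (metis dA.emeasure_finite infinity_ennreal_def less_top)
  have 2: "emeasure (distr (lebesgue_on {0..1}) borel (\<lambda>t::real. t)) {x<..} = emeasure lborel ({x<..} \<inter> {0..1})"
  proof -
    have "emeasure (distr (lebesgue_on {0..1}) borel (\<lambda>t::real. t)) {x<..} = emeasure (lebesgue_on {0..1}) ({x<..} \<inter> {0..1})"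
      using m' by (subst emeasure_distr) (auto intro!: arg_cong[where f="emeasure (lebesgue_on {0..1})"])
    also have "\<dots> = emeasure lborel ({x<..} \<inter> {0..1})"
      by (subst emeasure_restrict_space) auto
    finally show ?thesis .
  qed
  consider "x < 0" | "x \<ge> 1" | "0 \<le> x" "x < 1" by linarith
  then show "emeasure (distr dA borel (\<lambda>z. (cmod z)\<^sup>2)) {x<..} = emeasure (distr (lebesgue_on {0..1}) borel (\<lambda>t::real. t)) {x<..}"
  proof cases
    case 1
    then have "{z \<in> ball 0 1. x < (cmod z)\<^sup>2} = ball 0 1" "{x<..} \<inter> {0..1} = {0..1}"
      by (auto intro: less_le_trans[of x 0])
    then show ?thesis unfolding \<open>emeasure (distr dA _ _) _ = _\<close> 2 using emeasure_dA_ball[of 1 0] by simp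
  next
    case 2
    have "(cmod z)\<^sup>2 < 1" if "cmod z < 1" for z
      using that by (simp add: abs_square_less_1)
    then have "{z \<in> ball 0 1. x < (cmod z)\<^sup>2} = {}" "{x<..} \<inter> {0..1} = {}"
      using 2 by fastforce+
    then show ?thesis unfolding 1 \<open>emeasure (distr (lebesgue_on _) _ _) _ = _\<close> by (simp only:) simp
  next
    case 3
    have e: "{z \<in> ball 0 1. x < (cmod z)\<^sup>2} = ball 0 1 - cball 0 (sqrt x)"
      using 3 by (auto simp: not_le real_less_lsqrt real_sqrt_less_iff) (metis norm_ge_zero not_le real_le_rsqrt real_less_lsqrt abs_norm_cancel real_sqrt_abs real_sqrt_less_iff)+
    have "emeasure dA (cball 0 (sqrt x)) = ennreal (1 / pi) * ennreal (pi * x)"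
      using 3 by (subst emeasure_dA) (auto simp: emeasure_cball unit_ball_vol_2 le_less_trans)
    also have "\<dots> = ennreal x" using 3 by (subst ennreal_mult[symmetric]) auto
    finally have cb: "emeasure dA (cball 0 (sqrt x)) = ennreal x" .
    have sub: "cball 0 (sqrt x) \<subseteq> ball (0::complex) 1" using 3 by (auto simp: le_less_trans)
    have sb: "A \<in> sets dA" if "A \<in> sets borel" "A \<subseteq> ball 0 1" for A
      using that by (auto simp: sets_dA sets_restrict_space intro!: image_eqI[of _ _ A])
    have "emeasure dA (ball 0 1 - cball 0 (sqrt x)) = emeasure dA (ball 0 1) - emeasure dA (cball 0 (sqrt x))"
      using sub by (intro emeasure_Diff) (auto intro!: sb simp: dA.emeasure_finite)
    also have "\<dots> = ennreal (1 - x)"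
      using emeasure_dA_ball[of 1 0] 3 by (simp add: cb ennreal_minus[symmetric])
    finally have "emeasure dA {z \<in> ball 0 1. x < (cmod z)\<^sup>2} = ennreal (1 - x)" by (simp only: e)
    moreover have "{x<..} \<inter> {0..1} = {x<..1}" using 3 by auto
    ultimately show ?thesis unfolding 1 2 using 3 by simp
  qed
qed auto

section \<open>The Bergman projection and circle means\<close>

lemma ident_measurable_lebesgue_on: "(\<lambda>t. t) \<in> borel_measurable (lebesgue_on S)"
  by (intro measurable_restrict_space1 measurable_completion) simp

text \<open>Rotation invariance permits averaging the area integral over all rotations. After
  exchanging the integrals, the inner one is the circle mean, a function of |z|^2 only, and |z|^2 is
  uniform on [0,1].\<close>

lemma integral_dA_circle_mean:
  fixes F :: "complex \<Rightarrow> complex" and H :: "real \<Rightarrow> complex"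
  assumes contF: "continuous_on (ball 0 1) F" and intF: "integrable dA F"
    and contH: "continuous_on {0..1} H"
    and mean: "\<And>z. cmod z < 1 \<Longrightarrow>
      ((\<lambda>t. F (exp (2 * of_real pi * \<i> * of_real t) * z)) has_integral H ((cmod z)\<^sup>2)) {0..1}"
  shows "(LINT z|dA. F z) = integral {0..1} H"
proof -
  let ?I = "lebesgue_on {0..1::real}"
  let ?e = "\<lambda>t::real. exp (2 * of_real pi * \<i> * of_real t)"
  \<comment> \<open>Extension by zero gives a Borel function on the whole plane, which can be
    composed with rotations without losing measurability.\<close>
  define F1 where "F1 z = indicator (ball 0 1) z *\<^sub>R F z" for z
  have F1[measurable]: "F1 \<in> borel_measurable borel"
    unfolding F1_def by (intro borel_measurable_continuous_on_indicator contF) auto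
  have F1F: "F1 z = F z" if "cmod z < 1" for z using that by (simp add: F1_def)
  have [simp]: "cmod (?e t) = 1" for t by simp
  have e[measurable]: "?e \<in> borel_measurable ?I"
  proof -
    have "?e \<in> borel_measurable borel" by (intro borel_measurable_continuous_onI continuous_intros)
    then show ?thesis using measurable_compose[OF ident_measurable_lebesgue_on] by blast
  qed
  have F1m: "F1 \<in> borel_measurable dA" by (rule borel_measurable_dA[OF F1])
  have int1: "integrable dA F1"
    using intF by (subst Bochner_Integration.integrable_cong[of dA dA F1 F]) (auto simp: F1F)
  have introt: "integrable dA (\<lambda>z. F1 (?e t * z))" for t
  proof -
    have "integrable (distr dA borel (\<lambda>z. z)) F1"
      using int1 by (subst integrable_distr_eq) auto
    then have "integrable (distr dA borel (\<lambda>z. ?e t * z)) F1"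
      by (subst distr_dA_rotate) auto
    then show ?thesis by (subst (asm) integrable_distr_eq) auto
  qed
  have rot: "(LINT z|dA. G (?e t * z)) = (LINT z|dA. G z)" if [measurable]: "G \<in> borel_measurable borel"
    for G :: "complex \<Rightarrow> 'b::{banach, second_countable_topology}" and t
  proof -
    have "(LINT z|dA. G (?e t * z)) = (LINT z|distr dA borel (\<lambda>z. ?e t * z). G z)"
      by (subst integral_distr) auto
    also have "\<dots> = (LINT z|distr dA borel (\<lambda>z. z). G z)" by (subst distr_dA_rotate) auto
    also have "\<dots> = (LINT z|dA. G z)" by (subst integral_distr) auto
    finally show ?thesis .
  qed
  interpret I: finite_measure ?I by (rule finite_measure_lebesgue_on) simp
  interpret P: pair_sigma_finite ?I dA ..
  have measI: "measure ?I (space ?I) = 1"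
    by (simp add: measure_restrict_space)
  have pm: "case_prod (\<lambda>t z. F1 (?e t * z)) \<in> borel_measurable (?I \<Otimes>\<^sub>M dA)"
    by measurable
  have prod: "integrable (?I \<Otimes>\<^sub>M dA) (case_prod (\<lambda>t z. F1 (?e t * z)))"
  proof (rule P.Fubini_integrable[OF pm])
    show "integrable ?I (\<lambda>t. LINT z|dA. norm (case (t, z) of (t, z) \<Rightarrow> F1 (?e t * z)))"
      using rot[of "\<lambda>z. norm (F1 z)"] by (simp add: I.emeasure_finite)
    show "AE t in ?I. integrable dA (\<lambda>z. case (t, z) of (t, z) \<Rightarrow> F1 (?e t * z))"
      using introt by simp
  qed
  have inner: "(LINT t|?I. F1 (?e t * z)) = H ((cmod z)\<^sup>2)" if z: "cmod z < 1" for z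
  proof -
    have "continuous_on {0..1} (\<lambda>t. F (?e t * z))"
      by (rule continuous_on_compose2[OF contF]) (use z in \<open>auto intro!: continuous_intros simp: norm_mult\<close>)
    then have "integrable ?I (\<lambda>t. F (?e t * z))"
      by (intro continuous_imp_integrable_real) auto
    then have "(LINT t|?I. F (?e t * z)) = H ((cmod z)\<^sup>2)"
      using mean[OF z] by (subst lebesgue_integral_eq_integral) (auto simp: integral_unique)
    moreover have "F1 (?e t * z) = F (?e t * z)" for t
      using z by (intro F1F) (simp add: norm_mult)
    ultimately show ?thesis by simp
  qed
  define H1 where "H1 t = indicator {0..1} t *\<^sub>R H t" for t
  have H1[measurable]: "H1 \<in> borel_measurable borel"
    unfolding H1_def by (intro borel_measurable_continuous_on_indicator contH) auto
  have sq: "(cmod z)\<^sup>2 \<le> 1" if "cmod z < 1" for z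
    using that by (simp add: abs_square_le_1)
  have "(LINT z|dA. F z) = (LINT z|dA. F1 z)"
    by (intro Bochner_Integration.integral_cong) (auto simp: F1F)
  also have "\<dots> = (LINT t|?I. (LINT z|dA. F1 (?e t * z)))"
    using measI by (simp add: rot[OF F1])
  also have "\<dots> = (LINT z|dA. (LINT t|?I. F1 (?e t * z)))"
    using P.Fubini_integral[OF prod] by simp
  also have "\<dots> = (LINT z|dA. H1 ((cmod z)\<^sup>2))"
    by (intro Bochner_Integration.integral_cong) (auto simp: inner H1_def sq)
  also have "\<dots> = (LINT t|distr dA borel (\<lambda>z. (cmod z)\<^sup>2). H1 t)"
    by (subst integral_distr) auto
  also have "\<dots> = (LINT t|?I. H1 t)"
    unfolding distr_dA_norm_square by (subst integral_distr) (auto simp: ident_measurable_lebesgue_on)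
  also have "\<dots> = (LINT t|?I. H t)"
    by (intro Bochner_Integration.integral_cong) (auto simp: H1_def)
  also have "\<dots> = integral {0..1} H"
    using contH by (intro lebesgue_integral_eq_integral continuous_imp_integrable_real) auto
  finally show ?thesis .
qed

lemma one_minus_cnj_mult_ge:
  assumes "cmod w \<le> 1"
  shows "cmod (1 - cnj w * z) \<ge> 1 - cmod z"
proof -
  have "cmod (cnj w * z) \<le> cmod z" using assms by (simp add: norm_mult mult_left_le_one_le)
  then show ?thesis using norm_triangle_ineq2[of 1 "cnj w * z"] by simp
qed

lemma one_minus_cnj_mult_nonzero: "cmod w \<le> 1 \<Longrightarrow> cmod z < 1 \<Longrightarrow> 1 - cnj w * z \<noteq> 0"
  using one_minus_cnj_mult_ge[of w z] by auto

text \<open>Put a = cnj w * z. On the unit circle cnj u = 1 / u, so 1 - cnj (u w) z = (u - a) / u,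
  and the mean becomes the Cauchy integral for the derivative of u * F(u w) at a. Moreover a * w =
  |w|^2 z, which is why only |w|^2 remains.\<close>

lemma bergman_kernel_circle_mean:
  assumes F: "F holomorphic_on ball 0 1" and z: "cmod z < 1" and w: "cmod w < 1"
  shows "((\<lambda>t. F (exp (2 * of_real pi * \<i> * of_real t) * w) / (1 - cnj (exp (2 * of_real pi * \<i> * of_real t) * w) * z)\<^sup>2)
     has_integral (F (of_real ((cmod w)\<^sup>2) * z) + of_real ((cmod w)\<^sup>2) * z * deriv F (of_real ((cmod w)\<^sup>2) * z))) {0..1}"
    (is "(?f has_integral ?R) _")
proof -
  let ?e = "\<lambda>t::real. exp (2 * of_real pi * \<i> * of_real t)"
  define a where "a = cnj w * z"
  define h where "h u = F (u * w) * u" for u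
  have aw: "a * w = of_real ((cmod w)\<^sup>2) * z"
    unfolding a_def by (simp only: complex_norm_square mult_ac)
  have a: "cmod a < 1"
    unfolding a_def using z w by (simp add: norm_mult) (metis mult_strict_mono' mult_1 norm_ge_zero)
  have sub: "(\<lambda>u. u * w) ` cball 0 1 \<subseteq> ball 0 1"
    using w by (auto simp: norm_mult) (metis le_less_trans mult_left_le_one_le norm_ge_zero)
  have hh: "h holomorphic_on cball 0 1"
    unfolding h_def
    by (intro holomorphic_intros holomorphic_on_compose_gen[OF _ F, unfolded o_def] sub)
  then have hc: "continuous_on (cball 0 1) h" by (rule holomorphic_on_imp_continuous_on)
  have hb: "h holomorphic_on ball 0 1" by (rule holomorphic_on_subset[OF hh]) auto
  have ab: "a \<in> ball 0 1" using a by simp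
  let ?C = "contour_integral (circlepath 0 1) (\<lambda>u. h u / (u - a)\<^sup>2)"
  note C = Cauchy_derivative_integral_circlepath[OF hc hb ab]
  have awb: "a * w \<in> ball 0 1" using sub a by (auto simp: image_subset_iff)
  have "(F has_field_derivative deriv F (a * w)) (at (a * w))"
    using F awb by (simp add: holomorphic_derivI)
  then have "((\<lambda>u. F (u * w)) has_field_derivative deriv F (a * w) * w) (at a)"
    by (rule DERIV_chain2) (auto intro!: derivative_eq_intros)
  then have "(h has_field_derivative (deriv F (a * w) * w * a + F (a * w))) (at a)"
    unfolding h_def by (auto intro!: derivative_eq_intros)
  with C(2) have "1 / (2 * of_real pi * \<i>) * ?C = deriv F (a * w) * w * a + F (a * w)"
    by (rule DERIV_unique)
  then have Cval: "?C = 2 * of_real pi * \<i> * ?R"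
    unfolding aw[symmetric] by (simp add: field_simps)
  have "((\<lambda>u. h u / (u - a)\<^sup>2) has_contour_integral ?C) (circlepath 0 1)"
    by (rule has_contour_integral_integral[OF C(1)])
  then have *: "((\<lambda>t. h (circlepath 0 1 t) / (circlepath 0 1 t - a)\<^sup>2 *
      vector_derivative (circlepath 0 1) (at t within {0..1})) has_integral ?C) {0..1}"
    by (simp only: has_contour_integral_def)
  have "((\<lambda>t. h (?e t) / (?e t - a)\<^sup>2 * (2 * of_real pi * \<i> * ?e t)) has_integral ?C) {0..1}"
  proof (rule has_integral_eq[OF _ *])
    fix t :: real assume "t \<in> {0..1}"
    then have "vector_derivative (circlepath 0 1) (at t within {0..1}) = 2 * of_real pi * \<i> * ?e t"
      using vector_derivative_circlepath01[of t 0 1] by simp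
    moreover have "circlepath 0 1 t = ?e t" by (simp add: circlepath)
    ultimately show "h (circlepath 0 1 t) / (circlepath 0 1 t - a)\<^sup>2 * vector_derivative (circlepath 0 1) (at t within {0..1})
        = h (?e t) / (?e t - a)\<^sup>2 * (2 * of_real pi * \<i> * ?e t)"
      by (simp only:)
  qed
  then have "((\<lambda>t. 1 / (2 * of_real pi * \<i>) * (h (?e t) / (?e t - a)\<^sup>2 * (2 * of_real pi * \<i> * ?e t)))
      has_integral (1 / (2 * of_real pi * \<i>) * ?C)) {0..1}"
    by (rule has_integral_mult_right)
  moreover have "1 / (2 * of_real pi * \<i>) * ?C = ?R" unfolding Cval by simp
  moreover have "1 / (2 * of_real pi * \<i>) * (h (?e t) / (?e t - a)\<^sup>2 * (2 * of_real pi * \<i> * ?e t)) = ?f t" for t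
  proof -
    define u where "u = ?e t"
    have u: "u \<noteq> 0" "cmod u = 1" by (simp_all add: u_def)
    then have "cnj u = 1 / u"
      by (metis complex_norm_square nonzero_mult_div_cancel_left of_real_1 power_one)
    moreover have "u - a \<noteq> 0" using u a by auto
    ultimately have "1 - cnj (u * w) * z = (u - a) / u"
      using u by (simp add: a_def field_simps)
    then have "F (u * w) / (1 - cnj (u * w) * z)\<^sup>2 = h u / (u - a)\<^sup>2 * u"
      using u by (simp add: h_def power_divide power2_eq_square)
    moreover have "1 / c * (x * (c * u)) = x * u" if "c \<noteq> 0" for c x :: complex
      using that by simp
    then have "1 / (2 * of_real pi * \<i>) * (h u / (u - a)\<^sup>2 * (2 * of_real pi * \<i> * u)) = h u / (u - a)\<^sup>2 * u"
      by (metis divisors_zero complex_i_not_zero of_real_eq_0_iff pi_neq_zero zero_neq_numeral)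
    ultimately show ?thesis unfolding u_def by metis
  qed
  ultimately show ?thesis by simp
qed

text \<open>Averaging the integrand over circles reduces the Bergman projection of a radial multiple
  of a holomorphic function to a one-dimensional integral.\<close>

lemma bergman_proj_radial:
  fixes F :: "complex \<Rightarrow> complex" and p \<Phi> :: "real \<Rightarrow> complex"
  assumes F: "F holomorphic_on ball 0 1" and z: "cmod z < 1" and p: "continuous_on {0..1} p"
    and int: "integrable dA (\<lambda>w. F w * p ((cmod w)\<^sup>2))"
    and \<Phi>: "\<And>t. t \<in> {0..1} \<Longrightarrow> (\<Phi> has_vector_derivative
        p t * (F (of_real t * z) + of_real t * z * deriv F (of_real t * z))) (at t within {0..1})"
  shows "bergman_proj (\<lambda>w. F w * p ((cmod w)\<^sup>2)) z = \<Phi> 1 - \<Phi> 0"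
proof -
  define H where "H t = p t * (F (of_real t * z) + of_real t * z * deriv F (of_real t * z))" for t
  have F': "deriv F holomorphic_on ball 0 1" using F by (intro holomorphic_deriv) auto
  have sub: "(\<lambda>t. of_real t * z) ` {0..1::real} \<subseteq> ball 0 1"
    using z by (auto simp: norm_mult) (metis le_less_trans mult_left_le_one_le norm_ge_zero)
  have cz: "continuous_on {0..1::real} (\<lambda>t. of_real t * z)" by (intro continuous_intros)
  have H: "continuous_on {0..1} H"
    unfolding H_def
    by (intro continuous_intros p continuous_on_compose2[OF holomorphic_on_imp_continuous_on[OF F] cz sub]
        continuous_on_compose2[OF holomorphic_on_imp_continuous_on[OF F'] cz sub])
  have sqb: "(cmod w)\<^sup>2 \<in> {0..1}" if "cmod w < 1" for w
    using that by (simp add: abs_square_le_1)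
  have cint: "continuous_on (ball 0 1) (\<lambda>w. F w * p ((cmod w)\<^sup>2) / (1 - cnj w * z)\<^sup>2)"
    by (intro continuous_intros holomorphic_on_imp_continuous_on[OF F] continuous_on_compose2[OF p])
      (use z sqb one_minus_cnj_mult_nonzero in force)+
  have "bergman_proj (\<lambda>w. F w * p ((cmod w)\<^sup>2)) z = integral {0..1} H"
    unfolding bergman_proj_def
  proof (rule integral_dA_circle_mean[OF cint _ H])
    show "integrable dA (\<lambda>w. F w * p ((cmod w)\<^sup>2) / (1 - cnj w * z)\<^sup>2)"
    proof (rule Bochner_Integration.integrable_bound[OF integrable_mult_right[OF int, of "1 / of_real ((1 - cmod z)\<^sup>2)"]])
      show "(\<lambda>w. F w * p ((cmod w)\<^sup>2) / (1 - cnj w * z)\<^sup>2) \<in> borel_measurable dA"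
        by (rule borel_measurable_dA_continuous_on[OF cint])
      have "cmod (F w * p ((cmod w)\<^sup>2) / (1 - cnj w * z)\<^sup>2) \<le> cmod (1 / of_real ((1 - cmod z)\<^sup>2) * (F w * p ((cmod w)\<^sup>2)))"
        if "cmod w < 1" for w
      proof -
        have "(1 - cmod z)\<^sup>2 \<le> (cmod (1 - cnj w * z))\<^sup>2"
          using one_minus_cnj_mult_ge[of w z] that z by (intro power_mono) auto
        then have "cmod (F w * p ((cmod w)\<^sup>2)) / (cmod (1 - cnj w * z))\<^sup>2 \<le> cmod (F w * p ((cmod w)\<^sup>2)) / (1 - cmod z)\<^sup>2"
          using z by (intro divide_left_mono mult_pos_pos) (auto intro: less_le_trans[rotated])
        then show ?thesis
          by (simp add: norm_divide norm_power norm_mult del: of_real_power of_real_diff)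
      qed
      then show "AE w in dA. cmod (F w * p ((cmod w)\<^sup>2) / (1 - cnj w * z)\<^sup>2) \<le> cmod (1 / of_real ((1 - cmod z)\<^sup>2) * (F w * p ((cmod w)\<^sup>2)))"
        by (intro AE_I2) simp
    qed
    fix w assume w: "cmod w < 1"
    from has_integral_mult_right[OF bergman_kernel_circle_mean[OF F z w], of "p ((cmod w)\<^sup>2)"]
    show "((\<lambda>t. F (exp (2 * of_real pi * \<i> * of_real t) * w) * p ((cmod (exp (2 * of_real pi * \<i> * of_real t) * w))\<^sup>2) /
        (1 - cnj (exp (2 * of_real pi * \<i> * of_real t) * w) * z)\<^sup>2) has_integral H ((cmod w)\<^sup>2)) {0..1}"
      unfolding H_def by (simp add: norm_mult mult_ac)
  qed
  also have "\<dots> = \<Phi> 1 - \<Phi> 0"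
    using \<Phi> by (intro integral_unique fundamental_theorem_of_calculus) (auto simp: H_def)
  finally show ?thesis .
qed

lemma integrable_L2D:
  assumes "f \<in> L2D"
  shows "integrable dA f"
proof -
  have f[measurable]: "f \<in> borel_measurable dA" and i: "integrable dA (\<lambda>z. (cmod (f z))\<^sup>2)"
    using assms by (auto simp: L2D_def)
  have "integrable dA (\<lambda>z. 1 + (cmod (f z))\<^sup>2)"
    using i by (intro Bochner_Integration.integrable_add) (auto simp: dA.emeasure_finite)
  then show ?thesis
  proof (rule Bochner_Integration.integrable_bound[OF _ f])
    have "x \<le> 1 + x\<^sup>2" if "x \<ge> 0" for x :: real
      using sum_power2_ge_zero[of "x - 1" 0] that by (simp add: power2_eq_square algebra_simps)
    then show "AE z in dA. cmod (f z) \<le> norm (1 + (cmod (f z))\<^sup>2)" by (intro AE_I2) simp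
  qed
qed

lemma has_vector_derivative_radial:
  assumes F: "F holomorphic_on ball 0 1" and z: "cmod z < 1" and t: "t \<in> {0..1}"
  shows "((\<lambda>t. F (of_real t * z)) has_vector_derivative (z * deriv F (of_real t * z))) (at t within {0..1})"
proof -
  have "of_real t * z \<in> ball 0 1"
    using z t by (auto simp: norm_mult) (metis le_less_trans mult_left_le_one_le norm_ge_zero)
  then have "(F has_field_derivative deriv F (of_real t * z)) (at (of_real t * z))"
    using F by (simp add: holomorphic_derivI)
  moreover have "((\<lambda>t. of_real t * z) has_vector_derivative z) (at t within {0..1})"
    by (auto intro!: derivative_eq_intros)
  ultimately show ?thesis
    using field_vector_diff_chain_within[of "\<lambda>t. of_real t * z" z t "{0..1}" F]
    by (auto simp: o_def has_field_derivative_at_within)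
qed

text \<open>For the constant weight p = 1 the one-dimensional integrand is the derivative of t * F(t
  z).\<close>

lemma bergman_proj_reproducing:
  assumes F: "F \<in> A2D" and z: "cmod z < 1"
  shows "bergman_proj F z = F z"
proof -
  have hol: "F holomorphic_on ball 0 1" and L: "F \<in> L2D" using F by (auto simp: A2D_def)
  have "bergman_proj (\<lambda>w. F w * (\<lambda>_. 1) ((cmod w)\<^sup>2)) z = of_real 1 * F (of_real 1 * z) - of_real 0 * F (of_real 0 * z)"
  proof (rule bergman_proj_radial[OF hol z])
    show "integrable dA (\<lambda>w. F w * 1)" using integrable_L2D[OF L] by simp
    fix t :: real assume "t \<in> {0..1}"
    from has_vector_derivative_mult[OF has_vector_derivative_of_real[OF DERIV_ident]
        has_vector_derivative_radial[OF hol z this]]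
    show "((\<lambda>t. of_real t * F (of_real t * z)) has_vector_derivative 
        1 * (F (of_real t * z) + of_real t * z * deriv F (of_real t * z))) (at t within {0..1})"
      by (simp add: algebra_simps)
  qed auto
  then show ?thesis by simp
qed

text \<open>With F = 2 G + z G', integration by parts against the weight 1 - t leaves the integral
  of t * F(t z), which is the derivative of t^2 * G(t z). The combination 2 G + z G' is chosen for
  this identity; the antiderivative in the proof joins both steps.\<close>

lemma bergman_proj_primitive:
  assumes G: "G holomorphic_on ball 0 1" and z: "cmod z < 1"
    and int: "integrable dA (\<lambda>w. (2 * G w + w * deriv G w) * of_real (1 - (cmod w)\<^sup>2))"
  shows "bergman_proj (\<lambda>w. (2 * G w + w * deriv G w) * of_real (1 - (cmod w)\<^sup>2)) z = G z"
proof -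
  define F where "F w = 2 * G w + w * deriv G w" for w
  have F: "F holomorphic_on ball 0 1"
    unfolding F_def by (intro holomorphic_intros G holomorphic_deriv[OF G]) auto
  let ?\<Phi> = "\<lambda>t. of_real (1 - t) * (of_real t * F (of_real t * z)) + of_real t * (of_real t * G (of_real t * z))"
  have "bergman_proj (\<lambda>w. F w * (\<lambda>t. of_real (1 - t)) ((cmod w)\<^sup>2)) z = ?\<Phi> 1 - ?\<Phi> 0"
  proof (rule bergman_proj_radial[OF F z, where p="\<lambda>t. of_real (1 - t)" and \<Phi>="?\<Phi>"])
    show "continuous_on {0..1} (\<lambda>t. complex_of_real (1 - t))"
      by (intro continuous_on_of_real continuous_on_diff continuous_on_const continuous_on_id)
    show "integrable dA (\<lambda>w. F w * of_real (1 - (cmod w)\<^sup>2))" using int by (simp add: F_def)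
    fix t :: real assume t: "t \<in> {0..1}"
    note d = has_vector_derivative_radial[OF F z t] has_vector_derivative_radial[OF G z t]
    have "(?\<Phi> has_vector_derivative
       (of_real (1 - t) * (of_real t * (z * deriv F (of_real t * z)) + of_real 1 * F (of_real t * z))
        + of_real (- 1) * (of_real t * F (of_real t * z)))
       + (of_real t * (of_real t * (z * deriv G (of_real t * z)) + of_real 1 * G (of_real t * z))
         + of_real 1 * (of_real t * G (of_real t * z)))) (at t within {0..1})"
    proof (rule has_vector_derivative_add)
      have i: "((\<lambda>t. complex_of_real t) has_vector_derivative of_real 1) (at t within {0..1})"
        by (rule has_vector_derivative_of_real[OF DERIV_ident])
      have j: "((\<lambda>t. complex_of_real (1 - t)) has_vector_derivative of_real (- 1)) (at t within {0..1})"
        by (rule has_vector_derivative_of_real) (auto intro!: derivative_eq_intros)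
      show "((\<lambda>t. of_real (1 - t) * (of_real t * F (of_real t * z))) has_vector_derivative
         (of_real (1 - t) * (of_real t * (z * deriv F (of_real t * z)) + of_real 1 * F (of_real t * z))
        + of_real (- 1) * (of_real t * F (of_real t * z)))) (at t within {0..1})"
        by (rule has_vector_derivative_mult[OF j has_vector_derivative_mult[OF i d(1)]])
      show "((\<lambda>t. of_real t * (of_real t * G (of_real t * z))) has_vector_derivative
         (of_real t * (of_real t * (z * deriv G (of_real t * z)) + of_real 1 * G (of_real t * z))
         + of_real 1 * (of_real t * G (of_real t * z)))) (at t within {0..1})"
        by (rule has_vector_derivative_mult[OF i has_vector_derivative_mult[OF i d(2)]])
    qed
    moreover have "F (of_real t * z) = 2 * G (of_real t * z) + of_real t * z * deriv G (of_real t * z)"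
      by (simp add: F_def)
    ultimately show "(?\<Phi> has_vector_derivative
        of_real (1 - t) * (F (of_real t * z) + of_real t * z * deriv F (of_real t * z))) (at t within {0..1})"
      by (elim has_vector_derivative_eq_rhs) (simp add: algebra_simps)
  qed
  then show ?thesis by (simp add: F_def)
qed

section \<open>Bounded Toeplitz products\<close>

lemma borel_measurable_cnj [measurable]: "cnj \<in> borel_measurable borel"
  by (intro borel_measurable_continuous_onI continuous_intros)

lemma borel_measurable_powr_Re_pos:
  assumes q: "q \<in> borel_measurable M" and pos: "\<And>x. x \<in> space M \<Longrightarrow> Re (q x) > 0"
  shows "(\<lambda>x. q x powr s :: complex) \<in> borel_measurable M"
proof -
  let ?D = "{v. Re v > 0}"
  have "open ?D" by (rule open_halfspace_Re_gt)
  moreover have "continuous_on ?D (\<lambda>v. v powr s)"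
    by (intro continuous_intros) (auto simp: complex_nonpos_Reals_iff)
  ultimately have "(\<lambda>v. indicator ?D v *\<^sub>R (v powr s)) \<in> borel_measurable borel"
    by (intro borel_measurable_continuous_on_indicator) auto
  from measurable_compose[OF q this] show ?thesis
    by (rule measurable_cong[THEN iffD1, rotated]) (simp add: pos)
qed

lemma Re_one_minus_mult_ge: "cmod p \<le> 1 \<Longrightarrow> Re (1 - p * z) \<ge> 1 - cmod z"
proof -
  assume "cmod p \<le> 1"
  then have "cmod (p * z) \<le> cmod z" by (simp add: norm_mult mult_left_le_one_le)
  then show ?thesis using complex_Re_le_cmod[of "p * z"] by simp
qed

text \<open>Differentiation under the integral, stated so as to cover both the Bergman kernel (order
  2, p = cnj) and the Cantor potentials (p = conjugated Cantor points). On the disc of radius (1 -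
  |z|) / 2 about z the base 1 - p w has real part at least that radius, so it avoids the branch cut
  and the difference quotients have one common bound.\<close>

lemma has_field_derivative_power_kernel_integral:
  fixes u p :: "'x \<Rightarrow> complex"
  assumes u: "integrable M u" and p: "p \<in> borel_measurable M"
    and p1: "\<And>x. x \<in> space M \<Longrightarrow> cmod (p x) \<le> 1" and \<sigma>: "\<sigma> > 0" and z: "cmod z < 1"
  shows "((\<lambda>z. LINT x|M. u x * (1 - p x * z) powr (- of_real \<sigma>)) has_field_derivative
     (LINT x|M. u x * (of_real \<sigma> * p x * (1 - p x * z) powr (- of_real \<sigma> - 1)))) (at z)"
proof -
  define r where "r = (1 - cmod z) / 2"
  have r: "r > 0" using z by (simp add: r_def)
  define k where "k x w = (1 - p x * w) powr (- of_real \<sigma>)" for x w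
  define k' where "k' x w = of_real \<sigma> * p x * (1 - p x * w) powr (- of_real \<sigma> - 1)" for x w
  have um[measurable]: "u \<in> borel_measurable M" using u by auto
  note p[measurable]
  have Rer: "Re (1 - p x * w) \<ge> r" if "x \<in> space M" "w \<in> ball z r" for x w
  proof -
    have "cmod w \<le> cmod z + r" using norm_triangle_ineq2[of w z] that
      by (simp add: dist_norm norm_minus_commute)
    then show ?thesis using Re_one_minus_mult_ge[OF p1[OF that(1)], of w] by (simp add: r_def field_simps)
  qed
  have Rez: "Re (1 - p x * z) > 0" if "x \<in> space M" for x
    using Rer[OF that, of z] r by auto
  have Repos: "Re (1 - p x * w) > 0" if "x \<in> space M" "w \<in> ball z r" for x w
    using Rer[OF that] r by linarith
  have pm: "(\<lambda>x. 1 - p x * w) \<in> borel_measurable M" for w by measurable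
  have km[measurable]: "(\<lambda>x. k x w) \<in> borel_measurable M" if "w \<in> ball z r" for w
    unfolding k_def using Repos[OF _ that] by (intro borel_measurable_powr_Re_pos pm)
  have k'm[measurable]: "(\<lambda>x. k' x w) \<in> borel_measurable M" if "w \<in> ball z r" for w
    unfolding k'_def using Repos[OF _ that] p
    by (intro borel_measurable_times borel_measurable_powr_Re_pos pm) auto
  have nr: "cmod (1 - p x * w) \<ge> r" if "x \<in> space M" "w \<in> ball z r" for x w
    using Rer[OF that] complex_Re_le_cmod[of "1 - p x * w"] by linarith
  have kb: "cmod (k x w) \<le> r powr (- \<sigma>)" if "x \<in> space M" "w \<in> ball z r" for x w
    unfolding k_def using nr[OF that] r \<sigma> by (subst norm_powr_real_powr') (auto intro!: powr_mono2')
  define B where "B = \<sigma> * r powr (- \<sigma> - 1)"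
  have k'b: "cmod (k' x w) \<le> B" if "x \<in> space M" "w \<in> ball z r" for x w
  proof -
    have "cmod ((1 - p x * w) powr (- of_real \<sigma> - 1)) \<le> r powr (- \<sigma> - 1)"
      using nr[OF that] r \<sigma> by (subst norm_powr_real_powr') (auto intro!: powr_mono2')
    then have "cmod (p x) * cmod ((1 - p x * w) powr (- of_real \<sigma> - 1)) \<le> 1 * r powr (- \<sigma> - 1)"
      using p1[OF that(1)] by (intro mult_mono) auto
    then show ?thesis using \<sigma> by (simp add: k'_def B_def norm_mult mult_left_mono)
  qed
  have kd: "(k x has_field_derivative k' x w) (at w)" if "x \<in> space M" "w \<in> ball z r" for x w
  proof -
    have "1 - p x * w \<notin> \<real>\<^sub>\<le>\<^sub>0" using Rer[OF that] r by (auto simp: complex_nonpos_Reals_iff)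
    then have "((\<lambda>v. v powr (- of_real \<sigma>)) has_field_derivative
        (- of_real \<sigma> * (1 - p x * w) powr (- of_real \<sigma> - 1))) (at (1 - p x * w))"
      by (rule has_field_derivative_powr)
    moreover have "((\<lambda>w. 1 - p x * w) has_field_derivative (- p x)) (at w)"
      by (auto intro!: derivative_eq_intros)
    ultimately have "((\<lambda>w. (1 - p x * w) powr (- of_real \<sigma>)) has_field_derivative
        (- of_real \<sigma> * (1 - p x * w) powr (- of_real \<sigma> - 1) * (- p x))) (at w)"
      by (rule DERIV_chain2)
    then show ?thesis unfolding k_def[abs_def] k'_def by (simp add: mult_ac)
  qed
  have kl: "cmod (k x w - k x z) \<le> B * cmod (w - z)" if "x \<in> space M" "w \<in> ball z r" for x w
    by (rule field_differentiable_bound[of "ball z r" "k x" "k' x"])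
      (use that r kd k'b in \<open>auto intro: has_field_derivative_at_within\<close>)
  have ki: "integrable M (\<lambda>x. u x * k x w)" if w: "w \<in> ball z r" for w
  proof (rule Bochner_Integration.integrable_bound[OF integrable_mult_right[OF integrable_norm[OF u], of "r powr (- \<sigma>)"]])
    show "(\<lambda>x. u x * k x w) \<in> borel_measurable M" using km[OF w] um by (intro borel_measurable_times)
    show "AE x in M. norm (u x * k x w) \<le> norm (r powr (- \<sigma>) * norm (u x))"
      using kb[OF _ w] by (intro AE_I2) (simp add: norm_mult mult.commute[of "r powr _"] mult_left_mono)
  qed
  have zb: "z \<in> ball z r" using r by simp
  have "((\<lambda>w. ((LINT x|M. u x * k x w) - (LINT x|M. u x * k x z)) / (w - z)) \<longlongrightarrow> (LINT x|M. u x * k' x z)) (at z within ball z r)"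
    unfolding tendsto_at_iff_sequentially
  proof (intro allI impI)
    fix X assume X: "\<forall>i. X i \<in> ball z r - {z}" and lim: "X \<longlonglongrightarrow> z"
    have Xb: "X i \<in> ball z r" and Xz: "X i \<noteq> z" for i using X by auto
    have "(\<lambda>i. LINT x|M. u x * ((k x (X i) - k x z) / (X i - z))) \<longlonglongrightarrow> (LINT x|M. u x * k' x z)"
    proof (rule integral_dominated_convergence[where w="\<lambda>x. B * norm (u x)"])
      show "(\<lambda>x. u x * k' x z) \<in> borel_measurable M"
        using k'm[OF zb] um by (intro borel_measurable_times)
      show "(\<lambda>x. u x * ((k x (X i) - k x z) / (X i - z))) \<in> borel_measurable M" for i
        using km[OF zb] km[OF Xb[of i]] um
        by (intro borel_measurable_times borel_measurable_divide borel_measurable_diff borel_measurable_const)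
      show "integrable M (\<lambda>x. B * norm (u x))" using u by auto
      show "AE x in M. (\<lambda>i. u x * ((k x (X i) - k x z) / (X i - z))) \<longlonglongrightarrow> u x * k' x z"
      proof (intro AE_I2 tendsto_intros)
        fix x assume x: "x \<in> space M"
        have "((\<lambda>w. (k x w - k x z) / (w - z)) \<longlongrightarrow> k' x z) (at z)"
          using kd[OF x zb] by (simp add: has_field_derivative_iff)
        moreover have "filterlim X (at z) sequentially"
          using lim Xz by (simp add: filterlim_at)
        ultimately show "(\<lambda>i. (k x (X i) - k x z) / (X i - z)) \<longlonglongrightarrow> k' x z"
          by (rule filterlim_compose)
      qed
      show "AE x in M. norm (u x * ((k x (X i) - k x z) / (X i - z))) \<le> B * norm (u x)" for i
      proof (intro AE_I2)
        fix x assume x: "x \<in> space M"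
        have "cmod ((k x (X i) - k x z) / (X i - z)) \<le> B"
          using kl[OF x Xb[of i]] Xz[of i] by (simp add: norm_divide divide_le_eq)
        then show "norm (u x * ((k x (X i) - k x z) / (X i - z))) \<le> B * norm (u x)"
          by (simp only: norm_mult mult.commute[of B] mult_left_mono norm_ge_zero)
      qed
    qed
    moreover have "(LINT x|M. u x * ((k x (X i) - k x z) / (X i - z))) =
       ((LINT x|M. u x * k x (X i)) - (LINT x|M. u x * k x z)) / (X i - z)" for i
    proof -
      have "(LINT x|M. u x * ((k x (X i) - k x z) / (X i - z))) = (LINT x|M. (u x * k x (X i) - u x * k x z) / (X i - z))"
        by (simp add: algebra_simps diff_divide_distrib)
      also have "\<dots> = ((LINT x|M. u x * k x (X i)) - (LINT x|M. u x * k x z)) / (X i - z)"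
        using ki[OF Xb[of i]] ki[OF zb] by simp
      finally show ?thesis .
    qed
    ultimately show "((\<lambda>w. ((LINT x|M. u x * k x w) - (LINT x|M. u x * k x z)) / (w - z)) \<circ> X) \<longlonglongrightarrow> (LINT x|M. u x * k' x z)"
      by (simp only: o_def)
  qed
  then show ?thesis
    using r by (simp add: has_field_derivative_iff at_within_open[of z "ball z r"] k_def k'_def)
qed

lemma powr_minus_2_complex: "v \<noteq> 0 \<Longrightarrow> v powr (- of_real 2) = 1 / (v::complex)\<^sup>2"
  using powr_minus[of v 2] by (simp add: inverse_eq_divide powr_numeral)

lemma holomorphic_bergman_proj:
  assumes u: "integrable dA u"
  shows "bergman_proj u holomorphic_on ball 0 1"
proof -
  have "(\<lambda>z. LINT w|dA. u w * (1 - cnj w * z) powr (- of_real 2)) holomorphic_on ball 0 1"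
  proof (rule holomorphic_onI)
    fix z :: complex assume "z \<in> ball 0 1"
    then have "cmod z < 1" by simp
    have d: "((\<lambda>z. LINT w|dA. u w * (1 - cnj w * z) powr (- of_real 2)) has_field_derivative
        (LINT w|dA. u w * (of_real 2 * cnj w * (1 - cnj w * z) powr (- of_real 2 - 1)))) (at z)"
      by (rule has_field_derivative_power_kernel_integral[OF u _ _ _ \<open>cmod z < 1\<close>]) auto
    then show "(\<lambda>z. LINT w|dA. u w * (1 - cnj w * z) powr (- of_real 2)) field_differentiable at z within ball 0 1"
      unfolding field_differentiable_def by (blast intro: has_field_derivative_at_within)
  qed
  then show ?thesis
  proof (rule holomorphic_transform)
    fix z :: complex assume z: "z \<in> ball 0 1"
    show "(LINT w|dA. u w * (1 - cnj w * z) powr (- of_real 2)) = bergman_proj u z"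
      unfolding bergman_proj_def
    proof (intro Bochner_Integration.integral_cong refl)
      fix w :: complex assume "w \<in> space dA"
      then have "1 - cnj w * z \<noteq> 0" using z by (intro one_minus_cnj_mult_nonzero) auto
      then show "u w * (1 - cnj w * z) powr (- of_real 2) = u w / (1 - cnj w * z)\<^sup>2"
        by (subst powr_minus_2_complex) auto
    qed
  qed
qed

section \<open>Bounded functions supported in a smaller disc\<close>

lemma L2D_bounded:
  assumes "f \<in> borel_measurable dA" and "\<And>z. cmod z < 1 \<Longrightarrow> cmod (f z) \<le> B"
  shows "f \<in> L2D"
proof -
  have "integrable dA (\<lambda>z. (cmod (f z))\<^sup>2)"
    by (rule dA.integrable_const_bound[where B="B\<^sup>2"]) (use assms in \<open>auto intro!: power_mono\<close>)
  then show ?thesis using assms by (simp add: L2D_def)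
qed

lemma L2D_mult_bounded:
  assumes f: "f \<in> L2D" and [measurable]: "h \<in> borel_measurable dA" and "\<And>z. cmod z < 1 \<Longrightarrow> cmod (h z) \<le> B"
  shows "(\<lambda>z. f z * h z) \<in> L2D"
proof -
  have [measurable]: "f \<in> borel_measurable dA" and i: "integrable dA (\<lambda>z. (cmod (f z))\<^sup>2)"
    using f by (auto simp: L2D_def)
  have "integrable dA (\<lambda>z. (cmod (f z * h z))\<^sup>2)"
  proof (rule Bochner_Integration.integrable_bound[OF integrable_mult_right[OF i, of "B\<^sup>2"]])
    have "(cmod (f z * h z))\<^sup>2 \<le> B\<^sup>2 * (cmod (f z))\<^sup>2" if "cmod z < 1" for z
      using power_mono[OF assms(3)[OF that], of 2] 
      by (simp add: norm_mult power_mult_distrib mult.commute[of "B\<^sup>2"] mult_left_mono)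
    then show "AE z in dA. norm ((cmod (f z * h z))\<^sup>2) \<le> norm (B\<^sup>2 * (cmod (f z))\<^sup>2)"
      by (intro AE_I2) simp
  qed measurable
  then show ?thesis by (simp add: L2D_def)
qed

text \<open>For such u the kernel is bounded on the support, uniformly in |z| \<le> 1. Hence P u is
  bounded, all domain conditions of the unbounded operators hold, and every exchange of integrals is
  legitimate. The class is closed under multiplication by cnj g and suffices for testing.\<close>

definition compactly_bounded :: "(complex \<Rightarrow> complex) \<Rightarrow> real \<Rightarrow> real \<Rightarrow> bool" where
  "compactly_bounded u R B \<longleftrightarrow> u \<in> borel_measurable dA \<and> 0 < R \<and> R < 1 \<and> 0 \<le> B \<and>
     (\<forall>z. cmod (u z) \<le> B) \<and> (\<forall>z. R < cmod z \<longrightarrow> u z = 0)"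

lemma compactly_bounded_L2D: "compactly_bounded u R B \<Longrightarrow> u \<in> L2D"
  unfolding compactly_bounded_def by (intro L2D_bounded[of _ B]) auto

lemma compactly_bounded_kernel:
  assumes "compactly_bounded u R B" "cmod z \<le> 1"
  shows "cmod (u w / (1 - cnj w * z)\<^sup>2) \<le> B / (1 - R)\<^sup>2"
proof (cases "R < cmod w")
  case True
  then show ?thesis using assms by (auto simp: compactly_bounded_def)
next
  case False
  have "cmod (1 - cnj w * z) = cmod (1 - cnj z * w)"
    by (metis complex_cnj_cnj complex_cnj_diff complex_cnj_mult complex_cnj_one complex_mod_cnj mult.commute)
  then have "1 - R \<le> cmod (1 - cnj w * z)"
    using one_minus_cnj_mult_ge[of z w] assms False by auto
  then have "(1 - R)\<^sup>2 \<le> (cmod (1 - cnj w * z))\<^sup>2"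
    using assms by (intro power_mono) (auto simp: compactly_bounded_def)
  then show ?thesis
    using assms unfolding norm_divide norm_power
    by (intro frac_le) (auto simp: compactly_bounded_def)
qed

lemma bergman_proj_compactly_bounded:
  assumes "compactly_bounded u R B" "cmod z \<le> 1"
  shows "cmod (bergman_proj u z) \<le> B / (1 - R)\<^sup>2"
proof -
  have [measurable]: "u \<in> borel_measurable dA" using assms by (simp add: compactly_bounded_def)
  have m: "(\<lambda>w. u w / (1 - cnj w * z)\<^sup>2) \<in> borel_measurable dA" by measurable
  have "norm (bergman_proj u z) \<le> (LINT w|dA. B / (1 - R)\<^sup>2)"
    unfolding bergman_proj_def
    by (rule Bochner_Integration.integral_norm_bound_integral[OF _ _ compactly_bounded_kernel[OF assms]])
      (auto simp: dA.emeasure_finite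
         intro!: m dA.integrable_const_bound[OF AE_I2[OF compactly_bounded_kernel[OF assms]]])
  then show ?thesis by simp
qed

lemma compactly_bounded_A2D:
  assumes "compactly_bounded u R B"
  shows "bergman_proj u \<in> A2D"
proof -
  have h: "bergman_proj u holomorphic_on ball 0 1"
    by (intro holomorphic_bergman_proj integrable_L2D compactly_bounded_L2D[OF assms])
  moreover have "bergman_proj u \<in> L2D"
    by (rule L2D_bounded[of _ "B / (1 - R)\<^sup>2"])
      (auto intro!: bergman_proj_compactly_bounded[OF assms] borel_measurable_dA_continuous_on
        holomorphic_on_imp_continuous_on h)
  ultimately show ?thesis by (simp add: A2D_def)
qed

text \<open>Self-adjointness of P by Fubini. The double integrand is dominated by a constant times
  |q|, because u confines one variable to a smaller disc; this is why q need only be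
  integrable.\<close>

lemma ipD_bergman_proj:
  assumes u: "compactly_bounded u R B" and q: "integrable dA q"
  shows "ipD q (bergman_proj u) = ipD (bergman_proj q) u"
proof -
  interpret P: pair_sigma_finite dA dA ..
  have [measurable]: "u \<in> borel_measurable dA" "q \<in> borel_measurable dA"
    using u q by (auto simp: compactly_bounded_def)
  let ?k = "\<lambda>w e. q w * cnj (u e / (1 - cnj e * w)\<^sup>2)"
  have int: "integrable (dA \<Otimes>\<^sub>M dA) (case_prod ?k)"
  proof (rule Bochner_Integration.integrable_bound)
    show "integrable (dA \<Otimes>\<^sub>M dA) (\<lambda>(w, e). q w * of_real (B / (1 - R)\<^sup>2))"
    proof (rule P.Fubini_integrable)
      show "integrable dA (\<lambda>x. LINT y|dA. norm (case (x, y) of (w, e) \<Rightarrow> q w * complex_of_real (B / (1 - R)\<^sup>2)))"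
        using q by (simp add: norm_mult)
    qed (auto simp: dA.emeasure_finite)
    show "case_prod ?k \<in> borel_measurable (dA \<Otimes>\<^sub>M dA)" by measurable
    have "cmod (?k w e) \<le> cmod (q w * of_real (B / (1 - R)\<^sup>2))" if "cmod w < 1" for w e
    proof -
      have "cmod (u e / (1 - cnj e * w)\<^sup>2) \<le> \<bar>B / (1 - R)\<^sup>2\<bar>"
        using compactly_bounded_kernel[OF u, of w e] that by linarith
      then show ?thesis
        by (simp only: norm_mult complex_mod_cnj norm_of_real mult_left_mono norm_ge_zero)
    qed
    then show "AE x in dA \<Otimes>\<^sub>M dA. norm (case_prod ?k x) \<le> norm (case x of (w, e) \<Rightarrow> q w * complex_of_real (B / (1 - R)\<^sup>2))"
      by (intro AE_I2) (auto simp: space_pair_measure)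
  qed
  have "ipD q (bergman_proj u) = (LINT w|dA. LINT e|dA. ?k w e)"
    unfolding ipD_def bergman_proj_def
    by (simp only: Bochner_Integration.integral_cnj[symmetric] integral_mult_right_zero[symmetric])
  also have "\<dots> = (LINT e|dA. LINT w|dA. ?k w e)"
    using P.Fubini_integral[OF int] by simp
  also have "\<dots> = ipD (bergman_proj q) u"
    unfolding ipD_def bergman_proj_def
  proof (intro Bochner_Integration.integral_cong refl)
    fix e
    have "(LINT w|dA. ?k w e) = (LINT w|dA. q w / (1 - cnj w * e)\<^sup>2 * cnj (u e))"
      by (simp add: mult.commute)
    then show "(LINT w|dA. ?k w e) = (LINT w|dA. q w / (1 - cnj w * e)\<^sup>2) * cnj (u e)"
      by (simp only: integral_mult_left_zero)
  qed
  finally show ?thesis .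
qed


lemma holomorphic_bergman_kernel: "cmod z < 1 \<Longrightarrow> (\<lambda>w. 1 / (1 - w * cnj z)\<^sup>2) holomorphic_on ball 0 1"
  and norm_bergman_kernel_le: "cmod z < 1 \<Longrightarrow> cmod w < 1 \<Longrightarrow> cmod (1 / (1 - w * cnj z)\<^sup>2) \<le> 1 / (1 - cmod z)\<^sup>2"
proof -
  assume z: "cmod z < 1"
  have nz: "1 - w * cnj z \<noteq> 0" if "cmod w < 1" for w
    using one_minus_cnj_mult_nonzero[of z w] z that by (simp add: mult.commute)
  show "(\<lambda>w. 1 / (1 - w * cnj z)\<^sup>2) holomorphic_on ball 0 1"
    by (intro holomorphic_intros) (use nz in auto)
  assume w: "cmod w < 1"
  have "1 - cmod z \<le> cmod (1 - w * cnj z)"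
    using one_minus_cnj_mult_ge[of "cnj w" "cnj z"] w by simp
  then have "(1 - cmod z)\<^sup>2 \<le> (cmod (1 - w * cnj z))\<^sup>2"
    using z by (intro power_mono) auto
  then show "cmod (1 / (1 - w * cnj z)\<^sup>2) \<le> 1 / (1 - cmod z)\<^sup>2"
    using z unfolding norm_divide norm_power by (intro frac_le) auto
qed

lemma ipD_cong: "(\<And>z. cmod z < 1 \<Longrightarrow> a z * cnj (b z) = c z * cnj (d z)) \<Longrightarrow> ipD a b = ipD c d"
  unfolding ipD_def by (intro Bochner_Integration.integral_cong) auto

lemma normD_cong: "(\<And>z. cmod z < 1 \<Longrightarrow> a z = b z) \<Longrightarrow> normD a = normD b"
  unfolding normD_def by (intro arg_cong[where f=sqrt] Bochner_Integration.integral_cong) auto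

lemma ipD_self: "ipD a a = of_real ((normD a)\<^sup>2)"
  unfolding ipD_def normD_def
  by (simp add: complex_norm_square[symmetric] flip: of_real_power)

lemma normD_square: "(normD a)\<^sup>2 = (LINT z|dA. (cmod (a z))\<^sup>2)"
  by (simp add: normD_def)

lemma A2D_measurable: "f \<in> A2D \<Longrightarrow> f \<in> borel_measurable dA"
  by (simp add: A2D_def L2D_def)

text \<open>P reproduces P u, so the squared norm of P u is the inner product of P u with u. This is
  at most half the sum of the two squared norms, and one half is absorbed on the left.\<close>

lemma normD_bergman_proj_le:
  assumes u: "compactly_bounded u R B"
  shows "normD (bergman_proj u) \<le> normD u"
proof -
  let ?v = "bergman_proj u"
  have v: "?v \<in> A2D" by (rule compactly_bounded_A2D[OF u])
  have iv: "integrable dA (\<lambda>z. (cmod (?v z))\<^sup>2)" and iu: "integrable dA (\<lambda>z. (cmod (u z))\<^sup>2)"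
    using v compactly_bounded_L2D[OF u] by (auto simp: A2D_def L2D_def)
  have "of_real ((normD ?v)\<^sup>2) = ipD ?v ?v" by (rule ipD_self[symmetric])
  also have "\<dots> = ipD (bergman_proj ?v) u"
    using v by (intro ipD_bergman_proj[OF u]) (auto simp: A2D_def integrable_L2D)
  also have "\<dots> = ipD ?v u"
    by (rule ipD_cong) (simp add: bergman_proj_reproducing[OF v])
  finally have e: "of_real ((normD ?v)\<^sup>2) = ipD ?v u" .
  have "(normD ?v)\<^sup>2 = cmod (ipD ?v u)"
    by (simp only: e[symmetric] norm_of_real abs_power2)
  also have "\<dots> \<le> (LINT z|dA. cmod (?v z * cnj (u z)))"
    unfolding ipD_def by (rule integral_norm_bound)
  also have "\<dots> \<le> (LINT z|dA. ((cmod (?v z))\<^sup>2 + (cmod (u z))\<^sup>2) / 2)"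
  proof (rule integral_mono')
    show "integrable dA (\<lambda>z. ((cmod (?v z))\<^sup>2 + (cmod (u z))\<^sup>2) / 2)" using iv iu by auto
    show "cmod (?v z * cnj (u z)) \<le> ((cmod (?v z))\<^sup>2 + (cmod (u z))\<^sup>2) / 2" for z
      using sum_squares_bound[of "cmod (?v z)" "cmod (u z)"] by (simp add: norm_mult)
  qed auto
  also have "\<dots> = ((normD ?v)\<^sup>2 + (normD u)\<^sup>2) / 2"
    using iv iu by (simp add: normD_square)
  finally have "(normD ?v)\<^sup>2 \<le> (normD u)\<^sup>2" by simp
  then show ?thesis by (rule power2_le_imp_le) (simp add: normD_def)
qed

lemma compactly_bounded_cnj_mult:
  assumes u: "compactly_bounded u R B" and g: "g \<in> A2D"
  shows "\<exists>B'. compactly_bounded (\<lambda>z. cnj (g z) * u z) R B'"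
proof -
  have R: "0 < R" "R < 1" "0 \<le> B" and ub: "\<And>z. cmod (u z) \<le> B" and u0: "\<And>z. R < cmod z \<Longrightarrow> u z = 0"
    and [measurable]: "u \<in> borel_measurable dA"
    using u by (auto simp: compactly_bounded_def)
  have "continuous_on (ball 0 1) g" using g by (auto simp: A2D_def intro: holomorphic_on_imp_continuous_on)
  then have "continuous_on (cball 0 R) g" by (rule continuous_on_subset) (use R in auto)
  then have "bounded (g ` cball 0 R)" by (intro compact_imp_bounded compact_continuous_image) auto
  then obtain K where "K > 0" and K: "\<And>z. cmod z \<le> R \<Longrightarrow> cmod (g z) \<le> K"
    by (auto simp: bounded_pos)
  have [measurable]: "g \<in> borel_measurable dA" by (rule A2D_measurable[OF g])
  have "cmod (cnj (g z) * u z) \<le> K * B" for z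
  proof (cases "R < cmod z")
    case True
    then show ?thesis using u0 \<open>K > 0\<close> R by simp
  next
    case False
    then show ?thesis using K[of z] ub[of z] \<open>K > 0\<close> by (simp add: norm_mult mult_mono)
  qed
  moreover have "(\<lambda>z. cnj (g z) * u z) \<in> borel_measurable dA" by measurable
  ultimately have "compactly_bounded (\<lambda>z. cnj (g z) * u z) R (K * B)"
    using R \<open>K > 0\<close> u0 by (simp add: compactly_bounded_def)
  then show ?thesis by blast
qed

text \<open>Since \<open>P(\<bar>g u) = P(\<bar>g P u)\<close>, boundedness of the product on the Bergman space controls
  \<open>f P(\<bar>g u)\<close> for arbitrary, not necessarily holomorphic, \<open>u\<close>.\<close>

lemma toeplitz_prod_boundedD:
  assumes bdd: "toeplitz_prod_bounded f g" and f: "f \<in> A2D" and g: "g \<in> A2D"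
  shows "\<exists>C>0. \<forall>u R B. compactly_bounded u R B \<longrightarrow>
    normD (\<lambda>z. f z * bergman_proj (\<lambda>w. cnj (g w) * u w) z) \<le> C * normD u"
proof -
  obtain C where C: "\<And>v. v \<in> toeplitz_adj_dom g \<Longrightarrow> toeplitz_adj g v \<in> toeplitz_dom f \<Longrightarrow>
      normD (toeplitz f (toeplitz_adj g v)) \<le> C * normD v"
    using bdd unfolding toeplitz_prod_bounded_def by blast
  have "normD (\<lambda>z. f z * bergman_proj (\<lambda>w. cnj (g w) * u w) z) \<le> (\<bar>C\<bar> + 1) * normD u"
    if u: "compactly_bounded u R B" for u R B
  proof -
    let ?q = "\<lambda>w. cnj (g w) * u w"
    define v where "v = bergman_proj u"
    define w where "w = bergman_proj ?q"
    obtain B' where q: "compactly_bounded ?q R B'"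
      using compactly_bounded_cnj_mult[OF u g] by blast
    have vA: "v \<in> A2D" and wA: "w \<in> A2D"
      unfolding v_def w_def using compactly_bounded_A2D[OF u] compactly_bounded_A2D[OF q] by auto
    have adj: "ipD (toeplitz g x) v = ipD x w" if x: "x \<in> toeplitz_dom g" for x
    proof -
      have xA: "x \<in> A2D" and gx: "(\<lambda>z. g z * x z) \<in> L2D" using x by (auto simp: toeplitz_dom_def)
      have gxA: "(\<lambda>z. g z * x z) \<in> A2D"
        using gx xA g by (auto simp: A2D_def intro!: holomorphic_intros)
      have "ipD (toeplitz g x) v = ipD (\<lambda>z. g z * x z) v"
        unfolding toeplitz_def by (rule ipD_cong) (simp add: bergman_proj_reproducing[OF gxA])
      also have "\<dots> = ipD (bergman_proj (\<lambda>z. g z * x z)) u"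
        unfolding v_def by (rule ipD_bergman_proj[OF u integrable_L2D[OF gx]])
      also have "\<dots> = ipD (bergman_proj x) ?q"
        by (rule ipD_cong) (simp add: bergman_proj_reproducing[OF gxA] bergman_proj_reproducing[OF xA])
      also have "\<dots> = ipD x w"
        unfolding w_def using xA by (intro ipD_bergman_proj[OF q, symmetric] integrable_L2D) (simp add: A2D_def)
      finally show ?thesis .
    qed
    have vdom: "v \<in> toeplitz_adj_dom g"
      unfolding toeplitz_adj_dom_def using vA wA adj by blast
    define w' where "w' = toeplitz_adj g v"
    have "w' \<in> A2D \<and> (\<forall>x\<in>toeplitz_dom g. ipD (toeplitz g x) v = ipD x w')"
      unfolding w'_def toeplitz_adj_def
      by (rule someI[where P="\<lambda>w. w \<in> A2D \<and> (\<forall>x\<in>toeplitz_dom g. ipD (toeplitz g x) v = ipD x w)" and x=w])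
        (use wA adj in blast)
    then have w'A: "w' \<in> A2D" and w'ip: "\<And>x. x \<in> toeplitz_dom g \<Longrightarrow> ipD x w' = ipD x w"
      using adj by auto
    \<comment> \<open>The adjoint is defined by choice, so its value must be identified. The kernels
      1 / (1 - w cnj z)^2 are bounded, hence lie in the domain of T_g, and pairing with them
      evaluates functions of the Bergman space at z.\<close>
    have w'w: "w' z = w z" if z: "cmod z < 1" for z
    proof -
      let ?k = "\<lambda>w. 1 / (1 - w * cnj z)\<^sup>2"
      have km: "?k \<in> borel_measurable dA"
        by (intro borel_measurable_dA_continuous_on holomorphic_on_imp_continuous_on holomorphic_bergman_kernel z)
      have "?k \<in> A2D"
        unfolding A2D_def using holomorphic_bergman_kernel[OF z] L2D_bounded[OF km norm_bergman_kernel_le[OF z]] by simp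
      moreover have "(\<lambda>w. g w * ?k w) \<in> L2D"
        using g by (intro L2D_mult_bounded[OF _ km norm_bergman_kernel_le[OF z]]) (auto simp: A2D_def)
      ultimately have "?k \<in> toeplitz_dom g" by (simp add: toeplitz_dom_def)
      from w'ip[OF this] have "ipD ?k w' = ipD ?k w" .
      moreover have "ipD ?k h = cnj (h z)" if h: "h \<in> A2D" for h
      proof -
        have "ipD ?k h = (LINT w|dA. cnj (h w / (1 - cnj w * z)\<^sup>2))"
          unfolding ipD_def by simp
        also have "\<dots> = cnj (bergman_proj h z)"
          unfolding bergman_proj_def by (rule Bochner_Integration.integral_cnj)
        finally show ?thesis by (simp add: bergman_proj_reproducing[OF h z])
      qed
      ultimately show ?thesis using w'A wA by simp
    qed
    have fw: "(\<lambda>z. f z * w' z) \<in> L2D"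
    proof (rule L2D_mult_bounded)
      show "f \<in> L2D" using f by (simp add: A2D_def)
      show "w' \<in> borel_measurable dA" by (rule A2D_measurable[OF w'A])
      show "cmod (w' z) \<le> B' / (1 - R)\<^sup>2" if "cmod z < 1" for z
        using that bergman_proj_compactly_bounded[OF q, of z] by (simp add: w'w w_def)
    qed
    then have fwA: "(\<lambda>z. f z * w' z) \<in> A2D"
      using f w'A by (auto simp: A2D_def intro!: holomorphic_intros)
    have "toeplitz_adj g v \<in> toeplitz_dom f"
      using fw w'A by (simp add: toeplitz_dom_def w'_def)
    from C[OF vdom this] have "normD (toeplitz f w') \<le> C * normD v" by (simp add: w'_def)
    moreover have "normD (toeplitz f w') = normD (\<lambda>z. f z * w z)"
      unfolding toeplitz_def by (rule normD_cong) (simp add: bergman_proj_reproducing[OF fwA] w'w)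
    ultimately have "normD (\<lambda>z. f z * w z) \<le> C * normD v" by simp
    also have "\<dots> \<le> (\<bar>C\<bar> + 1) * normD u"
      unfolding v_def using normD_bergman_proj_le[OF u] by (intro mult_mono) (auto simp: normD_def)
    finally show ?thesis by (simp add: w_def)
  qed
  then show ?thesis by (intro exI[of _ "\<bar>C\<bar> + 1"]) auto
qed

text \<open>Pair \<open>f P(\<bar>g u)\<close> with \<open>\<phi> / \<bar>f\<close>, where \<open>u\<close> is \<open>g P \<phi>\<close> cut off to a smaller disc.\<close>

lemma toeplitz_prod_bounded_test:
  assumes bdd: "toeplitz_prod_bounded f g" and f: "f \<in> A2D" and g: "g \<in> A2D"
    and f0: "\<And>z. cmod z < 1 \<Longrightarrow> f z \<noteq> 0"
    and phi: "integrable dA \<phi>" and phif: "integrable dA (\<lambda>z. (cmod (\<phi> z) / cmod (f z))\<^sup>2)"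
    and G: "G holomorphic_on ball 0 1" and proj: "\<And>z. cmod z < 1 \<Longrightarrow> bergman_proj \<phi> z = G z"
  shows "\<exists>K. \<forall>R. 0 < R \<longrightarrow> R < 1 \<longrightarrow>
     (LINT z|dA. (if cmod z \<le> R then (cmod (g z * G z))\<^sup>2 else 0)) \<le> K"
proof -
  obtain C where C: "C > 0" and Cb: "\<And>u R B. compactly_bounded u R B \<Longrightarrow>
    normD (\<lambda>z. f z * bergman_proj (\<lambda>w. cnj (g w) * u w) z) \<le> C * normD u"
    using toeplitz_prod_boundedD[OF bdd f g] by blast
  let ?Y = "LINT z|dA. (cmod (\<phi> z) / cmod (f z))\<^sup>2"
  have [measurable]: "f \<in> borel_measurable dA" "g \<in> borel_measurable dA" "\<phi> \<in> borel_measurable dA"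
    using f g phi by (auto intro: A2D_measurable)
  have Gc: "continuous_on (ball 0 1) G" by (rule holomorphic_on_imp_continuous_on[OF G])
  then have [measurable]: "G \<in> borel_measurable dA" by (rule borel_measurable_dA_continuous_on)
  have gc: "continuous_on (ball 0 1) g" using g by (auto simp: A2D_def intro: holomorphic_on_imp_continuous_on)
  have "(LINT z|dA. (if cmod z \<le> R then (cmod (g z * G z))\<^sup>2 else 0)) \<le> C\<^sup>2 * ?Y"
    if R: "0 < R" "R < 1" for R
  proof -
    define u where "u z = (if cmod z \<le> R then g z * G z else 0)" for z
    have [measurable]: "u \<in> borel_measurable dA" unfolding u_def[abs_def] by measurable
    have "continuous_on (cball 0 R) (\<lambda>z. g z * G z)"
      by (rule continuous_on_subset[of "ball 0 1"]) (use R gc Gc in \<open>auto intro!: continuous_intros\<close>)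
    then have "bounded ((\<lambda>z. g z * G z) ` cball 0 R)" by (intro compact_imp_bounded compact_continuous_image) auto
    then obtain B where "B > 0" and B: "\<And>z. cmod z \<le> R \<Longrightarrow> cmod (g z * G z) \<le> B"
      by (auto simp: bounded_pos)
    then have u: "compactly_bounded u R B"
      using R by (auto simp: compactly_bounded_def u_def)
    have iu: "integrable dA (\<lambda>z. (cmod (u z))\<^sup>2)"
      using compactly_bounded_L2D[OF u] by (simp add: L2D_def)
    let ?q = "\<lambda>w. cnj (g w) * u w"
    obtain B' where q: "compactly_bounded ?q R B'"
      using compactly_bounded_cnj_mult[OF u g] by blast
    define w where "w = bergman_proj ?q"
    have wA: "w \<in> A2D" unfolding w_def by (rule compactly_bounded_A2D[OF q])
    have fwL: "(\<lambda>z. f z * w z) \<in> L2D"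
      using f bergman_proj_compactly_bounded[OF q]
      by (intro L2D_mult_bounded[OF _ A2D_measurable[OF wA], of _ "B' / (1 - R)\<^sup>2"]) (auto simp: A2D_def w_def)
    then have ifw: "integrable dA (\<lambda>z. (cmod (f z * w z))\<^sup>2)" by (simp add: L2D_def)
    have "normD (\<lambda>z. f z * w z) \<le> C * normD u" unfolding w_def by (rule Cb[OF u])
    then have "(normD (\<lambda>z. f z * w z))\<^sup>2 \<le> (C * normD u)\<^sup>2"
      by (rule power_mono) (simp add: normD_def)
    then have fwu: "(LINT z|dA. (cmod (f z * w z))\<^sup>2) \<le> C\<^sup>2 * (normD u)\<^sup>2"
      by (simp add: normD_square power_mult_distrib)
    have "of_real ((normD u)\<^sup>2) = ipD u u" by (rule ipD_self[symmetric])
    also have "\<dots> = ipD (bergman_proj \<phi>) ?q"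
      by (rule ipD_cong) (auto simp: proj u_def)
    also have "\<dots> = ipD \<phi> w"
      unfolding w_def by (rule ipD_bergman_proj[OF q phi, symmetric])
    finally have e: "of_real ((normD u)\<^sup>2) = ipD \<phi> w" .
    have "(normD u)\<^sup>2 = cmod (ipD \<phi> w)"
      by (simp only: e[symmetric] norm_of_real abs_power2)
    also have "\<dots> \<le> (LINT z|dA. cmod (\<phi> z * cnj (w z)))"
      unfolding ipD_def by (rule integral_norm_bound)
    \<comment> \<open>The weight in the arithmetic-geometric mean inequality is the operator
      constant C. Since the squared norm of f w is at most C^2 times that of u, the first summand
      contributes at most half the squared norm of u. That norm is finite thanks to the cutoff, so
      it can be absorbed.\<close>
    also have "\<dots> \<le> (LINT z|dA. ((cmod (f z * w z))\<^sup>2 / C\<^sup>2 + C\<^sup>2 * (cmod (\<phi> z) / cmod (f z))\<^sup>2) / 2)"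
    proof (rule integral_mono_AE')
      show "integrable dA (\<lambda>z. ((cmod (f z * w z))\<^sup>2 / C\<^sup>2 + C\<^sup>2 * (cmod (\<phi> z) / cmod (f z))\<^sup>2) / 2)"
        using ifw phif by auto
      have "cmod (\<phi> z * cnj (w z)) \<le> ((cmod (f z * w z))\<^sup>2 / C\<^sup>2 + C\<^sup>2 * (cmod (\<phi> z) / cmod (f z))\<^sup>2) / 2"
        if z: "cmod z < 1" for z
      proof -
        have "2 * (cmod (f z * w z) / C) * (C * (cmod (\<phi> z) / cmod (f z)))
            \<le> (cmod (f z * w z) / C)\<^sup>2 + (C * (cmod (\<phi> z) / cmod (f z)))\<^sup>2"
          by (rule sum_squares_bound)
        moreover have "2 * (cmod (f z * w z) / C) * (C * (cmod (\<phi> z) / cmod (f z))) = 2 * cmod (\<phi> z * cnj (w z))"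
          using C f0[OF z] by (simp add: norm_mult field_simps)
        ultimately show ?thesis by (simp add: power_divide power_mult_distrib)
      qed
      then show "AE z in dA. cmod (\<phi> z * cnj (w z)) \<le> ((cmod (f z * w z))\<^sup>2 / C\<^sup>2 + C\<^sup>2 * (cmod (\<phi> z) / cmod (f z))\<^sup>2) / 2"
        by (intro AE_I2) simp
    qed auto
    also have "\<dots> = ((LINT z|dA. (cmod (f z * w z))\<^sup>2) / C\<^sup>2 + C\<^sup>2 * ?Y) / 2"
      using ifw phif by simp
    finally have "(normD u)\<^sup>2 \<le> ((LINT z|dA. (cmod (f z * w z))\<^sup>2) / C\<^sup>2 + C\<^sup>2 * ?Y) / 2" .
    moreover have "(LINT z|dA. (cmod (f z * w z))\<^sup>2) / C\<^sup>2 \<le> (normD u)\<^sup>2"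
      using fwu C by (simp add: divide_le_eq mult.commute)
    ultimately have "(normD u)\<^sup>2 \<le> C\<^sup>2 * ?Y" by argo
    moreover have "(LINT z|dA. (if cmod z \<le> R then (cmod (g z * G z))\<^sup>2 else 0)) = (normD u)\<^sup>2"
      unfolding normD_square u_def by (intro Bochner_Integration.integral_cong) auto
    ultimately show ?thesis by simp
  qed
  then show ?thesis by blast
qed

section \<open>Potentials of the Cantor measure\<close>

definition cantor_pot :: "real \<Rightarrow> complex \<Rightarrow> complex" where
  "cantor_pot \<sigma> z = (LINT x|unit_leb. (1 - cnj (cantor_point x) * z) powr (- of_real \<sigma>))"

definition cantor_rpot :: "real \<Rightarrow> complex \<Rightarrow> real" where
  "cantor_rpot \<sigma> z = (LINT x|unit_leb. cmod (z - cantor_point x) powr (- \<sigma>))"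

lemma norm_one_minus_cnj_cantor_point:
  "cmod (1 - cnj (cantor_point x) * z) = cmod (z - cantor_point x)"
proof -
  have "cantor_point x * cnj (cantor_point x) = 1"
    by (metis complex_norm_square norm_cantor_point of_real_1 power_one)
  then have "cantor_point x - z = cantor_point x * (1 - cnj (cantor_point x) * z)"
    by (simp add: algebra_simps flip: mult.assoc)
  then have "cmod (cantor_point x - z) = cmod (1 - cnj (cantor_point x) * z)"
    by (simp add: norm_mult)
  then show ?thesis by (simp add: norm_minus_commute)
qed

lemma integrable_cantor_rpot:
  assumes z: "cmod z < 1" and "\<sigma> > 0"
  shows "integrable unit_leb (\<lambda>x. cmod (z - cantor_point x) powr (- \<sigma>))"
proof (rule unit_leb.integrable_const_bound[where B="(1 - cmod z) powr (- \<sigma>)"])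
  show "AE x in unit_leb. norm (cmod (z - cantor_point x) powr - \<sigma>) \<le> (1 - cmod z) powr - \<sigma>"
    using assms dist_cantor_point_ge[of z] by (intro AE_I2) (auto intro!: powr_mono2')
qed measurable

section \<open>Dyadic bounds for the real potentials\<close>

lemma geometric_sum_le:
  fixes Q :: real assumes "Q > 1" shows "(\<Sum>m\<le>n. Q ^ m) \<le> Q ^ Suc n / (Q - 1)"
proof -
  have "(Q - 1) * (\<Sum>m\<le>n. Q ^ m) = Q ^ Suc n - 1"
    using power_diff_1_eq[of Q "Suc n"] by (simp add: lessThan_Suc_atMost)
  then show ?thesis using assms by (simp add: le_divide_eq mult.commute)
qed

text \<open>Together with \<open>powr_le_near_sum\<close> this makes s^(-\<sigma>) comparable to the
  sum of 4^(\<sigma> m) over the scales m with s \<le> 3 / 4^m. Integrating over \<mu> replaces each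
  indicator by a mass of order 2^-m, so the potential becomes a geometric sum with ratio 4^\<sigma>
  / 2.\<close>

lemma near_sum_le:
  fixes s \<sigma> :: real
  assumes s: "s > 0" and \<sigma>: "\<sigma> > 0"
  shows "(\<Sum>m\<le>n. (4 powr \<sigma>) ^ m * (if s \<le> 3 / 4 ^ m then 1 else 0)) \<le>
    4 powr \<sigma> / (4 powr \<sigma> - 1) * (3 powr \<sigma> * s powr (- \<sigma>))"
proof -
  define Q :: real where "Q = 4 powr \<sigma>"
  have Q: "Q > 1" using \<sigma> by (simp add: Q_def)
  have key: "Q ^ Suc n / (Q - 1) \<le> Q / (Q - 1) * (3 powr \<sigma> * s powr (- \<sigma>))" if "s \<le> 3 / 4 ^ n" for n
  proof -
    have "4 ^ n \<le> 3 / s" using that s by (simp add: field_simps)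
    then have "(4 ^ n) powr \<sigma> \<le> (3 / s) powr \<sigma>" using \<sigma> by (intro powr_mono2) auto
    also have "(3 / s) powr \<sigma> = 3 powr \<sigma> * s powr (- \<sigma>)"
      using s by (simp add: powr_divide powr_minus_divide)
    also have "(4 ^ n) powr \<sigma> = Q ^ n"
      by (simp add: Q_def powr_powr powr_realpow[symmetric] mult.commute)
    finally have "Q / (Q - 1) * Q ^ n \<le> Q / (Q - 1) * (3 powr \<sigma> * s powr (- \<sigma>))"
      using Q by (intro mult_left_mono) auto
    then show ?thesis by simp
  qed
  have "(\<Sum>m\<le>n. Q ^ m * (if s \<le> 3 / 4 ^ m then 1 else 0)) \<le> Q / (Q - 1) * (3 powr \<sigma> * s powr (- \<sigma>))"
  proof (induction n)
    case 0
    show ?case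
    proof (cases "s \<le> 3 / 4 ^ 0")
      case True
      have "1 \<le> Q ^ Suc 0 / (Q - 1)" using Q by simp
      also note key[OF True]
      finally show ?thesis using True by simp
    next
      case False
      then show ?thesis using Q by auto
    qed
  next
    case (Suc n)
    show ?case
    proof (cases "s \<le> 3 / 4 ^ Suc n")
      case True
      have "(\<Sum>m\<le>Suc n. Q ^ m * (if s \<le> 3 / 4 ^ m then 1 else 0)) \<le> (\<Sum>m\<le>Suc n. Q ^ m)"
        using Q by (intro sum_mono) auto
      also have "\<dots> \<le> Q ^ Suc (Suc n) / (Q - 1)" by (rule geometric_sum_le[OF Q])
      also note key[OF True]
      finally show ?thesis .
    next
      case False
      then show ?thesis using Suc by simp
    qed
  qed
  then show ?thesis by (simp add: Q_def)
qed

lemma near_index: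
  fixes s :: real
  assumes "s \<le> 3" "3 / 4 ^ Suc n < s"
  shows "\<exists>m\<le>n. s \<le> 3 / 4 ^ m \<and> 3 / 4 ^ Suc m < s"
  using assms
proof (induction n)
  case 0
  then show ?case by auto
next
  case (Suc n)
  show ?case
  proof (cases "3 / 4 ^ Suc n < s")
    case True
    then show ?thesis using Suc by (meson le_Suc_eq)
  next
    case False
    then show ?thesis using Suc.prems by (intro exI[of _ "Suc n"]) auto
  qed
qed

lemma powr_le_near_sum:
  fixes s \<sigma> :: real
  assumes s: "s \<le> 3" "3 / 4 ^ Suc n < s" and \<sigma>: "\<sigma> > 0"
  shows "s powr (- \<sigma>) \<le> (\<Sum>m\<le>n. (4 powr \<sigma>) ^ Suc m * (if s \<le> 3 / 4 ^ m then 1 else 0))"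
proof -
  obtain m where m: "m \<le> n" "s \<le> 3 / 4 ^ m" "3 / 4 ^ Suc m < s" using near_index[OF s] by blast
  have "1 / 4 ^ Suc m \<le> s" 
  proof -
    have "1 / 4 ^ Suc m \<le> (3 / 4 ^ Suc m :: real)" by (intro divide_right_mono) auto
    then show ?thesis using m(3) by linarith
  qed
  then have "s powr (- \<sigma>) \<le> (1 / 4 ^ Suc m) powr (- \<sigma>)"
    using \<sigma> by (intro powr_mono2') auto
  also have "\<dots> = (4 powr \<sigma>) ^ Suc m"
  proof -
    have "(1 / 4 ^ Suc m) powr (- \<sigma>) = (4 ^ Suc m) powr \<sigma>"
      by (simp only: powr_minus powr_divide powr_one_eq_one) simp
    also have "\<dots> = (4 powr \<sigma>) ^ Suc m"
      by (simp only: powr_realpow[symmetric] powr_powr zero_less_numeral powr_gt_zero mult.commute)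
    finally show ?thesis .
  qed
  also have "\<dots> = (4 powr \<sigma>) ^ Suc m * (if s \<le> 3 / 4 ^ m then 1 else 0)" using m by simp
  also have "\<dots> \<le> (\<Sum>m\<le>n. (4 powr \<sigma>) ^ Suc m * (if s \<le> 3 / 4 ^ m then 1 else 0))"
    using m(1) by (intro member_le_sum) auto
  finally show ?thesis .
qed

lemma near_indicator_integral:
  "integrable unit_leb (\<lambda>x. c * (if cmod (z - cantor_point x) \<le> 3 / 4 ^ m then 1 else 0 :: real))"
  "(LINT x|unit_leb. c * (if cmod (z - cantor_point x) \<le> 3 / 4 ^ m then 1 else 0)) = c * near_mass m z"
proof -
  let ?S = "{x \<in> {0..<1}. cmod (z - cantor_point x) \<le> 3 / 4 ^ m}"
  have S: "?S \<in> sets unit_leb" by (rule sets_near')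
  have e: "c * (if cmod (z - cantor_point x) \<le> 3 / 4 ^ m then 1 else 0) = c * indicator ?S x"
    if "x \<in> space unit_leb" for x using that by auto
  have "integrable unit_leb (\<lambda>x. c * indicator ?S x)"
    using S by (intro integrable_mult_right integrable_real_indicator) (auto simp: less_top[symmetric])
  then show "integrable unit_leb (\<lambda>x. c * (if cmod (z - cantor_point x) \<le> 3 / 4 ^ m then 1 else 0))"
    by (subst Bochner_Integration.integrable_cong[OF refl e])
  have "(LINT x|unit_leb. c * (if cmod (z - cantor_point x) \<le> 3 / 4 ^ m then 1 else 0)) = (LINT x|unit_leb. c * indicator ?S x)"
    by (rule Bochner_Integration.integral_cong[OF refl e])
  also have "\<dots> = c * measure unit_leb ?S"
    using S sets.sets_into_space[OF S] by (simp add: Int_absorb2)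
  finally show "(LINT x|unit_leb. c * (if cmod (z - cantor_point x) \<le> 3 / 4 ^ m then 1 else 0)) = c * near_mass m z"
    by (simp add: near_mass_def)
qed

lemma dist_cantor_point_le: "cmod z < 1 \<Longrightarrow> cmod (z - cantor_point x) \<le> 2"
  using norm_triangle_ineq4[of z "cantor_point x"] by simp

lemma cantor_rpot_le:
  assumes z: "cmod z < 1" and \<sigma>: "\<sigma> > 0"
  shows "cantor_rpot \<sigma> z \<le> 4 * 4 powr \<sigma> * (\<Sum>m\<le>Suc (cantor_level z). (4 powr \<sigma> / 2) ^ m)"
proof -
  let ?N = "cantor_level z" and ?Q = "4 powr \<sigma>"
  have "cantor_rpot \<sigma> z \<le> (LINT x|unit_leb. (\<Sum>m\<le>Suc ?N. ?Q ^ Suc m * (if cmod (z - cantor_point x) \<le> 3 / 4 ^ m then 1 else 0)))"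
    unfolding cantor_rpot_def
  proof (rule integral_mono[OF integrable_cantor_rpot[OF z \<sigma>]])
    show "integrable unit_leb (\<lambda>x. \<Sum>m\<le>Suc ?N. ?Q ^ Suc m * (if cmod (z - cantor_point x) \<le> 3 / 4 ^ m then 1 else 0))"
      by (intro Bochner_Integration.integrable_sum near_indicator_integral)
    fix x assume "x \<in> space unit_leb"
    then have "1 / (2 * 4 ^ ?N) < cmod (z - cantor_point x)" using cantor_level(2)[OF z] by simp
    \<comment> \<open>The sum has to run one step beyond the level N: the distance to the Cantor set
      is only known to exceed (1/2) / 4^N, and 3 / 4^(N+1) is larger than this.\<close>
    moreover have "3 / 4 ^ Suc (Suc ?N) \<le> 1 / (2 * 4 ^ ?N :: real)" by (simp add: field_simps)
    ultimately show "cmod (z - cantor_point x) powr - \<sigma> \<le>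
        (\<Sum>m\<le>Suc ?N. ?Q ^ Suc m * (if cmod (z - cantor_point x) \<le> 3 / 4 ^ m then 1 else 0))"
      using dist_cantor_point_le[OF z, of x] by (intro powr_le_near_sum \<sigma>) linarith+
  qed
  also have "\<dots> = (\<Sum>m\<le>Suc ?N. ?Q ^ Suc m * near_mass m z)"
    by (subst Bochner_Integration.integral_sum) (simp_all only: near_indicator_integral)
  also have "\<dots> \<le> (\<Sum>m\<le>Suc ?N. ?Q ^ Suc m * (4 / 2 ^ m))"
    by (intro sum_mono mult_left_mono near_mass_le) simp
  also have "\<dots> = 4 * ?Q * (\<Sum>m\<le>Suc ?N. (?Q / 2) ^ m)"
    unfolding sum_distrib_left by (intro sum.cong) (auto simp: power_divide)
  finally show ?thesis .
qed

lemma cantor_rpot_ge: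
  assumes z: "cmod z < 1" and \<sigma>: "\<sigma> > 0"
  shows "(\<Sum>m\<le>cantor_level z. (4 powr \<sigma> / 2) ^ m) \<le> 4 powr \<sigma> / (4 powr \<sigma> - 1) * 3 powr \<sigma> * cantor_rpot \<sigma> z"
proof -
  let ?N = "cantor_level z" and ?Q = "4 powr \<sigma>"
  have "(\<Sum>m\<le>?N. (?Q / 2) ^ m) = (\<Sum>m\<le>?N. ?Q ^ m * (1 / 2 ^ m))"
    by (simp add: power_divide)
  also have "\<dots> \<le> (\<Sum>m\<le>?N. ?Q ^ m * near_mass m z)"
    using z by (intro sum_mono mult_left_mono near_mass_ge_level) auto
  also have "\<dots> = (LINT x|unit_leb. (\<Sum>m\<le>?N. ?Q ^ m * (if cmod (z - cantor_point x) \<le> 3 / 4 ^ m then 1 else 0)))"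
    by (subst Bochner_Integration.integral_sum) (simp_all only: near_indicator_integral)
  also have "\<dots> \<le> (LINT x|unit_leb. ?Q / (?Q - 1) * (3 powr \<sigma> * cmod (z - cantor_point x) powr - \<sigma>))"
  proof (rule integral_mono)
    show "integrable unit_leb (\<lambda>x. \<Sum>m\<le>?N. ?Q ^ m * (if cmod (z - cantor_point x) \<le> 3 / 4 ^ m then 1 else 0))"
      by (intro Bochner_Integration.integrable_sum near_indicator_integral)
    show "integrable unit_leb (\<lambda>x. ?Q / (?Q - 1) * (3 powr \<sigma> * cmod (z - cantor_point x) powr - \<sigma>))"
      using integrable_cantor_rpot[OF z \<sigma>] by (intro integrable_mult_right)
    fix x
    have "cmod (z - cantor_point x) > 0" using dist_cantor_point_ge[of z x] z by linarith
    then show "(\<Sum>m\<le>?N. ?Q ^ m * (if cmod (z - cantor_point x) \<le> 3 / 4 ^ m then 1 else 0)) \<le>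
        ?Q / (?Q - 1) * (3 powr \<sigma> * cmod (z - cantor_point x) powr - \<sigma>)"
      by (intro near_sum_le \<sigma>)
  qed
  also have "\<dots> = ?Q / (?Q - 1) * 3 powr \<sigma> * cantor_rpot \<sigma> z"
    unfolding cantor_rpot_def by (simp add: mult.assoc)
  finally show ?thesis .
qed

text \<open>The ratio q = 4^\<sigma> / 2 exceeds 1 precisely for \<sigma> > 1/2. Then the geometric
  sum is comparable to its last term q^N, which is the size \<delta>^(1/2 - \<sigma>).\<close>

lemma cantor_rpot_upper:
  assumes \<sigma>: "\<sigma> > 1/2"
  shows "\<exists>C>0. \<forall>z. cmod z < 1 \<longrightarrow> cantor_rpot \<sigma> z \<le> C * (4 powr \<sigma> / 2) ^ cantor_level z"
proof -
  define q :: real where "q = 4 powr \<sigma> / 2"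
  have "4 powr (1/2) < (4::real) powr \<sigma>" using \<sigma> by (intro powr_less_mono) auto
  then have q: "q > 1" by (simp add: q_def powr_half_sqrt)
  have "cantor_rpot \<sigma> z \<le> 4 * 4 powr \<sigma> * (q ^ 2 / (q - 1)) * q ^ cantor_level z" if z: "cmod z < 1" for z
  proof -
    have "cantor_rpot \<sigma> z \<le> 4 * 4 powr \<sigma> * (\<Sum>m\<le>Suc (cantor_level z). q ^ m)"
      unfolding q_def using \<sigma> by (intro cantor_rpot_le z) auto
    also have "\<dots> \<le> 4 * 4 powr \<sigma> * (q ^ Suc (Suc (cantor_level z)) / (q - 1))"
      by (intro mult_left_mono geometric_sum_le q) auto
    finally show ?thesis by (simp add: power2_eq_square mult_ac)
  qed
  moreover have "4 * 4 powr \<sigma> * (q ^ 2 / (q - 1)) > 0" using q by simp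
  ultimately show ?thesis unfolding q_def by blast
qed

lemma cantor_rpot_lower:
  assumes \<sigma>: "\<sigma> > 1/2"
  shows "\<exists>C>0. \<forall>z. cmod z < 1 \<longrightarrow> (4 powr \<sigma> / 2) ^ cantor_level z \<le> C * cantor_rpot \<sigma> z"
proof -
  have Q: "4 powr \<sigma> > (1::real)" using \<sigma> by simp
  have "(4 powr \<sigma> / 2) ^ cantor_level z \<le> 4 powr \<sigma> / (4 powr \<sigma> - 1) * 3 powr \<sigma> * cantor_rpot \<sigma> z" if z: "cmod z < 1" for z
  proof -
    have "(4 powr \<sigma> / 2) ^ cantor_level z \<le> (\<Sum>m\<le>cantor_level z. (4 powr \<sigma> / 2 :: real) ^ m)"
      by (rule member_le_sum) auto
    also have "\<dots> \<le> 4 powr \<sigma> / (4 powr \<sigma> - 1) * 3 powr \<sigma> * cantor_rpot \<sigma> z"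
      using \<sigma> by (intro cantor_rpot_ge z) auto
    finally show ?thesis .
  qed
  moreover have "4 powr \<sigma> / (4 powr \<sigma> - 1) * 3 powr \<sigma> > (0::real)" using Q by simp
  ultimately show ?thesis by blast
qed

text \<open>At order 1/2 the ratio is 1, so every scale counts equally and the potential counts the
  scales. This is the source of the logarithm.\<close>

lemma cantor_rpot_half:
  assumes z: "cmod z < 1"
  shows "cantor_rpot (1/2) z \<le> 16 * (real (cantor_level z) + 1)"
    and "real (cantor_level z) + 1 \<le> 4 * cantor_rpot (1/2) z"
proof -
  have 4: "4 powr (1/2) = (2::real)" by (simp add: powr_half_sqrt)
  show "cantor_rpot (1/2) z \<le> 16 * (real (cantor_level z) + 1)"
    using cantor_rpot_le[OF z, of "1/2"] unfolding 4 by simp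
  have r0: "cantor_rpot (1/2) z \<ge> 0" unfolding cantor_rpot_def by (rule integral_nonneg_AE) auto
  have "real (cantor_level z) + 1 \<le> 2 * sqrt 3 * cantor_rpot (1/2) z"
    using cantor_rpot_ge[OF z, of "1/2"] unfolding 4 by (simp add: powr_half_sqrt add.commute)
  also have "\<dots> \<le> 2 * 2 * cantor_rpot (1/2) z"
    using r0 real_sqrt_le_mono[of 3 4] by (intro mult_mono) auto
  finally show "real (cantor_level z) + 1 \<le> 4 * cantor_rpot (1/2) z" by simp
qed

section \<open>The holomorphic potentials and their sector\<close>

lemma Re_one_minus_cantor_pos: "cmod z < 1 \<Longrightarrow> Re (1 - cnj (cantor_point x) * z) > 0"
  using Re_one_minus_mult_ge[of "cnj (cantor_point x)" z] by simp

lemma measurable_cantor_kernel [measurable]: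
  "cmod z < 1 \<Longrightarrow> (\<lambda>x. (1 - cnj (cantor_point x) * z) powr s) \<in> borel_measurable unit_leb"
  using Re_one_minus_cantor_pos by (intro borel_measurable_powr_Re_pos) auto

lemma norm_cantor_kernel:
  "cmod ((1 - cnj (cantor_point x) * z) powr (- of_real \<sigma>)) = cmod (z - cantor_point x) powr (- \<sigma>)"
  by (subst norm_powr_real_powr') (auto simp: norm_one_minus_cnj_cantor_point)

lemma integrable_cantor_kernel:
  assumes "cmod z < 1" "\<sigma> > 0"
  shows "integrable unit_leb (\<lambda>x. (1 - cnj (cantor_point x) * z) powr (- of_real \<sigma>))"
  by (rule Bochner_Integration.integrable_bound[OF integrable_cantor_rpot[OF assms]])
    (use assms in \<open>auto simp: norm_cantor_kernel intro!: measurable_cantor_kernel\<close>)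

lemma norm_cantor_pot_le:
  assumes "cmod z < 1" "\<sigma> > 0"
  shows "cmod (cantor_pot \<sigma> z) \<le> cantor_rpot \<sigma> z"
proof -
  have "cmod (cantor_pot \<sigma> z) \<le> (LINT x|unit_leb. cmod ((1 - cnj (cantor_point x) * z) powr (- of_real \<sigma>)))"
    unfolding cantor_pot_def by (rule integral_norm_bound)
  then show ?thesis by (simp only: norm_cantor_kernel cantor_rpot_def)
qed

text \<open>The argument of v is below pi/2 in absolute value, so that of v^(-\<sigma>) is below
  \<sigma> pi/2. No cancellation can then occur in the integral over \<mu>, and real part, modulus
  and real potential are all comparable.\<close>

lemma Re_powr_sector:
  assumes v: "Re v > 0" and \<sigma>: "0 < \<sigma>" "\<sigma> < 1"
  shows "Re (v powr (- of_real \<sigma>)) \<ge> cos (\<sigma> * pi / 2) * cmod v powr (- \<sigma>)"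
proof -
  have v0: "v \<noteq> 0" using v by auto
  have im: "\<bar>Im (Ln v)\<bar> < pi / 2" using Re_Ln_pos_lt[OF v0] v by simp
  have "Re (v powr (- of_real \<sigma>)) = exp (- \<sigma> * ln (cmod v)) * cos (\<sigma> * Im (Ln v))"
    using v0 by (simp add: powr_def Re_exp Re_Ln)
  also have "exp (- \<sigma> * ln (cmod v)) = cmod v powr (- \<sigma>)" using v0 by (simp add: powr_def)
  also have "cos (\<sigma> * Im (Ln v)) = cos (\<sigma> * \<bar>Im (Ln v)\<bar>)"
    by (metis abs_of_pos abs_mult cos_abs_real \<sigma>(1))
  finally have e: "Re (v powr (- of_real \<sigma>)) = cmod v powr (- \<sigma>) * cos (\<sigma> * \<bar>Im (Ln v)\<bar>)" .
  have "cos (\<sigma> * pi / 2) \<le> cos (\<sigma> * \<bar>Im (Ln v)\<bar>)"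
  proof (rule cos_monotone_0_pi_le)
    show "\<sigma> * \<bar>Im (Ln v)\<bar> \<le> \<sigma> * pi / 2" using mult_left_mono[of "\<bar>Im (Ln v)\<bar>" "pi / 2" \<sigma>] im \<sigma> by simp
    show "\<sigma> * pi / 2 \<le> pi" using mult_right_mono[of \<sigma> 1 pi] \<sigma> pi_gt_zero by simp
  qed (use \<sigma> in auto)
  then show ?thesis unfolding e by (simp add: mult.commute mult_left_mono)
qed

lemma Re_cantor_pot_ge:
  assumes z: "cmod z < 1" and \<sigma>: "0 < \<sigma>" "\<sigma> < 1"
  shows "Re (cantor_pot \<sigma> z) \<ge> cos (\<sigma> * pi / 2) * cantor_rpot \<sigma> z"
proof -
  have "cos (\<sigma> * pi / 2) * cantor_rpot \<sigma> z = (LINT x|unit_leb. cos (\<sigma> * pi / 2) * cmod (z - cantor_point x) powr (- \<sigma>))"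
    unfolding cantor_rpot_def by simp
  also have "\<dots> \<le> (LINT x|unit_leb. Re ((1 - cnj (cantor_point x) * z) powr (- of_real \<sigma>)))"
  proof (rule integral_mono)
    show "integrable unit_leb (\<lambda>x. cos (\<sigma> * pi / 2) * cmod (z - cantor_point x) powr (- \<sigma>))"
      using integrable_cantor_rpot[OF z \<sigma>(1)] by simp
    show "integrable unit_leb (\<lambda>x. Re ((1 - cnj (cantor_point x) * z) powr (- of_real \<sigma>)))"
      using integrable_cantor_kernel[OF z \<sigma>(1)] by (rule integrable_Re)
    show "cos (\<sigma> * pi / 2) * cmod (z - cantor_point x) powr - \<sigma> \<le> Re ((1 - cnj (cantor_point x) * z) powr - of_real \<sigma>)" for x
      using Re_powr_sector[OF Re_one_minus_cantor_pos[OF z] \<sigma>, of x] by (simp only: norm_one_minus_cnj_cantor_point)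
  qed
  also have "\<dots> = Re (cantor_pot \<sigma> z)"
    unfolding cantor_pot_def using integral_Re[OF integrable_cantor_kernel[OF z \<sigma>(1)]] by simp
  finally show ?thesis .
qed

lemma cantor_pot_derivative:
  assumes z: "cmod z < 1" and \<sigma>: "\<sigma> > 0"
  shows "(cantor_pot \<sigma> has_field_derivative
    (LINT x|unit_leb. of_real \<sigma> * cnj (cantor_point x) * (1 - cnj (cantor_point x) * z) powr (- of_real \<sigma> - 1))) (at z)"
proof -
  have "((\<lambda>z. LINT x|unit_leb. 1 * (1 - cnj (cantor_point x) * z) powr (- of_real \<sigma>)) has_field_derivative
     (LINT x|unit_leb. 1 * (of_real \<sigma> * cnj (cantor_point x) * (1 - cnj (cantor_point x) * z) powr (- of_real \<sigma> - 1)))) (at z)"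
    by (rule has_field_derivative_power_kernel_integral[OF _ _ _ \<sigma> z])
      (auto intro!: unit_leb.integrable_const_bound)
  then show ?thesis by (simp add: cantor_pot_def[abs_def])
qed

lemma holomorphic_cantor_pot:
  assumes "\<sigma> > 0" shows "cantor_pot \<sigma> holomorphic_on ball 0 1"
  using cantor_pot_derivative[OF _ assms]
  by (meson field_differentiable_at_within field_differentiable_def holomorphic_onI mem_ball_0)

text \<open>Order \<sigma> + 1 is outside the range of the sector argument, but for the derivative
  an upper bound is enough and the triangle inequality gives it.\<close>

lemma norm_deriv_cantor_pot_le:
  assumes z: "cmod z < 1" and \<sigma>: "\<sigma> > 0"
  shows "cmod (deriv (cantor_pot \<sigma>) z) \<le> \<sigma> * cantor_rpot (\<sigma> + 1) z"
proof -
  have "cmod (deriv (cantor_pot \<sigma>) z) = cmod (LINT x|unit_leb. of_real \<sigma> * cnj (cantor_point x) * (1 - cnj (cantor_point x) * z) powr (- of_real \<sigma> - 1))"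
    using DERIV_imp_deriv[OF cantor_pot_derivative[OF assms]] by simp
  also have "\<dots> \<le> (LINT x|unit_leb. cmod (of_real \<sigma> * cnj (cantor_point x) * (1 - cnj (cantor_point x) * z) powr (- of_real \<sigma> - 1)))"
    by (rule integral_norm_bound)
  also have "\<dots> = (LINT x|unit_leb. \<sigma> * cmod (z - cantor_point x) powr (- (\<sigma> + 1)))"
  proof (rule Bochner_Integration.integral_cong[OF refl])
    fix x
    have "- complex_of_real \<sigma> - 1 = - of_real (\<sigma> + 1)" by simp
    then show "cmod (of_real \<sigma> * cnj (cantor_point x) * (1 - cnj (cantor_point x) * z) powr (- of_real \<sigma> - 1)) =
       \<sigma> * cmod (z - cantor_point x) powr (- (\<sigma> + 1))"
      using \<sigma> norm_cantor_kernel[of x z "\<sigma> + 1"] by (simp only: norm_mult) simp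
  qed
  also have "\<dots> = \<sigma> * cantor_rpot (\<sigma> + 1) z" by (simp add: cantor_rpot_def)
  finally show ?thesis .
qed

section \<open>Kernel estimates\<close>

text \<open>The difference of the squares is (1 - |w|^2) (1 - |z|^2). This allows the kernel |1 -
  cnj w z| to be treated as a distance from w to z.\<close>

lemma norm_diff_le_one_minus_cnj:
  assumes "cmod w < 1" "cmod z < 1"
  shows "cmod (w - z) \<le> cmod (1 - cnj w * z)"
proof -
  have "(cmod (1 - cnj w * z))\<^sup>2 - (cmod (w - z))\<^sup>2 = (1 - (cmod w)\<^sup>2) * (1 - (cmod z)\<^sup>2)"
    unfolding cmod_power2 by (simp add: algebra_simps power2_eq_square)
  also have "\<dots> \<ge> 0" using assms by (intro mult_nonneg_nonneg) (auto simp: abs_square_le_1)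
  finally have "(cmod (w - z))\<^sup>2 \<le> (cmod (1 - cnj w * z))\<^sup>2" by simp
  then show ?thesis by (rule power2_le_imp_le) simp
qed

lemma quad_index:
  fixes v r :: real
  assumes "0 < r" "r \<le> v"
  shows "\<exists>j::nat. 4 ^ j * r \<le> v \<and> v \<le> 4 ^ Suc j * r"
proof -
  obtain n where n: "v / r < 4 ^ n" using real_arch_pow[of 4 "v / r"] by auto
  then have "v \<le> 4 ^ n * r" using assms by (simp add: field_simps)
  then have ex: "\<exists>n. v \<le> 4 ^ n * r" by blast
  define k where "k = (LEAST n. v \<le> 4 ^ n * r)"
  have k: "v \<le> 4 ^ k * r" unfolding k_def by (rule LeastI_ex[OF ex])
  show ?thesis
  proof (cases k)
    case 0
    then show ?thesis using k assms by (intro exI[of _ 0]) auto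
  next
    case (Suc j)
    then have "\<not> v \<le> 4 ^ j * r" unfolding k_def by (metis lessI not_less_Least)
    then show ?thesis using k Suc by (intro exI[of _ j]) auto
  qed
qed

lemma ennreal_term_le_suminf: "f j \<le> (\<Sum>i. f i)" for f :: "nat \<Rightarrow> ennreal"
  using sum_le_suminf[of f "{j}"] by simp

text \<open>Cut the disc into shells where |1 - cnj w z| is about 4^j r with r = 1 - |z|. A shell
  lies in a disc of area (4^(j+1) r)^2, so the contributions are 16 r^(2 - \<sigma>) q^j with q =
  4^(2 - \<sigma>) < 1.\<close>

lemma nn_integral_kernel_le:
  assumes \<sigma>: "\<sigma> > 2"
  shows "\<exists>C>0. \<forall>z. cmod z < 1 \<longrightarrow>
    (\<integral>\<^sup>+w. ennreal (cmod (1 - cnj w * z) powr (- \<sigma>)) \<partial>dA) \<le> ennreal (C * (1 - cmod z) powr (2 - \<sigma>))"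
proof -
  define q :: real where "q = 4 powr (2 - \<sigma>)"
  have "4 powr (2 - \<sigma>) < (4::real) powr 0" using \<sigma> by (intro powr_less_mono) auto
  then have q: "0 < q" "q < 1" by (simp_all add: q_def)
  have "(\<integral>\<^sup>+w. ennreal (cmod (1 - cnj w * z) powr (- \<sigma>)) \<partial>dA) \<le> ennreal (16 / (1 - q) * (1 - cmod z) powr (2 - \<sigma>))"
    if z: "cmod z < 1" for z
  proof -
    define r where "r = 1 - cmod z"
    have r: "r > 0" using z by (simp add: r_def)
    let ?S = "\<lambda>j. {w \<in> ball 0 1. cmod (w - z) \<le> 4 ^ Suc j * r}"
    have S: "?S j \<in> sets dA" for j
    proof -
      have "{w \<in> space dA. cmod (w - z) \<le> 4 ^ Suc j * r} \<in> sets dA" by measurable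
      then show ?thesis by simp
    qed
    have "(\<integral>\<^sup>+w. ennreal (cmod (1 - cnj w * z) powr (- \<sigma>)) \<partial>dA)
        \<le> (\<integral>\<^sup>+w. (\<Sum>j. ennreal ((4 ^ j * r) powr (- \<sigma>)) * indicator (?S j) w) \<partial>dA)"
    proof (rule nn_integral_mono)
      fix w assume "w \<in> space dA"
      then have w: "cmod w < 1" by simp
      obtain j where j: "4 ^ j * r \<le> cmod (1 - cnj w * z)" "cmod (1 - cnj w * z) \<le> 4 ^ Suc j * r"
        using quad_index[OF r, of "cmod (1 - cnj w * z)"] one_minus_cnj_mult_ge[of w z] w
        by (auto simp: r_def)
      have "cmod (1 - cnj w * z) powr (- \<sigma>) \<le> (4 ^ j * r) powr (- \<sigma>)"
        using j r \<sigma> by (intro powr_mono2') auto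
      then have "ennreal (cmod (1 - cnj w * z) powr (- \<sigma>)) \<le> ennreal ((4 ^ j * r) powr (- \<sigma>)) * indicator (?S j) w"
        using w j norm_diff_le_one_minus_cnj[OF w z] by (auto intro!: ennreal_leI)
      also have "\<dots> \<le> (\<Sum>i. ennreal ((4 ^ i * r) powr (- \<sigma>)) * indicator (?S i) w)"
        by (rule ennreal_term_le_suminf)
      finally show "ennreal (cmod (1 - cnj w * z) powr (- \<sigma>)) \<le> (\<Sum>i. ennreal ((4 ^ i * r) powr (- \<sigma>)) * indicator (?S i) w)" .
    qed
    also have "\<dots> = (\<Sum>j. \<integral>\<^sup>+w. ennreal ((4 ^ j * r) powr (- \<sigma>)) * indicator (?S j) w \<partial>dA)"
      using S by (intro nn_integral_suminf) auto
    also have "\<dots> = (\<Sum>j. ennreal ((4 ^ j * r) powr (- \<sigma>)) * emeasure dA (?S j))"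
      using S by (simp add: nn_integral_cmult_indicator)
    also have "\<dots> \<le> (\<Sum>j. ennreal (16 * r powr (2 - \<sigma>) * q ^ j))"
    proof (rule suminf_le)
      fix j
      have "ennreal ((4 ^ j * r) powr (- \<sigma>)) * emeasure dA (?S j) \<le> ennreal ((4 ^ j * r) powr (- \<sigma>)) * ennreal ((4 ^ Suc j * r)\<^sup>2)"
        using r by (intro mult_left_mono emeasure_dA_cball_le) auto
      also have "\<dots> = ennreal ((4 ^ j * r) powr (- \<sigma>) * (4 ^ Suc j * r)\<^sup>2)"
        by (simp add: ennreal_mult)
      also have "(4 ^ j * r) powr (- \<sigma>) * (4 ^ Suc j * r)\<^sup>2 = 16 * ((4 ^ j * r) powr (- \<sigma>) * (4 ^ j * r) powr 2)"
        using r by (simp add: power_mult_distrib power2_eq_square)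
      also have "(4 ^ j * r) powr (- \<sigma>) * (4 ^ j * r) powr 2 = (4 ^ j * r) powr (2 - \<sigma>)"
        by (simp flip: powr_add)
      also have "\<dots> = q ^ j * r powr (2 - \<sigma>)"
        using r by (simp add: powr_mult q_def powr_powr powr_realpow[symmetric] mult.commute)
      finally show "ennreal ((4 ^ j * r) powr (- \<sigma>)) * emeasure dA (?S j) \<le> ennreal (16 * r powr (2 - \<sigma>) * q ^ j)"
        by (simp add: mult_ac)
    qed auto
    also have "\<dots> = ennreal (\<Sum>j. 16 * r powr (2 - \<sigma>) * q ^ j)"
      using q by (intro suminf_ennreal2 summable_mult summable_geometric) auto
    also have "(\<Sum>j. 16 * r powr (2 - \<sigma>) * q ^ j) = 16 * r powr (2 - \<sigma>) * (1 / (1 - q))"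
      using q by (subst suminf_mult) (auto simp: suminf_geometric intro: summable_geometric)
    finally show ?thesis by (simp add: r_def mult_ac)
  qed
  moreover have "16 / (1 - q) > 0" using q by simp
  ultimately show ?thesis by blast
qed

text \<open>A radial kernel whose potential against \<mu> dominates the weight 8^N (N+1)^(-3/2). It
  turns area integrals near the whole Cantor set into integrals around a single point t by Fubini.
  The factor 16^m compensates the area of the disc of radius 3 / 4^m, leaving the summable
  m^(-3/2).\<close>

definition tail_kernel :: "real \<Rightarrow> ennreal" where
  "tail_kernel s = (\<Sum>m. ennreal (16 ^ m * real (Suc m) powr (- 3 / 2)) * (if s \<le> 3 / 4 ^ m then 1 else 0))"

lemma measurable_tail_kernel [measurable]: "tail_kernel \<in> borel_measurable borel"
  unfolding tail_kernel_def[abs_def] by measurable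

lemma tail_kernel_le:
  assumes s: "s > 0"
  shows "tail_kernel s \<le> ennreal (10 / s\<^sup>2)"
  unfolding tail_kernel_def
proof (rule suminf_le_const)
  fix n
  have le: "ennreal (16 ^ m * real (Suc m) powr (- 3 / 2)) * (if s \<le> 3 / 4 ^ m then 1 else 0)
      \<le> ennreal ((4 powr 2) ^ m * (if s \<le> 3 / 4 ^ m then 1 else 0))" for m
  proof -
    have "real (Suc m) powr (- 3 / 2) \<le> real (Suc m) powr 0" by (intro powr_mono) auto
    then have "16 ^ m * real (Suc m) powr (- 3 / 2) \<le> 16 ^ m * 1" by (intro mult_left_mono) auto
    then show ?thesis by (auto intro!: ennreal_leI)
  qed
  have "(\<Sum>m<n. ennreal (16 ^ m * real (Suc m) powr (- 3 / 2)) * (if s \<le> 3 / 4 ^ m then 1 else 0))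
      \<le> (\<Sum>m<n. ennreal ((4 powr 2) ^ m * (if s \<le> 3 / 4 ^ m then 1 else 0)))"
    by (intro sum_mono le)
  also have "\<dots> \<le> (\<Sum>m\<le>n. ennreal ((4 powr 2) ^ m * (if s \<le> 3 / 4 ^ m then 1 else 0)))"
    by (intro sum_mono2) auto
  also have "\<dots> = ennreal (\<Sum>m\<le>n. (4 powr 2) ^ m * (if s \<le> 3 / 4 ^ m then 1 else 0))"
    by (intro sum_ennreal) auto
  also have "\<dots> \<le> ennreal (4 powr 2 / (4 powr 2 - 1) * (3 powr 2 * s powr (- 2)))"
    using s by (intro ennreal_leI near_sum_le) auto
  \<comment> \<open>The constant of \<open>near_sum_le\<close> for order 2 is (16/15) * 9 =
    9.6.\<close>
  also have "\<dots> \<le> ennreal (10 / s\<^sup>2)"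
    using s by (intro ennreal_leI) (simp add: powr_minus_divide field_simps)
  finally show "(\<Sum>m<n. ennreal (16 ^ m * real (Suc m) powr (- 3 / 2)) * (if s \<le> 3 / 4 ^ m then 1 else 0)) \<le> ennreal (10 / s\<^sup>2)" .
qed auto

lemma nn_integral_tail_kernel_le: "\<exists>C>0. \<forall>t. (\<integral>\<^sup>+z. tail_kernel (cmod (z - t)) \<partial>dA) \<le> ennreal C"
proof -
  define a where "a m = 9 * real (Suc m) powr (- 3 / 2)" for m
  have "summable (\<lambda>m. real m powr (- 3 / 2))" by (subst summable_real_powr_iff) simp
  then have a: "summable a"
    unfolding a_def by (intro summable_mult) (subst summable_Suc_iff)
  have a0: "a m \<ge> 0" for m by (simp add: a_def)
  have "(\<integral>\<^sup>+z. tail_kernel (cmod (z - t)) \<partial>dA) \<le> ennreal (suminf a + 1)" for t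
  proof -
    let ?S = "\<lambda>m. {z \<in> ball 0 1. cmod (z - t) \<le> 3 / 4 ^ m}"
    have S: "?S m \<in> sets dA" for m
    proof -
      have "{z \<in> space dA. cmod (z - t) \<le> 3 / 4 ^ m} \<in> sets dA" by measurable
      then show ?thesis by simp
    qed
    let ?c = "\<lambda>m. ennreal (16 ^ m * real (Suc m) powr (- 3 / 2))"
    have "(\<integral>\<^sup>+z. tail_kernel (cmod (z - t)) \<partial>dA) = (\<integral>\<^sup>+z. (\<Sum>m. ?c m * indicator (?S m) z) \<partial>dA)"
      unfolding tail_kernel_def by (intro nn_integral_cong suminf_cong) auto
    also have "\<dots> = (\<Sum>m. \<integral>\<^sup>+z. ?c m * indicator (?S m) z \<partial>dA)"
      using S by (intro nn_integral_suminf) auto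
    also have "\<dots> = (\<Sum>m. ?c m * emeasure dA (?S m))"
      using S by (simp add: nn_integral_cmult_indicator)
    also have "\<dots> \<le> (\<Sum>m. ennreal (a m))"
    proof (rule suminf_le)
      fix m
      have "?c m * emeasure dA (?S m) \<le> ?c m * ennreal ((3 / 4 ^ m)\<^sup>2)"
        by (intro mult_left_mono emeasure_dA_cball_le) auto
      also have "\<dots> = ennreal (16 ^ m * real (Suc m) powr (- 3 / 2) * (3 / 4 ^ m)\<^sup>2)"
        by (simp add: ennreal_mult)
      also have "16 ^ m * real (Suc m) powr (- 3 / 2) * (3 / 4 ^ m)\<^sup>2 = a m"
      proof -
        have "(16::real) ^ m = (4 ^ m)\<^sup>2" by (simp add: power2_eq_square flip: power_mult_distrib)
        then show ?thesis by (simp add: a_def power_divide)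
      qed
      finally show "?c m * emeasure dA (?S m) \<le> ennreal (a m)" .
    qed auto
    also have "\<dots> = ennreal (suminf a)" using a a0 by (intro suminf_ennreal2) auto
    also have "\<dots> \<le> ennreal (suminf a + 1)" by (intro ennreal_leI) simp
    finally show ?thesis .
  qed
  moreover have "suminf a + 1 > 0" using suminf_nonneg[OF a a0] by linarith
  ultimately show ?thesis by blast
qed

text \<open>Of the series only the term m = N is kept: the disc of radius 3 / 4^N about z has mass
  at least 2^-N, and 16^N * 2^-N = 8^N.\<close>

lemma level_le_tail_kernel:
  assumes z: "cmod z < 1"
  shows "ennreal (8 ^ cantor_level z * (real (cantor_level z) + 1) powr (- 3 / 2))
    \<le> (\<integral>\<^sup>+x. tail_kernel (cmod (z - cantor_point x)) \<partial>unit_leb)"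
proof -
  let ?N = "cantor_level z"
  let ?c = "16 ^ ?N * real (Suc ?N) powr (- 3 / 2)"
  let ?S = "{x \<in> {0..<1}. cmod (z - cantor_point x) \<le> 3 / 4 ^ ?N}"
  have "(8::real) ^ ?N = 16 ^ ?N * (1 / 2 ^ ?N)" by (simp add: power_divide[symmetric])
  then have "8 ^ ?N * (real ?N + 1) powr (- 3 / 2) = ?c * (1 / 2 ^ ?N)" by (simp add: add.commute)
  also have "\<dots> \<le> ?c * near_mass ?N z"
    by (intro mult_left_mono near_mass_ge_level z) auto
  finally have "ennreal (8 ^ ?N * (real ?N + 1) powr (- 3 / 2)) \<le> ennreal (?c * near_mass ?N z)"
    by (rule ennreal_leI)
  also have "\<dots> = ennreal ?c * emeasure unit_leb ?S"
    by (simp only: near_mass_def unit_leb.emeasure_eq_measure) (simp add: ennreal_mult)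
  also have "\<dots> = (\<integral>\<^sup>+x. ennreal ?c * indicator ?S x \<partial>unit_leb)"
    by (rule nn_integral_cmult_indicator[symmetric, OF sets_near'])
  also have "\<dots> \<le> (\<integral>\<^sup>+x. tail_kernel (cmod (z - cantor_point x)) \<partial>unit_leb)"
  proof (rule nn_integral_mono)
    fix x
    let ?f = "\<lambda>m. ennreal (16 ^ m * real (Suc m) powr (- 3 / 2)) * (if cmod (z - cantor_point x) \<le> 3 / 4 ^ m then 1 else 0)"
    have "ennreal ?c * indicator ?S x \<le> ?f ?N" by (auto split: split_indicator)
    also have "\<dots> \<le> (\<Sum>m. ?f m)" by (rule ennreal_term_le_suminf)
    finally show "ennreal ?c * indicator ?S x \<le> tail_kernel (cmod (z - cantor_point x))"
      by (simp add: tail_kernel_def)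
  qed
  finally show ?thesis .
qed

text \<open>Let s = |z - t| and r = 1 - |z| \<le> s. Where |w - t| \<le> s/2 the kernel satisfies |1
  - cnj w z| \<ge> s/2, so the Berezin weight is at most 16 r^2 / s^4 and the total mass of
  \<open>tail_kernel\<close> suffices. Elsewhere \<open>tail_kernel\<close> is at most 40 / s^2 and
  the Berezin weight has bounded integral.\<close>

lemma nn_integral_tail_kernel_weight:
  "\<exists>C>0. \<forall>z t. cmod z < 1 \<longrightarrow> cmod t = 1 \<longrightarrow>
    (\<integral>\<^sup>+w. tail_kernel (cmod (w - t)) * ennreal ((1 - cmod z)\<^sup>2 * cmod (1 - cnj w * z) powr (- 4)) \<partial>dA)
      \<le> ennreal (C * cmod (z - t) powr (- 2))"
proof -
  obtain C1 where C1: "C1 > 0" and C1b: "\<And>t. (\<integral>\<^sup>+z. tail_kernel (cmod (z - t)) \<partial>dA) \<le> ennreal C1"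
    using nn_integral_tail_kernel_le by blast
  obtain C2 where C2: "C2 > 0" and C2b: "\<And>z. cmod z < 1 \<Longrightarrow>
      (\<integral>\<^sup>+w. ennreal (cmod (1 - cnj w * z) powr (- 4)) \<partial>dA) \<le> ennreal (C2 * (1 - cmod z) powr (2 - 4))"
    using nn_integral_kernel_le[of 4] by auto
  have "(\<integral>\<^sup>+w. tail_kernel (cmod (w - t)) * ennreal ((1 - cmod z)\<^sup>2 * cmod (1 - cnj w * z) powr (- 4)) \<partial>dA)
      \<le> ennreal ((16 * C1 + 40 * C2) * cmod (z - t) powr (- 2))" if z: "cmod z < 1" and t: "cmod t = 1" for z t
  proof -
    define s where "s = cmod (z - t)"
    define r where "r = 1 - cmod z"
    have r: "r > 0" using z by (simp add: r_def)
    have rs: "r \<le> s" unfolding r_def s_def using norm_triangle_ineq2[of t z] t by (simp add: norm_minus_commute)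
    have s: "s > 0" using r rs by linarith
    let ?v = "\<lambda>w. cmod (1 - cnj w * z)"
    have "(\<integral>\<^sup>+w. tail_kernel (cmod (w - t)) * ennreal (r\<^sup>2 * ?v w powr (- 4)) \<partial>dA)
       \<le> (\<integral>\<^sup>+w. ennreal (r\<^sup>2 * (16 / s ^ 4)) * tail_kernel (cmod (w - t)) + ennreal (40 / s\<^sup>2 * r\<^sup>2) * ennreal (?v w powr (- 4)) \<partial>dA)"
    proof (rule nn_integral_mono)
      fix w assume "w \<in> space dA"
      then have w: "cmod w < 1" by simp
      show "tail_kernel (cmod (w - t)) * ennreal (r\<^sup>2 * ?v w powr (- 4)) \<le>
         ennreal (r\<^sup>2 * (16 / s ^ 4)) * tail_kernel (cmod (w - t)) + ennreal (40 / s\<^sup>2 * r\<^sup>2) * ennreal (?v w powr (- 4))"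
      proof (cases "cmod (w - t) \<le> s / 2")
        case True
        have "s \<le> cmod (w - z) + cmod (w - t)"
          unfolding s_def using norm_triangle_ineq4[of "w - t" "w - z"] by simp
        then have "s / 2 \<le> ?v w" using True norm_diff_le_one_minus_cnj[OF w z] by linarith
        then have "?v w powr (- 4) \<le> (s / 2) powr (- 4)" using s by (intro powr_mono2') auto
        also have "\<dots> = 16 / s ^ 4"
          using s by (simp add: powr_minus_divide power_divide)
        finally have "r\<^sup>2 * ?v w powr (- 4) \<le> r\<^sup>2 * (16 / s ^ 4)" by (intro mult_left_mono) auto
        then have "tail_kernel (cmod (w - t)) * ennreal (r\<^sup>2 * ?v w powr (- 4)) \<le> tail_kernel (cmod (w - t)) * ennreal (r\<^sup>2 * (16 / s ^ 4))"
          by (rule mult_left_mono[OF ennreal_leI]) auto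
        then show ?thesis by (simp add: mult.commute add_increasing2)
      next
        case False
        then have "tail_kernel (cmod (w - t)) \<le> ennreal (10 / (cmod (w - t))\<^sup>2)"
          using s by (intro tail_kernel_le) linarith
        also have "\<dots> \<le> ennreal (10 / (s / 2)\<^sup>2)"
          using False s by (intro ennreal_leI divide_left_mono power_mono mult_pos_pos) auto
        also have "10 / (s / 2)\<^sup>2 = 40 / s\<^sup>2" by (simp add: power_divide)
        finally have "tail_kernel (cmod (w - t)) * ennreal (r\<^sup>2 * ?v w powr (- 4)) \<le> ennreal (40 / s\<^sup>2) * ennreal (r\<^sup>2 * ?v w powr (- 4))"
          by (intro mult_right_mono) auto
        also have "\<dots> = ennreal (40 / s\<^sup>2 * r\<^sup>2) * ennreal (?v w powr (- 4))"
          by (subst (1 2) ennreal_mult[symmetric]) (simp_all add: mult_ac)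
        finally show ?thesis by (simp add: add_increasing)
      qed
    qed
    also have "\<dots> = ennreal (r\<^sup>2 * (16 / s ^ 4)) * (\<integral>\<^sup>+w. tail_kernel (cmod (w - t)) \<partial>dA) +
        ennreal (40 / s\<^sup>2 * r\<^sup>2) * (\<integral>\<^sup>+w. ennreal (?v w powr (- 4)) \<partial>dA)"
      by (subst nn_integral_add) (auto simp: nn_integral_cmult)
    also have "\<dots> \<le> ennreal (r\<^sup>2 * (16 / s ^ 4)) * ennreal C1 + ennreal (40 / s\<^sup>2 * r\<^sup>2) * ennreal (C2 * r powr (2 - 4))"
      using C2b[OF z] by (intro add_mono mult_left_mono C1b) (auto simp: r_def)
    also have "\<dots> = ennreal (r\<^sup>2 * (16 / s ^ 4) * C1 + 40 / s\<^sup>2 * r\<^sup>2 * (C2 * r powr (2 - 4)))"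
    proof -
      have "0 \<le> r\<^sup>2 * (16 / s ^ 4)" "0 \<le> 40 / s\<^sup>2 * r\<^sup>2" "0 \<le> C2 * r powr (2 - 4)" "0 \<le> C1"
        using s C1 C2 by auto
      then show ?thesis by (simp only: ennreal_mult ennreal_plus mult_nonneg_nonneg)
    qed
    also have "\<dots> \<le> ennreal ((16 * C1 + 40 * C2) * s powr (- 2))"
    proof (rule ennreal_leI)
      have "r\<^sup>2 * (16 / s ^ 4) * C1 \<le> s\<^sup>2 * (16 / s ^ 4) * C1"
        using r rs C1 by (intro mult_right_mono power_mono) auto
      also have "\<dots> = 16 * C1 / s\<^sup>2" using s by (simp add: field_simps power2_eq_square power4_eq_xxxx)
      finally have a: "r\<^sup>2 * (16 / s ^ 4) * C1 \<le> 16 * C1 / s\<^sup>2" .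
      have b: "40 / s\<^sup>2 * r\<^sup>2 * (C2 * r powr (2 - 4)) = 40 * C2 / s\<^sup>2"
        using r by (simp add: powr_minus_divide)
      have c: "s powr (- 2) = 1 / s\<^sup>2" using s by (simp add: powr_minus_divide)
      have d: "(16 * C1 + 40 * C2) * (1 / s\<^sup>2) = 16 * C1 / s\<^sup>2 + 40 * C2 / s\<^sup>2"
        by (simp add: add_divide_distrib)
      show "r\<^sup>2 * (16 / s ^ 4) * C1 + 40 / s\<^sup>2 * r\<^sup>2 * (C2 * r powr (2 - 4)) \<le> (16 * C1 + 40 * C2) * s powr (- 2)"
        unfolding b c d by (rule add_right_mono[OF a])
    qed
    finally show ?thesis by (simp add: s_def r_def)
  qed
  moreover have "16 * C1 + 40 * C2 > 0" using C1 C2 by simp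
  ultimately show ?thesis by blast
qed

section \<open>The counterexample\<close>

text \<open>The potential of order 3/4 grows by a factor sqrt 2 per level; its sixth power therefore
  grows by 8, matching \<delta>^(-3/2).\<close>

lemma four_powr_three_quarters_div_2_power_6: "(4 powr (3/4) / 2) ^ 6 = (8::real)"
proof -
  have "(4 powr (3/4)) ^ 6 = (4::real) powr (3/4 * 6)"
    by (simp add: powr_powr powr_realpow[symmetric])
  also have "\<dots> = (4 powr (1/2)) powr 9" by (simp add: powr_powr)
  also have "\<dots> = 2 powr 9" by (simp add: powr_half_sqrt)
  also have "\<dots> = 512" by simp
  finally show ?thesis by (simp add: power_divide)
qed

lemma cos_sector_pos: "0 < \<sigma> \<Longrightarrow> \<sigma> < 1 \<Longrightarrow> cos (\<sigma> * pi / 2) > 0"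
  by (rule cos_gt_zero) (auto simp: field_simps)

lemma cantor_rpot_pos:
  assumes "cmod z < 1" "\<sigma> > 0" shows "cantor_rpot \<sigma> z > 0"
proof -
  have "0 < (\<Sum>m\<le>cantor_level z. (4 powr \<sigma> / 2 :: real) ^ m)" by (intro sum_pos) auto
  also note cantor_rpot_ge[OF assms]
  finally have "0 < 4 powr \<sigma> / (4 powr \<sigma> - 1) * 3 powr \<sigma> * cantor_rpot \<sigma> z" .
  moreover have "0 < 4 powr \<sigma> / (4 powr \<sigma> - 1) * (3::real) powr \<sigma>" using assms by simp
  ultimately show ?thesis by (rule zero_less_mult_pos)
qed

lemma Re_cantor_pot_pos:
  assumes "cmod z < 1" "0 < \<sigma>" "\<sigma> < 1" shows "Re (cantor_pot \<sigma> z) > 0"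
  using Re_cantor_pot_ge[OF assms] cantor_rpot_pos[OF assms(1,2)] cos_sector_pos[OF assms(2,3)]
  by (meson less_le_trans mult_pos_pos)

lemma norm_cantor_pot_ge:
  assumes "cmod z < 1" "0 < \<sigma>" "\<sigma> < 1"
  shows "cos (\<sigma> * pi / 2) * cantor_rpot \<sigma> z \<le> cmod (cantor_pot \<sigma> z)"
  using Re_cantor_pot_ge[OF assms] complex_Re_le_cmod order_trans by blast

lemma cantor_pot_three_quarter_bounds:
  "\<exists>A>0. \<forall>z. cmod z < 1 \<longrightarrow> cmod (cantor_pot (3/4) z) ^ 6 \<le> A * 8 ^ cantor_level z \<and>
     8 ^ cantor_level z \<le> A * cmod (cantor_pot (3/4) z) ^ 6"
proof -
  let ?q = "4 powr (3/4) / 2 :: real"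
  obtain C where C: "C > 0" "\<And>z. cmod z < 1 \<Longrightarrow> cantor_rpot (3/4) z \<le> C * ?q ^ cantor_level z"
    using cantor_rpot_upper[of "3/4"] by auto
  obtain D where D: "D > 0" "\<And>z. cmod z < 1 \<Longrightarrow> ?q ^ cantor_level z \<le> D * cantor_rpot (3/4) z"
    using cantor_rpot_lower[of "3/4"] by auto
  let ?c = "cos (3/4 * pi / 2)"
  have c: "?c > 0" by (rule cos_sector_pos) auto
  have q6: "(?q ^ n) ^ 6 = 8 ^ n" for n
    by (simp only: power_mult[symmetric] mult.commute[of n]) (simp only: power_mult four_powr_three_quarters_div_2_power_6)
  have "cmod (cantor_pot (3/4) z) ^ 6 \<le> (C ^ 6 + (D / ?c) ^ 6) * 8 ^ cantor_level z \<and>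
     8 ^ cantor_level z \<le> (C ^ 6 + (D / ?c) ^ 6) * cmod (cantor_pot (3/4) z) ^ 6" if z: "cmod z < 1" for z
  proof
    have "cmod (cantor_pot (3/4) z) \<le> C * ?q ^ cantor_level z"
      using norm_cantor_pot_le[OF z, of "3/4"] C(2)[OF z] by simp
    then have "cmod (cantor_pot (3/4) z) ^ 6 \<le> (C * ?q ^ cantor_level z) ^ 6" by (rule power_mono) simp
    also have "\<dots> = C ^ 6 * 8 ^ cantor_level z" by (simp only: power_mult_distrib q6)
    also have "\<dots> \<le> (C ^ 6 + (D / ?c) ^ 6) * 8 ^ cantor_level z" by (intro mult_right_mono) auto
    finally show "cmod (cantor_pot (3/4) z) ^ 6 \<le> (C ^ 6 + (D / ?c) ^ 6) * 8 ^ cantor_level z" .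
    have "?q ^ cantor_level z \<le> D / ?c * (?c * cantor_rpot (3/4) z)" using D(2)[OF z] c by simp
    also have "\<dots> \<le> D / ?c * cmod (cantor_pot (3/4) z)"
      using norm_cantor_pot_ge[OF z, of "3/4"] D(1) c by (intro mult_left_mono) auto
    finally have "(?q ^ cantor_level z) ^ 6 \<le> (D / ?c * cmod (cantor_pot (3/4) z)) ^ 6" by (rule power_mono) simp
    then have "8 ^ cantor_level z \<le> (D / ?c) ^ 6 * cmod (cantor_pot (3/4) z) ^ 6" by (simp only: q6 power_mult_distrib)
    also have "\<dots> \<le> (C ^ 6 + (D / ?c) ^ 6) * cmod (cantor_pot (3/4) z) ^ 6" using C(1) by (intro mult_right_mono) auto
    finally show "8 ^ cantor_level z \<le> (C ^ 6 + (D / ?c) ^ 6) * cmod (cantor_pot (3/4) z) ^ 6" .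
  qed
  moreover have "C ^ 6 + (D / ?c) ^ 6 > 0" using C(1) by (intro add_pos_nonneg) auto
  ultimately show ?thesis by blast
qed

text \<open>The modulus is controlled on both sides through the sector. The derivative is controlled
  by the real potential of order 3/2, whose rate per level is 4^(3/2) / 2 = 4, that is 1/\<delta>.
  Adding the separate constants gives one that serves all three bounds.\<close>

lemma cantor_pot_half_bounds:
  "\<exists>A>0. \<forall>z. cmod z < 1 \<longrightarrow> cmod (cantor_pot (1/2) z) \<le> A * (real (cantor_level z) + 1) \<and>
     real (cantor_level z) + 1 \<le> A * cmod (cantor_pot (1/2) z) \<and>
     cmod (deriv (cantor_pot (1/2)) z) \<le> A * 4 ^ cantor_level z"
proof -
  have 84: "4 powr (3/2) / 2 = (4::real)"
  proof -
    have "4 powr (3/2) = (4 powr (1/2)) powr (3::real)" by (simp add: powr_powr)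
    also have "\<dots> = (2::real) powr 3" by (simp add: powr_half_sqrt)
    finally show ?thesis by simp
  qed
  obtain C where C: "C > 0" "\<And>z. cmod z < 1 \<Longrightarrow> cantor_rpot (3/2) z \<le> C * 4 ^ cantor_level z"
    using cantor_rpot_upper[of "3/2"] unfolding 84 by auto
  let ?c = "cos (1/2 * pi / 2)"
  have c: "?c > 0" by (rule cos_sector_pos) auto
  have "cmod (cantor_pot (1/2) z) \<le> (16 + 4 / ?c + C) * (real (cantor_level z) + 1) \<and>
     real (cantor_level z) + 1 \<le> (16 + 4 / ?c + C) * cmod (cantor_pot (1/2) z) \<and>
     cmod (deriv (cantor_pot (1/2)) z) \<le> (16 + 4 / ?c + C) * 4 ^ cantor_level z" if z: "cmod z < 1" for z
  proof (intro conjI)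
    have "cmod (cantor_pot (1/2) z) \<le> 16 * (real (cantor_level z) + 1)"
      using norm_cantor_pot_le[OF z, of "1/2"] cantor_rpot_half(1)[OF z] by simp
    also have "\<dots> \<le> (16 + 4 / ?c + C) * (real (cantor_level z) + 1)"
      using C(1) c by (intro mult_right_mono) (auto simp: add_nonneg_nonneg)
    finally show "cmod (cantor_pot (1/2) z) \<le> (16 + 4 / ?c + C) * (real (cantor_level z) + 1)" .
    have "real (cantor_level z) + 1 \<le> 4 / ?c * (?c * cantor_rpot (1/2) z)"
      using cantor_rpot_half(2)[OF z] c by simp
    also have "\<dots> \<le> 4 / ?c * cmod (cantor_pot (1/2) z)"
      using norm_cantor_pot_ge[OF z, of "1/2"] c by (intro mult_left_mono) auto
    also have "\<dots> \<le> (16 + 4 / ?c + C) * cmod (cantor_pot (1/2) z)"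
      using C(1) by (intro mult_right_mono) auto
    finally show "real (cantor_level z) + 1 \<le> (16 + 4 / ?c + C) * cmod (cantor_pot (1/2) z)" .
    have "cmod (deriv (cantor_pot (1/2)) z) \<le> 1/2 * cantor_rpot (3/2) z"
      using norm_deriv_cantor_pot_le[OF z, of "1/2"] by simp
    also have "\<dots> \<le> cantor_rpot (3/2) z" using cantor_rpot_pos[OF z, of "3/2"] by simp
    also have "\<dots> \<le> C * 4 ^ cantor_level z" by (rule C(2)[OF z])
    also have "\<dots> \<le> (16 + 4 / ?c + C) * 4 ^ cantor_level z"
      using c by (intro mult_right_mono) (auto simp: add_nonneg_nonneg)
    finally show "cmod (deriv (cantor_pot (1/2)) z) \<le> (16 + 4 / ?c + C) * 4 ^ cantor_level z" .
  qed
  moreover have "16 + 4 / ?c + C > 0" using C(1) c by (intro add_pos_pos) auto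
  ultimately show ?thesis by blast
qed

section \<open>The two symbols, the test function and their sizes\<close>

definition sarason_f :: "complex \<Rightarrow> complex" where
  "sarason_f z = 1 / cantor_pot (3/4) z ^ 3"

text \<open>Integer powers of the order 3/4 potential require no branch. Only the order 1/2 factor
  uses the principal power, which is holomorphic because that potential stays in the right half
  plane.\<close>

definition sarason_g :: "complex \<Rightarrow> complex" where
  "sarason_g z = cantor_pot (3/4) z ^ 3 * cantor_pot (1/2) z powr (- of_real (3/4))"

definition test_prim :: "complex \<Rightarrow> complex" where
  "test_prim z = cantor_pot (1/2) z powr of_real (1/4)"

definition test_fun :: "complex \<Rightarrow> complex" where
  "test_fun z = (2 * test_prim z + z * deriv test_prim z) * of_real (1 - (cmod z)\<^sup>2)"

lemma cantor_pot_not_nonpos: "cmod z < 1 \<Longrightarrow> 0 < \<sigma> \<Longrightarrow> \<sigma> < 1 \<Longrightarrow> cantor_pot \<sigma> z \<notin> \<real>\<^sub>\<le>\<^sub>0"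
  using Re_cantor_pot_pos[of z \<sigma>] by (auto simp: complex_nonpos_Reals_iff)

lemma cantor_pot_nonzero: "cmod z < 1 \<Longrightarrow> 0 < \<sigma> \<Longrightarrow> \<sigma> < 1 \<Longrightarrow> cantor_pot \<sigma> z \<noteq> 0"
  using Re_cantor_pot_pos[of z \<sigma>] by auto

lemma holomorphic_sarason_f: "sarason_f holomorphic_on ball 0 1"
  unfolding sarason_f_def[abs_def]
  by (intro holomorphic_intros holomorphic_cantor_pot) (auto simp: cantor_pot_nonzero)

lemma holomorphic_sarason_g: "sarason_g holomorphic_on ball 0 1"
  unfolding sarason_g_def[abs_def]
  by (intro holomorphic_intros holomorphic_on_powr_right holomorphic_cantor_pot) (auto simp: cantor_pot_not_nonpos)

lemma test_prim_derivative:
  assumes "cmod z < 1"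
  shows "(test_prim has_field_derivative
    (of_real (1/4) * cantor_pot (1/2) z powr (of_real (1/4) - 1) * deriv (cantor_pot (1/2)) z)) (at z)"
proof -
  have d: "(cantor_pot (1/2) has_field_derivative deriv (cantor_pot (1/2)) z) (at z)"
    using assms holomorphic_cantor_pot[of "1/2"] by (auto intro!: holomorphic_derivI[of _ "ball 0 1"])
  have "((\<lambda>v. v powr of_real (1/4)) has_field_derivative
      (of_real (1/4) * cantor_pot (1/2) z powr (of_real (1/4) - 1))) (at (cantor_pot (1/2) z))"
    using assms by (intro has_field_derivative_powr cantor_pot_not_nonpos) auto
  from DERIV_chain2[OF this d] show ?thesis unfolding test_prim_def[abs_def] .
qed

lemma holomorphic_test_prim: "test_prim holomorphic_on ball 0 1"
proof (rule holomorphic_onI)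
  fix z :: complex assume "z \<in> ball 0 1"
  then have "cmod z < 1" by simp
  from test_prim_derivative[OF this] show "test_prim field_differentiable at z within ball 0 1"
    unfolding field_differentiable_def by (blast intro: has_field_derivative_at_within)
qed

lemma norm_sarason_f: "(cmod (sarason_f z))\<^sup>2 = 1 / cmod (cantor_pot (3/4) z) ^ 6"
  by (simp add: sarason_f_def norm_divide norm_power power_divide flip: power_mult)

lemma sarason_f_bound:
  "\<exists>A>0. \<forall>z. cmod z < 1 \<longrightarrow> (cmod (sarason_f z))\<^sup>2 \<le> A / 8 ^ cantor_level z"
proof -
  obtain A where A: "A > 0" "\<And>z. cmod z < 1 \<Longrightarrow> 8 ^ cantor_level z \<le> A * cmod (cantor_pot (3/4) z) ^ 6"
    using cantor_pot_three_quarter_bounds by blast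
  have "(cmod (sarason_f z))\<^sup>2 \<le> A / 8 ^ cantor_level z" if z: "cmod z < 1" for z
  proof -
    have "cmod (cantor_pot (3/4) z) ^ 6 > 0" using cantor_pot_nonzero[OF z, of "3/4"] by simp
    then show ?thesis unfolding norm_sarason_f using A(2)[OF z] by (simp add: divide_le_eq le_divide_eq mult_ac)
  qed
  then show ?thesis using A(1) by blast
qed

lemma sarason_g_bound:
  "\<exists>A>0. \<forall>z. cmod z < 1 \<longrightarrow> (cmod (sarason_g z))\<^sup>2 \<le> A * (8 ^ cantor_level z * (real (cantor_level z) + 1) powr (- 3 / 2))"
proof -
  obtain A where A: "A > 0" "\<And>z. cmod z < 1 \<Longrightarrow> cmod (cantor_pot (3/4) z) ^ 6 \<le> A * 8 ^ cantor_level z"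
    using cantor_pot_three_quarter_bounds by blast
  obtain B where B: "B > 0" "\<And>z. cmod z < 1 \<Longrightarrow> real (cantor_level z) + 1 \<le> B * cmod (cantor_pot (1/2) z)"
    using cantor_pot_half_bounds by blast
  have "(cmod (sarason_g z))\<^sup>2 \<le> A * B powr (3/2) * (8 ^ cantor_level z * (real (cantor_level z) + 1) powr (- 3 / 2))"
    if z: "cmod z < 1" for z
  proof -
    let ?p = "cmod (cantor_pot (1/2) z)"
    have p: "?p > 0" using cantor_pot_nonzero[OF z, of "1/2"] by simp
    have "(cmod (sarason_g z))\<^sup>2 = cmod (cantor_pot (3/4) z) ^ 6 * (?p powr (- 3/4))\<^sup>2"
      unfolding sarason_g_def norm_mult norm_power power_mult_distrib
      by (subst norm_powr_real_powr') (auto simp flip: power_mult)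
    also have "(?p powr (- 3/4))\<^sup>2 = ?p powr (- 3/2)"
      by (simp add: power2_eq_square flip: powr_add)
    also have "?p powr (- 3/2) \<le> ((real (cantor_level z) + 1) / B) powr (- 3/2)"
      using B(1) B(2)[OF z] p by (intro powr_mono2') (auto simp: divide_le_eq mult.commute)
    also have "\<dots> = B powr (3/2) * (real (cantor_level z) + 1) powr (- 3/2)"
      using B(1) by (simp add: powr_divide powr_minus_divide field_simps)
    finally have "(cmod (sarason_g z))\<^sup>2 \<le> cmod (cantor_pot (3/4) z) ^ 6 * (B powr (3/2) * (real (cantor_level z) + 1) powr (- 3/2))"
      by (simp add: mult_left_mono)
    also have "\<dots> \<le> A * 8 ^ cantor_level z * (B powr (3/2) * (real (cantor_level z) + 1) powr (- 3/2))"
      using A(2)[OF z] by (intro mult_right_mono) auto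
    finally show ?thesis by (simp add: mult_ac)
  qed
  moreover have "A * B powr (3/2) > 0" using A(1) B(1) by simp
  ultimately show ?thesis by blast
qed

text \<open>The derivative term is the main one: G' is of order at most 4^N (N+1)^(-3/4), and the
  factor 1 - |z|^2 \<le> 4 / 4^N cancels the 4^N. The term 2 G is much smaller, since n = N + 1
  \<le> 4^N lets n^(1/4) be bounded by 4^N * n^(-3/4).\<close>

lemma test_fun_bound:
  "\<exists>A>0. \<forall>z. cmod z < 1 \<longrightarrow> cmod (test_fun z) \<le> A * (real (cantor_level z) + 1) powr (- 3 / 4)"
proof -
  obtain B where B: "B > 0" "\<And>z. cmod z < 1 \<Longrightarrow> cmod (cantor_pot (1/2) z) \<le> B * (real (cantor_level z) + 1)"
    "\<And>z. cmod z < 1 \<Longrightarrow> real (cantor_level z) + 1 \<le> B * cmod (cantor_pot (1/2) z)"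
    "\<And>z. cmod z < 1 \<Longrightarrow> cmod (deriv (cantor_pot (1/2)) z) \<le> B * 4 ^ cantor_level z"
    using cantor_pot_half_bounds by blast
  have "cmod (test_fun z) \<le> (8 * B powr (1/4) + B * B powr (3/4)) * (real (cantor_level z) + 1) powr (- 3 / 4)"
    if z: "cmod z < 1" for z
  proof -
    let ?N = "cantor_level z" and ?p = "cmod (cantor_pot (1/2) z)"
    define n where "n = real ?N + 1"
    have n: "n \<ge> 1" by (simp add: n_def)
    have p: "?p > 0" using cantor_pot_nonzero[OF z, of "1/2"] by simp
    have n4: "n \<le> 4 ^ ?N"
    proof -
      have "real (Suc k) \<le> 4 ^ k" for k by (induction k) auto
      from this[of ?N] show ?thesis by (simp add: n_def add.commute)
    qed
    have "1 - (cmod z)\<^sup>2 = (1 - cmod z) * (1 + cmod z)" by (simp add: power2_eq_square algebra_simps)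
    also have "\<dots> \<le> (2 / 4 ^ ?N) * 2"
      using z one_minus_norm_le_level[OF z] by (intro mult_mono) auto
    finally have r: "1 - (cmod z)\<^sup>2 \<le> 4 / 4 ^ ?N" by simp
    have r0: "0 \<le> 1 - (cmod z)\<^sup>2" using z by (simp add: abs_square_le_1)
    have "cmod (test_prim z) = ?p powr (1/4)"
      unfolding test_prim_def by (subst norm_powr_real_powr') auto
    also have "\<dots> \<le> (B * n) powr (1/4)" using B(2)[OF z] by (intro powr_mono2) (auto simp: n_def)
    also have "\<dots> = B powr (1/4) * (n * n powr (- 3/4))"
      using B(1) n by (simp add: powr_mult powr_mult_base)
    also have "\<dots> \<le> B powr (1/4) * (4 ^ ?N * n powr (- 3/4))"
      using n4 by (intro mult_left_mono mult_right_mono) auto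
    finally have G: "cmod (test_prim z) \<le> B powr (1/4) * (4 ^ ?N * n powr (- 3/4))" .
    have "deriv test_prim z = of_real (1/4) * cantor_pot (1/2) z powr (of_real (- 3/4)) * deriv (cantor_pot (1/2)) z"
      using DERIV_imp_deriv[OF test_prim_derivative[OF z]] by simp
    then have "cmod (deriv test_prim z) = 1/4 * ?p powr (- 3/4) * cmod (deriv (cantor_pot (1/2)) z)"
      by (simp only: norm_mult norm_powr_real_powr' Reals_of_real Re_complex_of_real) simp
    also have "\<dots> \<le> 1/4 * (n / B) powr (- 3/4) * (B * 4 ^ ?N)"
      using B(1) B(3,4)[OF z] p n
      by (intro mult_mono powr_mono2') (auto simp: n_def divide_le_eq mult.commute)
    also have "(n / B) powr (- 3/4) = B powr (3/4) * n powr (- 3/4)"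
      using B(1) n by (simp add: powr_divide powr_minus_divide field_simps)
    finally have G': "cmod (deriv test_prim z) \<le> 1/4 * (B powr (3/4) * n powr (- 3/4)) * (B * 4 ^ ?N)" .
    have "cmod (test_fun z) = cmod (2 * test_prim z + z * deriv test_prim z) * (1 - (cmod z)\<^sup>2)"
      unfolding test_fun_def norm_mult norm_of_real using r0 by simp
    also have "\<dots> \<le> (2 * cmod (test_prim z) + cmod (deriv test_prim z)) * (4 / 4 ^ ?N)"
    proof (rule mult_mono[OF _ r])
      have "cmod (2 * test_prim z + z * deriv test_prim z) \<le> cmod (2 * test_prim z) + cmod (z * deriv test_prim z)"
        by (rule norm_triangle_ineq)
      also have "\<dots> \<le> 2 * cmod (test_prim z) + cmod (deriv test_prim z)"
        using z by (simp add: norm_mult mult_left_le_one_le)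
      finally show "cmod (2 * test_prim z + z * deriv test_prim z) \<le> 2 * cmod (test_prim z) + cmod (deriv test_prim z)" .
    qed (use r0 in auto)
    also have "\<dots> \<le> (2 * (B powr (1/4) * (4 ^ ?N * n powr (- 3/4))) + 1/4 * (B powr (3/4) * n powr (- 3/4)) * (B * 4 ^ ?N)) * (4 / 4 ^ ?N)"
      using G G' by (intro mult_right_mono add_mono mult_left_mono) auto
    also have "\<dots> = (8 * B powr (1/4) + B * B powr (3/4)) * n powr (- 3/4)"
      by (simp add: algebra_simps)
    finally show ?thesis by (simp add: n_def)
  qed
  moreover have "8 * B powr (1/4) + B * B powr (3/4) > 0" using B(1) by (intro add_pos_pos) auto
  ultimately show ?thesis by blast
qed

lemma norm_sarason_g_test_prim_ge:
  "\<exists>c>0. \<forall>z. cmod z < 1 \<longrightarrow> c * (8 ^ cantor_level z / (real (cantor_level z) + 1)) \<le> (cmod (sarason_g z * test_prim z))\<^sup>2"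
proof -
  obtain A where A: "A > 0" "\<And>z. cmod z < 1 \<Longrightarrow> 8 ^ cantor_level z \<le> A * cmod (cantor_pot (3/4) z) ^ 6"
    using cantor_pot_three_quarter_bounds by blast
  obtain B where B: "B > 0" "\<And>z. cmod z < 1 \<Longrightarrow> cmod (cantor_pot (1/2) z) \<le> B * (real (cantor_level z) + 1)"
    using cantor_pot_half_bounds by blast
  have "1 / (A * B) * (8 ^ cantor_level z / (real (cantor_level z) + 1)) \<le> (cmod (sarason_g z * test_prim z))\<^sup>2"
    if z: "cmod z < 1" for z
  proof -
    let ?p = "cmod (cantor_pot (1/2) z)"
    have p: "?p > 0" using cantor_pot_nonzero[OF z, of "1/2"] by simp
    have "cmod (sarason_g z * test_prim z) = cmod (cantor_pot (3/4) z) ^ 3 * (?p powr (- 3/4) * ?p powr (1/4))"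
      unfolding sarason_g_def test_prim_def norm_mult norm_power
      by (subst (1 2) norm_powr_real_powr') auto
    also have "?p powr (- 3/4) * ?p powr (1/4) = ?p powr (- 1/2)" by (simp flip: powr_add)
    finally have "(cmod (sarason_g z * test_prim z))\<^sup>2 = cmod (cantor_pot (3/4) z) ^ 6 * (?p powr (- 1/2))\<^sup>2"
      by (simp add: power_mult_distrib flip: power_mult)
    also have "(?p powr (- 1/2))\<^sup>2 = 1 / ?p"
      using p by (simp add: power2_eq_square powr_minus_divide flip: powr_add)
    finally have e: "(cmod (sarason_g z * test_prim z))\<^sup>2 = cmod (cantor_pot (3/4) z) ^ 6 * (1 / ?p)" .
    have "8 ^ cantor_level z / A * (1 / (B * (real (cantor_level z) + 1))) \<le> cmod (cantor_pot (3/4) z) ^ 6 * (1 / ?p)"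
      using A(1) A(2)[OF z] B(1) B(2)[OF z] p
      by (intro mult_mono divide_left_mono) (auto simp: divide_le_eq mult.commute)
    then show ?thesis by (simp add: e)
  qed
  moreover have "1 / (A * B) > 0" using A(1) B(1) by simp
  ultimately show ?thesis by blast
qed

text \<open>Dominate the weight by the potential of \<open>tail_kernel\<close> and exchange the
  integrals: each point t contributes at most the same constant and \<mu> has mass 1. This serves
  both |g|^2 and |\<phi> / f|^2.\<close>

lemma integrable_level_bound:
  fixes h :: "complex \<Rightarrow> real"
  assumes h: "h \<in> borel_measurable dA" and h0: "\<And>z. h z \<ge> 0" and A: "A > 0"
    and b: "\<And>z. cmod z < 1 \<Longrightarrow> h z \<le> A * (8 ^ cantor_level z * (real (cantor_level z) + 1) powr (- 3 / 2))"
  shows "integrable dA h"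
proof -
  obtain C where C: "C > 0" "\<And>t. (\<integral>\<^sup>+z. tail_kernel (cmod (z - t)) \<partial>dA) \<le> ennreal C"
    using nn_integral_tail_kernel_le by blast
  interpret P: pair_sigma_finite dA unit_leb ..
  have "(\<integral>\<^sup>+z. ennreal (h z) \<partial>dA) \<le> (\<integral>\<^sup>+z. ennreal A * (\<integral>\<^sup>+x. tail_kernel (cmod (z - cantor_point x)) \<partial>unit_leb) \<partial>dA)"
  proof (rule nn_integral_mono)
    fix z assume "z \<in> space dA"
    then have z: "cmod z < 1" by simp
    have "ennreal (h z) \<le> ennreal A * ennreal (8 ^ cantor_level z * (real (cantor_level z) + 1) powr (- 3 / 2))"
      using b[OF z] A by (subst ennreal_mult[symmetric]) (auto intro!: ennreal_leI)
    also have "\<dots> \<le> ennreal A * (\<integral>\<^sup>+x. tail_kernel (cmod (z - cantor_point x)) \<partial>unit_leb)"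
      by (intro mult_left_mono level_le_tail_kernel z) auto
    finally show "ennreal (h z) \<le> ennreal A * (\<integral>\<^sup>+x. tail_kernel (cmod (z - cantor_point x)) \<partial>unit_leb)" .
  qed
  also have "\<dots> = ennreal A * (\<integral>\<^sup>+z. (\<integral>\<^sup>+x. tail_kernel (cmod (z - cantor_point x)) \<partial>unit_leb) \<partial>dA)"
    by (intro nn_integral_cmult) measurable
  also have "(\<integral>\<^sup>+z. (\<integral>\<^sup>+x. tail_kernel (cmod (z - cantor_point x)) \<partial>unit_leb) \<partial>dA)
     = (\<integral>\<^sup>+x. (\<integral>\<^sup>+z. tail_kernel (cmod (z - cantor_point x)) \<partial>dA) \<partial>unit_leb)"
    by (rule P.Fubini'[symmetric]) measurable
  also have "\<dots> \<le> (\<integral>\<^sup>+x. ennreal C \<partial>unit_leb)" by (intro nn_integral_mono C(2))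
  also have "\<dots> = ennreal C" by (simp add: emeasure_unit_leb)
  finally have "(\<integral>\<^sup>+z. ennreal (h z) \<partial>dA) \<le> ennreal A * ennreal C" by (simp add: mult_left_mono)
  also have "\<dots> < \<infinity>" by (simp add: ennreal_mult_less_top)
  finally show ?thesis using h h0 by (intro integrableI_bounded) auto
qed

lemma sarason_f_A2D: "sarason_f \<in> A2D"
proof -
  obtain A where A: "A > 0" "\<And>z. cmod z < 1 \<Longrightarrow> (cmod (sarason_f z))\<^sup>2 \<le> A / 8 ^ cantor_level z"
    using sarason_f_bound by blast
  have m: "sarason_f \<in> borel_measurable dA"
    by (intro borel_measurable_dA_continuous_on holomorphic_on_imp_continuous_on holomorphic_sarason_f)
  have "cmod (sarason_f z) \<le> sqrt A" if z: "cmod z < 1" for z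
  proof (rule real_le_rsqrt)
    have "A / 8 ^ cantor_level z \<le> A / 1" using A(1) by (intro divide_left_mono) auto
    then show "(cmod (sarason_f z))\<^sup>2 \<le> A" using A(2)[OF z] by simp
  qed
  then show ?thesis using L2D_bounded[OF m] holomorphic_sarason_f by (auto simp: A2D_def)
qed

lemma sarason_g_A2D: "sarason_g \<in> A2D"
proof -
  obtain A where A: "A > 0" "\<And>z. cmod z < 1 \<Longrightarrow>
     (cmod (sarason_g z))\<^sup>2 \<le> A * (8 ^ cantor_level z * (real (cantor_level z) + 1) powr (- 3 / 2))"
    using sarason_g_bound by blast
  have m[measurable]: "sarason_g \<in> borel_measurable dA"
    by (intro borel_measurable_dA_continuous_on holomorphic_on_imp_continuous_on holomorphic_sarason_g)
  have "integrable dA (\<lambda>z. (cmod (sarason_g z))\<^sup>2)"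
    by (rule integrable_level_bound[OF _ _ A]) auto
  then show ?thesis using m holomorphic_sarason_g by (simp add: A2D_def L2D_def)
qed

lemma measurable_test_fun: "test_fun \<in> borel_measurable dA"
  unfolding test_fun_def[abs_def]
  by (intro borel_measurable_dA_continuous_on continuous_intros holomorphic_on_imp_continuous_on
      holomorphic_test_prim holomorphic_deriv[OF holomorphic_test_prim]) auto

lemma integrable_test_fun: "integrable dA test_fun"
proof -
  obtain A where A: "A > 0" "\<And>z. cmod z < 1 \<Longrightarrow> cmod (test_fun z) \<le> A * (real (cantor_level z) + 1) powr (- 3 / 4)"
    using test_fun_bound by blast
  show ?thesis
  proof (rule dA.integrable_const_bound[OF _ measurable_test_fun])
    have "cmod (test_fun z) \<le> A" if "cmod z < 1" for z
    proof -
      have "(real (cantor_level z) + 1) powr (- 3 / 4) \<le> (real (cantor_level z) + 1) powr 0" by (intro powr_mono) auto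
      then have "A * (real (cantor_level z) + 1) powr (- 3 / 4) \<le> A * 1" using A(1) by (intro mult_left_mono) auto
      then show ?thesis using A(2)[OF that] by linarith
    qed
    then show "AE z in dA. cmod (test_fun z) \<le> A" by (intro AE_I2) simp
  qed
qed

lemma integrable_test_fun_div_f: "integrable dA (\<lambda>z. (cmod (test_fun z) / cmod (sarason_f z))\<^sup>2)"
proof -
  obtain A where A: "A > 0" "\<And>z. cmod z < 1 \<Longrightarrow> cmod (test_fun z) \<le> A * (real (cantor_level z) + 1) powr (- 3 / 4)"
    using test_fun_bound by blast
  obtain B where B: "B > 0" "\<And>z. cmod z < 1 \<Longrightarrow> cmod (cantor_pot (3/4) z) ^ 6 \<le> B * 8 ^ cantor_level z"
    using cantor_pot_three_quarter_bounds by blast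
  have [measurable]: "sarason_f \<in> borel_measurable dA" by (rule A2D_measurable[OF sarason_f_A2D])
  note measurable_test_fun[measurable]
  show ?thesis
  proof (rule integrable_level_bound[of _ "A\<^sup>2 * B"])
    fix z :: complex assume z: "cmod z < 1"
    let ?n = "real (cantor_level z) + 1"
    have "(cmod (test_fun z) / cmod (sarason_f z))\<^sup>2 = (cmod (test_fun z))\<^sup>2 * cmod (cantor_pot (3/4) z) ^ 6"
      by (simp add: power_divide norm_sarason_f)
    also have "\<dots> \<le> (A * ?n powr (- 3/4))\<^sup>2 * (B * 8 ^ cantor_level z)"
      using A(2)[OF z] B(2)[OF z] by (intro mult_mono power_mono) auto
    also have "(A * ?n powr (- 3/4))\<^sup>2 = A\<^sup>2 * ?n powr (- 3/2)"
      by (simp add: power_mult_distrib power2_eq_square flip: powr_add)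
    finally show "(cmod (test_fun z) / cmod (sarason_f z))\<^sup>2 \<le> A\<^sup>2 * B * (8 ^ cantor_level z * ?n powr (- 3 / 2))"
      by (simp add: mult_ac)
  qed (use A(1) B(1) in auto)
qed

lemma bergman_proj_test_fun: "cmod z < 1 \<Longrightarrow> bergman_proj test_fun z = test_prim z"
  using bergman_proj_primitive[OF holomorphic_test_prim, of z] integrable_test_fun
  unfolding test_fun_def[abs_def] by blast

section \<open>The Berezin transforms\<close>

lemma berezin_le:
  assumes m: "h \<in> borel_measurable dA" and h0: "\<And>w. h w \<ge> 0" and z: "cmod z < 1" and B: "B \<ge> 0"
    and le: "(\<integral>\<^sup>+w. ennreal (h w) * ennreal ((1 - cmod z)\<^sup>2 * cmod (1 - cnj w * z) powr (- 4)) \<partial>dA) \<le> ennreal B"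
  shows "berezin h z \<le> 4 * B"
proof -
  note m[measurable]
  have "(\<integral>\<^sup>+w. ennreal (h w * (1 - (cmod z)\<^sup>2)\<^sup>2 / cmod (1 - cnj w * z) ^ 4) \<partial>dA)
      \<le> (\<integral>\<^sup>+w. ennreal 4 * (ennreal (h w) * ennreal ((1 - cmod z)\<^sup>2 * cmod (1 - cnj w * z) powr (- 4))) \<partial>dA)"
  proof (rule nn_integral_mono)
    fix w assume "w \<in> space dA"
    then have "1 - cnj w * z \<noteq> 0" using z by (intro one_minus_cnj_mult_nonzero) auto
    then have p: "cmod (1 - cnj w * z) powr (- 4) = 1 / cmod (1 - cnj w * z) ^ 4"
      by (simp add: powr_minus_divide)
    have "(1 - (cmod z)\<^sup>2)\<^sup>2 = (1 - cmod z)\<^sup>2 * (1 + cmod z)\<^sup>2"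
      by (simp add: power2_eq_square algebra_simps)
    also have "\<dots> \<le> (1 - cmod z)\<^sup>2 * 2\<^sup>2" using z by (intro mult_left_mono power_mono) auto
    finally have "h w * (1 - (cmod z)\<^sup>2)\<^sup>2 / cmod (1 - cnj w * z) ^ 4 \<le> h w * ((1 - cmod z)\<^sup>2 * 2\<^sup>2) / cmod (1 - cnj w * z) ^ 4"
      using h0 by (intro divide_right_mono mult_left_mono) auto
    also have "\<dots> = 4 * (h w * ((1 - cmod z)\<^sup>2 * cmod (1 - cnj w * z) powr (- 4)))" by (simp add: p)
    finally have "ennreal (h w * (1 - (cmod z)\<^sup>2)\<^sup>2 / cmod (1 - cnj w * z) ^ 4) \<le> ennreal (4 * (h w * ((1 - cmod z)\<^sup>2 * cmod (1 - cnj w * z) powr (- 4))))"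
      by (rule ennreal_leI)
    also have "\<dots> = ennreal 4 * (ennreal (h w) * ennreal ((1 - cmod z)\<^sup>2 * cmod (1 - cnj w * z) powr (- 4)))"
      using h0 by (simp only: ennreal_mult mult_nonneg_nonneg zero_le_numeral zero_le_power2 powr_ge_zero)
    finally show "ennreal (h w * (1 - (cmod z)\<^sup>2)\<^sup>2 / cmod (1 - cnj w * z) ^ 4) \<le> ennreal 4 * (ennreal (h w) * ennreal ((1 - cmod z)\<^sup>2 * cmod (1 - cnj w * z) powr (- 4)))" .
  qed
  also have "\<dots> = ennreal 4 * (\<integral>\<^sup>+w. ennreal (h w) * ennreal ((1 - cmod z)\<^sup>2 * cmod (1 - cnj w * z) powr (- 4)) \<partial>dA)"
    by (intro nn_integral_cmult) measurable
  also have "\<dots> \<le> ennreal 4 * ennreal B" by (intro mult_left_mono le) auto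
  also have "\<dots> = ennreal (4 * B)" using B by (simp add: ennreal_mult)
  finally have "(\<integral>\<^sup>+w. ennreal (h w * (1 - (cmod z)\<^sup>2)\<^sup>2 / cmod (1 - cnj w * z) ^ 4) \<partial>dA) \<le> ennreal (4 * B)" .
  \<comment> \<open>For a nonnegative measurable integrand this identity needs no integrability; the
    bound on the nonnegative integral then rules out an infinite value.\<close>
  moreover have "berezin h z = enn2real (\<integral>\<^sup>+w. ennreal (h w * (1 - (cmod z)\<^sup>2)\<^sup>2 / cmod (1 - cnj w * z) ^ 4) \<partial>dA)"
    unfolding berezin_def using h0 by (intro integral_eq_nn_integral) (auto intro!: AE_I2)
  ultimately show ?thesis using B by (simp add: enn2real_leI)
qed

text \<open>Distance to the Cantor set grows at most like |1 - cnj w z| + R with R = 4^-N(z), so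
  |f(w)|^2 is bounded by the sum of the powers 3/2 of both. The first lowers the kernel exponent
  from 4 to 5/2, still above 2, and yields r^(3/2) \<le> (2 R)^(3/2); the second is a constant
  against a weight of bounded integral.\<close>

lemma berezin_sarason_f:
  "\<exists>C>0. \<forall>z. cmod z < 1 \<longrightarrow> berezin (\<lambda>w. (cmod (sarason_f w))\<^sup>2) z \<le> C / 8 ^ cantor_level z"
proof -
  obtain A where A: "A > 0" "\<And>z. cmod z < 1 \<Longrightarrow> (cmod (sarason_f z))\<^sup>2 \<le> A / 8 ^ cantor_level z"
    using sarason_f_bound by blast
  obtain C1 where C1: "C1 > 0" "\<And>z. cmod z < 1 \<Longrightarrow>
      (\<integral>\<^sup>+w. ennreal (cmod (1 - cnj w * z) powr (- 4)) \<partial>dA) \<le> ennreal (C1 * (1 - cmod z) powr (2 - 4))"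
    using nn_integral_kernel_le[of 4] by auto
  obtain C2 where C2: "C2 > 0" "\<And>z. cmod z < 1 \<Longrightarrow>
      (\<integral>\<^sup>+w. ennreal (cmod (1 - cnj w * z) powr (- 5/2)) \<partial>dA) \<le> ennreal (C2 * (1 - cmod z) powr (2 - 5/2))"
    using nn_integral_kernel_le[of "5/2"] by auto
  have [measurable]: "sarason_f \<in> borel_measurable dA" by (rule A2D_measurable[OF sarason_f_A2D])
  have pow8: "(1 / 4 ^ n) powr (3/2) = 1 / (8::real) ^ n" for n
  proof -
    have "(1 / 4 ^ n :: real) powr (3/2) = ((1 / 4 ^ n) powr (1/2)) powr 3" by (simp add: powr_powr)
    also have "(1 / 4 ^ n :: real) powr (1/2) = 1 / 2 ^ n"
      by (simp add: powr_half_sqrt real_sqrt_divide real_sqrt_power)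
    also have "(1 / 2 ^ n :: real) powr 3 = 1 / 8 ^ n"
    proof -
      have "((2::real) ^ n) ^ 3 = (2 ^ 3) ^ n" by (simp only: power_mult[symmetric] mult.commute)
      then show ?thesis by (simp add: power_divide)
    qed
    finally show ?thesis .
  qed
  have "berezin (\<lambda>w. (cmod (sarason_f w))\<^sup>2) z \<le> 4 * (64 * A * (4 * C2 + C1)) / 8 ^ cantor_level z" if z: "cmod z < 1" for z
  proof -
    let ?v = "\<lambda>w. cmod (1 - cnj w * z)"
    define r where "r = 1 - cmod z"
    have r: "r > 0" using z by (simp add: r_def)
    define R :: real where "R = 1 / 4 ^ cantor_level z"
    have R: "R > 0" by (simp add: R_def)
    have rR: "r \<le> 2 * R" using one_minus_norm_le_level[OF z] by (simp add: r_def R_def)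
    obtain x where x: "x \<in> {0..<1}" "cmod (z - cantor_point x) \<le> 2 * R"
      using cantor_level(1)[OF z] by (auto simp: R_def)
    have fb: "(cmod (sarason_f w))\<^sup>2 \<le> 64 * A * (?v w powr (3/2) + R powr (3/2))" if w: "cmod w < 1" for w
    proof -
      let ?m = "max (?v w) R"
      have "1 / (2 * 4 ^ cantor_level w) \<le> cmod (w - cantor_point x)"
        using cantor_level(2)[OF w x(1)] by simp
      also have "\<dots> \<le> cmod (w - z) + cmod (z - cantor_point x)"
        using norm_triangle_ineq[of "w - z" "z - cantor_point x"] by simp
      also have "\<dots> \<le> ?v w + 2 * R" using norm_diff_le_one_minus_cnj[OF w z] x(2) by linarith
      \<comment> \<open>The factor 3 would do; 8 makes the constant after doubling equal to 16, and
        16^(3/2) = 64.\<close>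
      also have "\<dots> \<le> 8 * ?m" using R by linarith
      finally have "1 / 4 ^ cantor_level w \<le> 16 * ?m" by simp
      then have "(1 / 4 ^ cantor_level w) powr (3/2) \<le> (16 * ?m) powr (3/2)" by (intro powr_mono2) auto
      also have "\<dots> = 64 * ?m powr (3/2)"
      proof -
        have "(16::real) powr (3/2) = (16 powr (1/2)) powr 3" by (simp add: powr_powr)
        also have "\<dots> = 4 powr 3" by (simp add: powr_half_sqrt)
        finally show ?thesis using R by (simp add: powr_mult)
      qed
      also have "\<dots> \<le> 64 * (?v w powr (3/2) + R powr (3/2))" by (auto simp: max_def)
      finally have "1 / 8 ^ cantor_level w \<le> 64 * (?v w powr (3/2) + R powr (3/2))" by (simp only: pow8)
      then have "A * (1 / 8 ^ cantor_level w) \<le> A * (64 * (?v w powr (3/2) + R powr (3/2)))"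
        using A(1) by (intro mult_left_mono) auto
      then show ?thesis using A(2)[OF w] by (simp add: mult_ac)
    qed
    have "(\<integral>\<^sup>+w. ennreal ((cmod (sarason_f w))\<^sup>2) * ennreal (r\<^sup>2 * ?v w powr (- 4)) \<partial>dA)
       \<le> (\<integral>\<^sup>+w. ennreal (64 * A * r\<^sup>2) * ennreal (?v w powr (- 5/2)) + ennreal (64 * A * R powr (3/2) * r\<^sup>2) * ennreal (?v w powr (- 4)) \<partial>dA)"
    proof (rule nn_integral_mono)
      fix w assume "w \<in> space dA"
      then have w: "cmod w < 1" by simp
      have "(cmod (sarason_f w))\<^sup>2 * (r\<^sup>2 * ?v w powr (- 4)) \<le> 64 * A * (?v w powr (3/2) + R powr (3/2)) * (r\<^sup>2 * ?v w powr (- 4))"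
        by (intro mult_right_mono fb w) auto
      also have "\<dots> = 64 * A * r\<^sup>2 * (?v w powr (3/2) * ?v w powr (- 4)) + 64 * A * R powr (3/2) * r\<^sup>2 * ?v w powr (- 4)"
        by (simp add: algebra_simps)
      also have "?v w powr (3/2) * ?v w powr (- 4) = ?v w powr (- 5/2)" by (simp flip: powr_add)
      finally have "ennreal ((cmod (sarason_f w))\<^sup>2 * (r\<^sup>2 * ?v w powr (- 4))) \<le> ennreal (64 * A * r\<^sup>2 * ?v w powr (- 5/2) + 64 * A * R powr (3/2) * r\<^sup>2 * ?v w powr (- 4))"
        by (rule ennreal_leI)
      moreover have "0 \<le> 64 * A * r\<^sup>2" "0 \<le> 64 * A * R powr (3/2) * r\<^sup>2" using A(1) by auto
      ultimately show "ennreal ((cmod (sarason_f w))\<^sup>2) * ennreal (r\<^sup>2 * ?v w powr (- 4)) \<le>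
          ennreal (64 * A * r\<^sup>2) * ennreal (?v w powr (- 5/2)) + ennreal (64 * A * R powr (3/2) * r\<^sup>2) * ennreal (?v w powr (- 4))"
        by (simp only: ennreal_mult ennreal_plus mult_nonneg_nonneg powr_ge_zero zero_le_power2)
    qed
    also have "\<dots> = ennreal (64 * A * r\<^sup>2) * (\<integral>\<^sup>+w. ennreal (?v w powr (- 5/2)) \<partial>dA) +
        ennreal (64 * A * R powr (3/2) * r\<^sup>2) * (\<integral>\<^sup>+w. ennreal (?v w powr (- 4)) \<partial>dA)"
      by (subst nn_integral_add) (auto simp: nn_integral_cmult)
    also have "\<dots> \<le> ennreal (64 * A * r\<^sup>2) * ennreal (C2 * r powr (2 - 5/2)) + ennreal (64 * A * R powr (3/2) * r\<^sup>2) * ennreal (C1 * r powr (2 - 4))"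
      using C1(2)[OF z] C2(2)[OF z] by (intro add_mono mult_left_mono) (auto simp: r_def)
    also have "\<dots> = ennreal (64 * A * r\<^sup>2 * (C2 * r powr (2 - 5/2)) + 64 * A * R powr (3/2) * r\<^sup>2 * (C1 * r powr (2 - 4)))"
    proof -
      have "0 \<le> 64 * A * r\<^sup>2" "0 \<le> 64 * A * R powr (3/2) * r\<^sup>2" "0 \<le> C2 * r powr (2 - 5/2)" "0 \<le> C1 * r powr (2 - 4)"
        using A(1) C1(1) C2(1) by auto
      then show ?thesis by (simp only: ennreal_mult ennreal_plus mult_nonneg_nonneg)
    qed
    also have "\<dots> \<le> ennreal (64 * A * (4 * C2 + C1) / 8 ^ cantor_level z)"
    proof (rule ennreal_leI)
      have "r\<^sup>2 * r powr (2 - 5/2) = r powr 2 * r powr (2 - 5/2)" using r by simp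
      also have "\<dots> = r powr (3/2)" by (simp flip: powr_add)
      also have "\<dots> \<le> (2 * R) powr (3/2)" using r rR by (intro powr_mono2) auto
      also have "\<dots> \<le> (4 * R powr (3/2))"
      proof -
        have "(2::real) powr (3/2) \<le> 2 powr 2" by (intro powr_mono) auto
        then have "2 powr (3/2) * R powr (3/2) \<le> 4 * R powr (3/2)" by (intro mult_right_mono) auto
        then show ?thesis using R by (simp add: powr_mult)
      qed
      finally have 1: "r\<^sup>2 * r powr (2 - 5/2) \<le> 4 * R powr (3/2)" .
      have 2: "r\<^sup>2 * r powr (2 - 4) = 1" using r by (simp add: powr_minus_divide)
      have "64 * A * r\<^sup>2 * (C2 * r powr (2 - 5/2)) + 64 * A * R powr (3/2) * r\<^sup>2 * (C1 * r powr (2 - 4))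
        = 64 * A * C2 * (r\<^sup>2 * r powr (2 - 5/2)) + 64 * A * R powr (3/2) * C1 * (r\<^sup>2 * r powr (2 - 4))"
        by (simp only: mult_ac)
      also have "\<dots> \<le> 64 * A * C2 * (4 * R powr (3/2)) + 64 * A * R powr (3/2) * C1 * 1"
        unfolding 2 using A(1) C1(1) C2(1) by (intro add_mono mult_left_mono 1) auto
      also have "\<dots> = 64 * A * (4 * C2 + C1) * R powr (3/2)" by (simp add: algebra_simps)
      also have "\<dots> = 64 * A * (4 * C2 + C1) / 8 ^ cantor_level z"
        unfolding R_def pow8 by simp
      finally show "64 * A * r\<^sup>2 * (C2 * r powr (2 - 5/2)) + 64 * A * R powr (3/2) * r\<^sup>2 * (C1 * r powr (2 - 4)) \<le> 64 * A * (4 * C2 + C1) / 8 ^ cantor_level z" .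
    qed
    finally have "berezin (\<lambda>w. (cmod (sarason_f w))\<^sup>2) z \<le> 4 * (64 * A * (4 * C2 + C1) / 8 ^ cantor_level z)"
      unfolding r_def using A(1) C1(1) C2(1) z by (intro berezin_le) auto
    then show ?thesis by simp
  qed
  moreover have "4 * (64 * A * (4 * C2 + C1)) > 0" using A(1) C1(1) C2(1) by simp
  ultimately show ?thesis by blast
qed

text \<open>After the exchange of integrals each Cantor point t contributes at most a constant times
  |z - t|^(-2). What remains is the potential of order 2, with rate 4^2 / 2 = 8 per level.\<close>

lemma berezin_sarason_g:
  "\<exists>C>0. \<forall>z. cmod z < 1 \<longrightarrow> berezin (\<lambda>w. (cmod (sarason_g w))\<^sup>2) z \<le> C * 8 ^ cantor_level z"
proof -
  obtain A where A: "A > 0" "\<And>z. cmod z < 1 \<Longrightarrow>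
     (cmod (sarason_g z))\<^sup>2 \<le> A * (8 ^ cantor_level z * (real (cantor_level z) + 1) powr (- 3 / 2))"
    using sarason_g_bound by blast
  obtain C1 where C1: "C1 > 0" "\<And>z t. cmod z < 1 \<Longrightarrow> cmod t = 1 \<Longrightarrow>
    (\<integral>\<^sup>+w. tail_kernel (cmod (w - t)) * ennreal ((1 - cmod z)\<^sup>2 * cmod (1 - cnj w * z) powr (- 4)) \<partial>dA)
      \<le> ennreal (C1 * cmod (z - t) powr (- 2))"
    using nn_integral_tail_kernel_weight by blast
  have 8: "4 powr 2 / 2 = (8::real)" by simp
  obtain C2 where C2: "C2 > 0" "\<And>z. cmod z < 1 \<Longrightarrow> cantor_rpot 2 z \<le> C2 * 8 ^ cantor_level z"
    using cantor_rpot_upper[of 2] unfolding 8 by auto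
  interpret P: pair_sigma_finite dA unit_leb ..
  have [measurable]: "sarason_g \<in> borel_measurable dA" by (rule A2D_measurable[OF sarason_g_A2D])
  have "berezin (\<lambda>w. (cmod (sarason_g w))\<^sup>2) z \<le> 4 * (A * C1 * C2) * 8 ^ cantor_level z" if z: "cmod z < 1" for z
  proof -
    let ?k = "\<lambda>w. ennreal ((1 - cmod z)\<^sup>2 * cmod (1 - cnj w * z) powr (- 4))"
    have "(\<integral>\<^sup>+w. ennreal ((cmod (sarason_g w))\<^sup>2) * ?k w \<partial>dA)
      \<le> (\<integral>\<^sup>+w. ennreal A * (\<integral>\<^sup>+x. tail_kernel (cmod (w - cantor_point x)) * ?k w \<partial>unit_leb) \<partial>dA)"
    proof (rule nn_integral_mono)
      fix w assume "w \<in> space dA"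
      then have w: "cmod w < 1" by simp
      have "ennreal ((cmod (sarason_g w))\<^sup>2) \<le> ennreal A * ennreal (8 ^ cantor_level w * (real (cantor_level w) + 1) powr (- 3 / 2))"
        using A(1) A(2)[OF w] by (subst ennreal_mult[symmetric]) (auto intro!: ennreal_leI)
      also have "\<dots> \<le> ennreal A * (\<integral>\<^sup>+x. tail_kernel (cmod (w - cantor_point x)) \<partial>unit_leb)"
        by (intro mult_left_mono level_le_tail_kernel w) auto
      finally have "ennreal ((cmod (sarason_g w))\<^sup>2) * ?k w \<le> ennreal A * (\<integral>\<^sup>+x. tail_kernel (cmod (w - cantor_point x)) \<partial>unit_leb) * ?k w"
        by (intro mult_right_mono) auto
      also have "\<dots> = ennreal A * (\<integral>\<^sup>+x. tail_kernel (cmod (w - cantor_point x)) * ?k w \<partial>unit_leb)"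
        by (subst nn_integral_multc) (auto simp: mult.assoc)
      finally show "ennreal ((cmod (sarason_g w))\<^sup>2) * ?k w \<le> ennreal A * (\<integral>\<^sup>+x. tail_kernel (cmod (w - cantor_point x)) * ?k w \<partial>unit_leb)" .
    qed
    also have "\<dots> = ennreal A * (\<integral>\<^sup>+w. (\<integral>\<^sup>+x. tail_kernel (cmod (w - cantor_point x)) * ?k w \<partial>unit_leb) \<partial>dA)"
      by (intro nn_integral_cmult) measurable
    also have "(\<integral>\<^sup>+w. (\<integral>\<^sup>+x. tail_kernel (cmod (w - cantor_point x)) * ?k w \<partial>unit_leb) \<partial>dA)
       = (\<integral>\<^sup>+x. (\<integral>\<^sup>+w. tail_kernel (cmod (w - cantor_point x)) * ?k w \<partial>dA) \<partial>unit_leb)"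
      by (rule P.Fubini'[symmetric]) measurable
    also have "\<dots> \<le> (\<integral>\<^sup>+x. ennreal (C1 * cmod (z - cantor_point x) powr (- 2)) \<partial>unit_leb)"
      by (intro nn_integral_mono C1(2) z) auto
    also have "\<dots> = ennreal (LINT x|unit_leb. C1 * cmod (z - cantor_point x) powr (- 2))"
      using C1(1) integrable_cantor_rpot[OF z, of 2] by (intro nn_integral_eq_integral) auto
    also have "(LINT x|unit_leb. C1 * cmod (z - cantor_point x) powr (- 2)) = C1 * cantor_rpot 2 z"
      by (simp add: cantor_rpot_def)
    also have "ennreal (C1 * cantor_rpot 2 z) \<le> ennreal (C1 * (C2 * 8 ^ cantor_level z))"
      using C1(1) C2(2)[OF z] by (intro ennreal_leI mult_left_mono) auto
    finally have "(\<integral>\<^sup>+w. ennreal ((cmod (sarason_g w))\<^sup>2) * ?k w \<partial>dA) \<le> ennreal A * ennreal (C1 * (C2 * 8 ^ cantor_level z))"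
      by (simp add: mult_left_mono)
    also have "\<dots> = ennreal (A * (C1 * (C2 * 8 ^ cantor_level z)))"
      using A(1) C1(1) C2(1) by (subst ennreal_mult) auto
    finally have "berezin (\<lambda>w. (cmod (sarason_g w))\<^sup>2) z \<le> 4 * (A * (C1 * (C2 * 8 ^ cantor_level z)))"
      using A(1) C1(1) C2(1) z by (intro berezin_le) auto
    then show ?thesis by (simp add: mult_ac)
  qed
  moreover have "4 * (A * C1 * C2) > 0" using A(1) C1(1) C2(1) by simp
  ultimately show ?thesis by blast
qed

text \<open>The balls of radius \<open>4^-m\<close> around \<open>(1 - 2 * 4^-m) t\<close>, where \<open>t\<close> runs through the Cantor set,
  sit at level \<open>m\<close> or \<open>m - 1\<close>, and each scale contributes the same amount to the integral of
  \<open>8^N\<close>, where \<open>N\<close> is the level.\<close>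

definition stolz_mass :: "nat \<Rightarrow> complex \<Rightarrow> ennreal" where
  "stolz_mass m z = (\<integral>\<^sup>+x. (if cmod (z - of_real (1 - 2 / 4 ^ m) * cantor_point x) < 1 / 4 ^ m then 1 else 0) \<partial>unit_leb)"

text \<open>Every disc has normalized area 16^-m whatever x is, and \<mu> has mass 1. The assumption
  m \<ge> 1 keeps 1 - 2 / 4^m positive, so that it is the modulus of the centre and the disc stays
  inside the unit disc.\<close>

lemma nn_integral_stolz_mass:
  assumes m: "m \<ge> 1"
  shows "(\<integral>\<^sup>+z. stolz_mass m z \<partial>dA) = ennreal (1 / 16 ^ m)"
proof -
  interpret P: pair_sigma_finite dA unit_leb ..
  have m4: "4 \<le> (4::real) ^ m" using power_increasing[OF m, of "4::real"] by simp
  then have r: "1 / 4 ^ m \<le> (1/4 :: real)" by (simp add: field_simps)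
  have inner: "(\<integral>\<^sup>+z. (if cmod (z - of_real (1 - 2 / 4 ^ m) * cantor_point x) < 1 / 4 ^ m then 1 else 0) \<partial>dA) = ennreal (1 / 16 ^ m)" for x
  proof -
    let ?c = "of_real (1 - 2 / 4 ^ m) * cantor_point x"
    have c: "cmod ?c = 1 - 2 / 4 ^ m" using r by (simp add: norm_mult del: of_real_diff)
    have sub: "ball ?c (1 / 4 ^ m) \<subseteq> ball 0 1"
    proof
      fix z assume "z \<in> ball ?c (1 / 4 ^ m)"
      then have "cmod (z - ?c) < 1 / 4 ^ m" by (simp add: dist_norm norm_minus_commute)
      then have "cmod z < 1 / 4 ^ m + (1 - 2 / 4 ^ m)" using norm_triangle_sub[of z ?c] c by linarith
      also have "\<dots> < 1" by simp
      finally show "z \<in> ball 0 1" by simp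
    qed
    have "ball ?c (1 / 4 ^ m) \<in> sets dA"
      using sub by (auto simp: sets_dA sets_restrict_space intro!: image_eqI[of _ _ "ball ?c (1 / 4 ^ m)"])
    then have "(\<integral>\<^sup>+z. indicator (ball ?c (1 / 4 ^ m)) z \<partial>dA) = ennreal ((1 / 4 ^ m)\<^sup>2)"
      using emeasure_dA_ball[OF _ sub] by simp
    also have "(1 / 4 ^ m)\<^sup>2 = 1 / (16::real) ^ m"
      by (simp add: power_divide power2_eq_square flip: power_mult_distrib)
    finally show ?thesis
      by (subst nn_integral_cong[where v="indicator (ball ?c (1 / 4 ^ m))"]) (auto simp: dist_norm norm_minus_commute)
  qed
  have "(\<integral>\<^sup>+z. stolz_mass m z \<partial>dA) = (\<integral>\<^sup>+x. (\<integral>\<^sup>+z. (if cmod (z - of_real (1 - 2 / 4 ^ m) * cantor_point x) < 1 / 4 ^ m then 1 else 0) \<partial>dA) \<partial>unit_leb)"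
    unfolding stolz_mass_def by (rule P.Fubini'[symmetric]) measurable
  then show ?thesis by (simp only: inner) (simp add: emeasure_unit_leb)
qed

lemma stolz_mass_le: "stolz_mass m z \<le> ennreal (4 / 2 ^ m)"
proof -
  let ?S = "{x \<in> {0..<1}. cmod (z - cantor_point x) \<le> 3 / 4 ^ m}"
  have "stolz_mass m z \<le> (\<integral>\<^sup>+x. indicator ?S x \<partial>unit_leb)"
    unfolding stolz_mass_def
  proof (rule nn_integral_mono)
    fix x assume x: "x \<in> space unit_leb"
    have "cmod (z - cantor_point x) \<le> 3 / 4 ^ m" if "cmod (z - of_real (1 - 2 / 4 ^ m) * cantor_point x) < 1 / 4 ^ m"
    proof -
      have "z - cantor_point x = (z - of_real (1 - 2 / 4 ^ m) * cantor_point x) - of_real (2 / 4 ^ m) * cantor_point x"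
        by (simp add: algebra_simps)
      then have "cmod (z - cantor_point x) \<le> cmod (z - of_real (1 - 2 / 4 ^ m) * cantor_point x) + cmod (of_real (2 / 4 ^ m) * cantor_point x)"
        by (metis norm_triangle_ineq4)
      also have "cmod (of_real (2 / 4 ^ m) * cantor_point x) = 2 / 4 ^ m" by (simp add: norm_mult norm_divide norm_power)
      finally show ?thesis using that by simp
    qed
    then show "(if cmod (z - of_real (1 - 2 / 4 ^ m) * cantor_point x) < 1 / 4 ^ m then 1 else 0) \<le> (indicator ?S x :: ennreal)"
      using x by auto
  qed
  also have "\<dots> = ennreal (near_mass m z)"
    unfolding near_mass_def by (simp only: nn_integral_indicator[OF sets_near'] unit_leb.emeasure_eq_measure)
  also have "\<dots> \<le> ennreal (4 / 2 ^ m)" by (intro ennreal_leI near_mass_le)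
  finally show ?thesis .
qed

text \<open>A nonzero value provides a Cantor point t with |z - (1 - 2/4^m) t| < 4^-m. From 4^-m < 1
  - |z| \<le> 2 / 4^N follows N \<le> m, and from 1 / (2 * 4^N) < |z - t| < 3 / 4^m follows m \<le>
  N + 1.\<close>

lemma stolz_mass_nonzero:
  assumes m: "m \<ge> 1" and z: "cmod z < 1" and nz: "stolz_mass m z \<noteq> 0"
  shows "m = cantor_level z \<or> m = Suc (cantor_level z)" and "cmod z \<le> 1 - 1 / 4 ^ m"
proof -
  have m4: "4 \<le> (4::real) ^ m" using power_increasing[OF m, of "4::real"] by simp
  then have r: "1 / 4 ^ m \<le> (1/4 :: real)" by (simp add: field_simps)
  have "\<exists>x\<in>{0..<1}. cmod (z - of_real (1 - 2 / 4 ^ m) * cantor_point x) < 1 / 4 ^ m"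
  proof (rule ccontr)
    assume "\<not> ?thesis"
    then have "stolz_mass m z = (\<integral>\<^sup>+x. 0 \<partial>unit_leb)"
      unfolding stolz_mass_def by (intro nn_integral_cong) auto
    then show False using nz by simp
  qed
  then obtain x where x: "x \<in> {0..<1}" and xz: "cmod (z - of_real (1 - 2 / 4 ^ m) * cantor_point x) < 1 / 4 ^ m" by blast
  let ?c = "of_real (1 - 2 / 4 ^ m) * cantor_point x"
  have c: "cmod ?c = 1 - 2 / 4 ^ m" using r by (simp add: norm_mult del: of_real_diff)
  have "cmod z < 1 / 4 ^ m + (1 - 2 / 4 ^ m)" using norm_triangle_sub[of z ?c] c xz by linarith
  then have zm: "1 / 4 ^ m < 1 - cmod z" by simp
  then show "cmod z \<le> 1 - 1 / 4 ^ m" by simp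
  have "1 / 4 ^ m < 2 / (4::real) ^ cantor_level z" using zm one_minus_norm_le_level[OF z] by linarith
  then have "(4::real) ^ cantor_level z < 2 * 4 ^ m" by (simp add: field_simps)
  also have "\<dots> < 4 ^ Suc m" by simp
  finally have "cantor_level z < Suc m" by (rule power_less_imp_less_exp[rotated]) simp
  moreover have "m < Suc (Suc (cantor_level z))"
  proof -
    have "z - cantor_point x = (z - ?c) - of_real (2 / 4 ^ m) * cantor_point x"
      by (simp add: algebra_simps)
    then have "cmod (z - cantor_point x) \<le> cmod (z - ?c) + cmod (of_real (2 / 4 ^ m) * cantor_point x)"
      by (metis norm_triangle_ineq4)
    also have "cmod (of_real (2 / 4 ^ m) * cantor_point x) = 2 / 4 ^ m" by (simp add: norm_mult norm_divide norm_power)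
    finally have "1 / (2 * 4 ^ cantor_level z) < 3 / (4::real) ^ m" using xz cantor_level(2)[OF z x] by simp
    then have "(4::real) ^ m < 6 * 4 ^ cantor_level z" by (simp add: field_simps)
    also have "\<dots> < 4 ^ Suc (Suc (cantor_level z))" by simp
    finally show ?thesis by (rule power_less_imp_less_exp[rotated]) simp
  qed
  ultimately show "m = cantor_level z \<or> m = Suc (cantor_level z)" by linarith
qed

text \<open>Only m = N and m = N + 1 survive, each with a term of at most 4 * 8^m / (m+1); this
  gives 4 + 32 = 36. All discs up to scale M lie in |z| \<le> 1 - 4^-M, so the sum is compatible
  with a cutoff, while its area integral is the harmonic sum of 1 / (m+1).\<close>

lemma sum_stolz_mass_le:
  assumes z: "cmod z < 1"
  shows "(\<Sum>m=1..M. ennreal (16 ^ m / real (Suc m)) * stolz_mass m z) \<le>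
    ennreal (36 * (if cmod z \<le> 1 - 1 / 4 ^ M then 8 ^ cantor_level z / (real (cantor_level z) + 1) else 0))"
proof -
  let ?N = "cantor_level z"
  let ?t = "\<lambda>m. ennreal (16 ^ m / real (Suc m)) * stolz_mass m z"
  have t: "?t m \<le> ennreal (4 * (8 ^ m / real (Suc m)))" for m
  proof -
    have "?t m \<le> ennreal (16 ^ m / real (Suc m)) * ennreal (4 / 2 ^ m)"
      by (intro mult_left_mono stolz_mass_le) auto
    also have "\<dots> = ennreal (16 ^ m / real (Suc m) * (4 / 2 ^ m))" by (subst ennreal_mult) auto
    also have "16 ^ m / real (Suc m) * (4 / 2 ^ m) = 4 * (8 ^ m / real (Suc m))"
    proof -
      have "(16::real) ^ m = 2 ^ m * 8 ^ m" by (simp flip: power_mult_distrib)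
      then show ?thesis by simp
    qed
    finally show ?thesis .
  qed
  show ?thesis
  proof (cases "cmod z \<le> 1 - 1 / 4 ^ M")
    case False
    have "?t m = 0" if "m \<in> {1..M}" for m
    proof (rule ccontr)
      assume "?t m \<noteq> 0"
      then have "cmod z \<le> 1 - 1 / 4 ^ m" using that z by (intro stolz_mass_nonzero(2)) auto
      also have "\<dots> \<le> 1 - 1 / 4 ^ M" using that by (auto intro!: divide_left_mono power_increasing)
      finally show False using False by simp
    qed
    then have "(\<Sum>m=1..M. ?t m) = 0" by (intro sum.neutral) blast
    then show ?thesis by simp
  next
    case True
    have "(\<Sum>m=1..M. ?t m) = (\<Sum>m\<in>{1..M} \<inter> {?N, Suc ?N}. ?t m)"
    proof (rule sum.mono_neutral_right)
      show "\<forall>m\<in>{1..M} - {1..M} \<inter> {?N, Suc ?N}. ?t m = 0"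
        using stolz_mass_nonzero(1)[OF _ z] by fastforce
    qed auto
    also have "\<dots> \<le> (\<Sum>m\<in>{1..M} \<inter> {?N, Suc ?N}. ennreal (4 * (8 ^ m / real (Suc m))))"
      by (intro sum_mono t)
    also have "\<dots> \<le> (\<Sum>m\<in>{?N, Suc ?N}. ennreal (4 * (8 ^ m / real (Suc m))))"
      by (intro sum_mono2) auto
    also have "\<dots> = ennreal (4 * (8 ^ ?N / real (Suc ?N)) + 4 * (8 ^ Suc ?N / real (Suc (Suc ?N))))"
      by (subst ennreal_plus) auto
    also have "\<dots> \<le> ennreal (36 * (8 ^ ?N / (real ?N + 1)))"
    proof (rule ennreal_leI)
      have "8 ^ Suc ?N / real (Suc (Suc ?N)) \<le> 8 * (8 ^ ?N / (real ?N + 1))"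
        by (simp add: frac_le)
      then show "4 * (8 ^ ?N / real (Suc ?N)) + 4 * (8 ^ Suc ?N / real (Suc (Suc ?N))) \<le> 36 * (8 ^ ?N / (real ?N + 1))"
        by (simp add: add.commute)
    qed
    finally show ?thesis using True by simp
  qed
qed

text \<open>Boundedness would bound the integral of |g G|^2 over every smaller disc by one constant
  K. Taking the radius 1 - 4^-M makes this a bound on the M-th partial sum of the harmonic series,
  uniform in M.\<close>

lemma sarason_not_bounded: "\<not> toeplitz_prod_bounded sarason_f sarason_g"
proof
  assume bdd: "toeplitz_prod_bounded sarason_f sarason_g"
  let ?h = "\<lambda>z. (cmod (sarason_g z * test_prim z))\<^sup>2"
  obtain K where K: "\<And>R. 0 < R \<Longrightarrow> R < 1 \<Longrightarrow> (LINT z|dA. (if cmod z \<le> R then ?h z else 0)) \<le> K"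
    using toeplitz_prod_bounded_test[OF bdd sarason_f_A2D sarason_g_A2D _ integrable_test_fun
        integrable_test_fun_div_f holomorphic_test_prim bergman_proj_test_fun]
    by (auto simp: sarason_f_def cantor_pot_nonzero)
  obtain c where c: "c > 0" "\<And>z. cmod z < 1 \<Longrightarrow> c * (8 ^ cantor_level z / (real (cantor_level z) + 1)) \<le> ?h z"
    using norm_sarason_g_test_prim_ge by blast
  have hc: "continuous_on (ball 0 1) (\<lambda>z. sarason_g z * test_prim z)"
    by (intro continuous_intros holomorphic_on_imp_continuous_on holomorphic_sarason_g holomorphic_test_prim)
  then have [measurable]: "(\<lambda>z. sarason_g z * test_prim z) \<in> borel_measurable dA"
    by (rule borel_measurable_dA_continuous_on)
  have bound: "(\<Sum>m=1..M. 1 / real (Suc m)) \<le> 36 / c * K" if M: "M \<ge> 1" for M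
  proof -
    define R where "R = 1 - 1 / (4::real) ^ M"
    have "4 \<le> (4::real) ^ M" using power_increasing[OF M, of "4::real"] by simp
    then have R: "0 < R" "R < 1" by (simp_all add: R_def field_simps)
    let ?H = "\<lambda>z. if cmod z \<le> R then ?h z else 0"
    have m[measurable]: "stolz_mass m \<in> borel_measurable dA" for m
      unfolding stolz_mass_def[abs_def] by measurable
    have "continuous_on (cball 0 R) (\<lambda>z. sarason_g z * test_prim z)"
      by (rule continuous_on_subset[OF hc]) (use R in auto)
    then have "bounded ((\<lambda>z. sarason_g z * test_prim z) ` cball 0 R)"
      by (intro compact_imp_bounded compact_continuous_image) auto
    then obtain B where B: "B > 0" "\<And>z. cmod z \<le> R \<Longrightarrow> cmod (sarason_g z * test_prim z) \<le> B"
      by (auto simp: bounded_pos)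
    have iH: "integrable dA ?H"
    proof (rule dA.integrable_const_bound[of _ "B\<^sup>2"])
      show "AE z in dA. norm (?H z) \<le> B\<^sup>2"
        using B by (intro AE_I2) (auto intro!: power_mono)
    qed measurable
    have "ennreal (\<Sum>m=1..M. 1 / real (Suc m)) = (\<Sum>m=1..M. ennreal (16 ^ m / real (Suc m)) * (\<integral>\<^sup>+z. stolz_mass m z \<partial>dA))"
    proof -
      have "ennreal (16 ^ m / real (Suc m)) * (\<integral>\<^sup>+z. stolz_mass m z \<partial>dA) = ennreal (1 / real (Suc m))" if "m \<in> {1..M}" for m
        using that by (subst nn_integral_stolz_mass) (auto simp: ennreal_mult[symmetric])
      then show ?thesis by (simp add: sum_ennreal[symmetric] del: sum_ennreal)
    qed
    also have "\<dots> = (\<integral>\<^sup>+z. (\<Sum>m=1..M. ennreal (16 ^ m / real (Suc m)) * stolz_mass m z) \<partial>dA)"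
      by (subst nn_integral_sum) (auto simp: nn_integral_cmult)
    also have "\<dots> \<le> (\<integral>\<^sup>+z. ennreal (36 / c * ?H z) \<partial>dA)"
    proof (rule nn_integral_mono)
      fix z assume "z \<in> space dA"
      then have z: "cmod z < 1" by simp
      note sum_stolz_mass_le[OF z, of M]
      also have "ennreal (36 * (if cmod z \<le> 1 - 1 / 4 ^ M then 8 ^ cantor_level z / (real (cantor_level z) + 1) else 0)) \<le> ennreal (36 / c * ?H z)"
      proof (rule ennreal_leI)
        show "36 * (if cmod z \<le> 1 - 1 / 4 ^ M then 8 ^ cantor_level z / (real (cantor_level z) + 1) else 0) \<le> 36 / c * ?H z"
          using c(1) c(2)[OF z] by (auto simp: R_def field_simps)
      qed
      finally show "(\<Sum>m=1..M. ennreal (16 ^ m / real (Suc m)) * stolz_mass m z) \<le> ennreal (36 / c * ?H z)" .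
    qed
    also have "\<dots> = ennreal (LINT z|dA. 36 / c * ?H z)"
      using iH c(1) by (intro nn_integral_eq_integral) auto
    also have "(LINT z|dA. 36 / c * ?H z) = 36 / c * (LINT z|dA. ?H z)" by simp
    finally have "(\<Sum>m=1..M. 1 / real (Suc m)) \<le> 36 / c * (LINT z|dA. ?H z)"
      using c(1) by (subst (asm) ennreal_le_iff) (auto intro!: mult_nonneg_nonneg integral_nonneg_AE AE_I2)
    also have "\<dots> \<le> 36 / c * K" using K[OF R] c(1) by (intro mult_left_mono) auto
    finally show ?thesis .
  qed
  have "\<not> summable (\<lambda>m. 1 / real (Suc m))"
    using not_summable_harmonic[where 'a=real] by (subst summable_Suc_iff) (simp add: inverse_eq_divide)
  moreover have "summable (\<lambda>m. 1 / real (Suc m))"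
  proof (rule bounded_imp_summable[where B="1 + 36 / c * K"])
    fix n
    have "(\<Sum>m\<le>n. 1 / real (Suc m)) \<le> (\<Sum>m\<le>Suc n. 1 / real (Suc m))" by simp
    also have "\<dots> = 1 + (\<Sum>m=1..Suc n. 1 / real (Suc m))"
      by (simp only: atMost_atLeast0 sum.atLeast_Suc_atMost[of 0 "Suc n"]) simp
    also have "\<dots> \<le> 1 + 36 / c * K" by (intro add_left_mono bound) simp
    finally show "(\<Sum>m\<le>n. 1 / real (Suc m)) \<le> 1 + 36 / c * K" .
  qed auto
  ultimately show False by contradiction
qed

theorem theorem1p3:
  shows "\<exists>f g. f \<in> A2D \<and> g \<in> A2D \<and>
     (\<exists>M::real. \<forall>z \<in> ball 0 1.
        berezin (\<lambda>\<zeta>. (cmod (f \<zeta>))\<^sup>2) z * berezin (\<lambda>\<zeta>. (cmod (g \<zeta>))\<^sup>2) z \<le> M) \<and>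
     \<not> toeplitz_prod_bounded f g"
proof -
  obtain C where C: "C > 0" "\<And>z. cmod z < 1 \<Longrightarrow> berezin (\<lambda>w. (cmod (sarason_f w))\<^sup>2) z \<le> C / 8 ^ cantor_level z"
    using berezin_sarason_f by blast
  obtain D where D: "D > 0" "\<And>z. cmod z < 1 \<Longrightarrow> berezin (\<lambda>w. (cmod (sarason_g w))\<^sup>2) z \<le> D * 8 ^ cantor_level z"
    using berezin_sarason_g by blast
  have "berezin (\<lambda>w. (cmod (sarason_f w))\<^sup>2) z * berezin (\<lambda>w. (cmod (sarason_g w))\<^sup>2) z \<le> C * D"
    if "z \<in> ball 0 1" for z
  proof -
    have z: "cmod z < 1" using that by simp
    \<comment> \<open>Multiplying the two upper bounds requires a sign for one factor; after that
      the powers 8^N of the common level cancel.\<close>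
    have "berezin (\<lambda>w. (cmod (sarason_g w))\<^sup>2) z \<ge> 0"
      unfolding berezin_def by (rule integral_nonneg_AE) auto
    then have "berezin (\<lambda>w. (cmod (sarason_f w))\<^sup>2) z * berezin (\<lambda>w. (cmod (sarason_g w))\<^sup>2) z
        \<le> C / 8 ^ cantor_level z * (D * 8 ^ cantor_level z)"
      using C(1) C(2)[OF z] D(2)[OF z] by (intro mult_mono) auto
    then show ?thesis by simp
  qed
  then show ?thesis
    using sarason_f_A2D sarason_g_A2D sarason_not_bounded by blast
qed

end
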